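(* Let $F$ be a Steiner bundle over $\mathbb{G}(k,n)$, given by a resolution $0\to S\otimes\mathcal{U}\to T\otimes\mathcal{O}_{\mathbb{G}}\to F\to 0$. Then $$\operatorname{rk} F\ \geq\ \min\big((k+1)(n-k),\ (n-k)\dim S\big).$$
   Context: $\mathbb{K}$ is an algebraically closed field of characteristic $0$. For a vector space $V$ of dimension $n+1$ over $\mathbb{K}$, $\mathbb{P}^n=\mathbb{P}(V)$ is the projective space whose points are the lines of $V^*$, and $\mathbb{G}=\mathbb{G}(k,n)=\mathbb{G}(k,\mathbb{P}(V))$ is the Grassmannian $G(k+1,V^* )$ of $(k+1)$-dimensional linear subspaces of $V^*$. $\mathcal{U}\to\mathbb{G}(k,n)$ is the universal (tautological sub-)bundle of rank $k+1$, and $\mathcal{O}_{\mathbb{G}}$ is the trivial line bundle. Given vector spaces $S,T$ over $\mathbb{K}$ of dimensions $s$ and $t$, an $(s,t)$-Steiner bundle over $\mathbb{G}(k,n)$ is a vector bundle $F$ defined by a resolution (exact sequence of vector bundles) $0\to S\otimes\mathcal{U}\to T\otimes\mathcal{O}_{\mathbb{G}}\to F\to 0$. *)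

theory Defs
  imports
    "HOL-Library.Function_Algebras"
    "HOL-Analysis.Abstract_Topology"
    "HOL-Computational_Algebra.Polynomial"
    "Jordan_Normal_Form.Determinant"
begin

text \<open>Scalar multiplication of functions with values in a vector space, pointwise.
  Addition of functions is pointwise by \<^theory>\<open>HOL-Library.Function_Algebras\<close>.\<close>

definition fscale :: "('k \<Rightarrow> 'e \<Rightarrow> 'e) \<Rightarrow> 'k \<Rightarrow> ('i \<Rightarrow> 'e) \<Rightarrow> 'i \<Rightarrow> 'e"
  where "fscale sc c f = (\<lambda>i. sc c (f i))"

lemma vector_space_fscale:
  assumes "vector_space sc"
  shows "vector_space (fscale sc)"
proof -
  interpret vector_space sc by fact
  show ?thesis
    by unfold_locales
      (auto simp: fscale_def fun_eq_iff scale_right_distrib scale_left_distrib)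
qed

definition indexed_basis ::
  "('k::field \<Rightarrow> 'e::ab_group_add \<Rightarrow> 'e) \<Rightarrow> nat \<Rightarrow> (nat \<Rightarrow> 'e) \<Rightarrow> 'e set \<Rightarrow> bool"
  where "indexed_basis sc r e A \<longleftrightarrow>
    inj_on e {..<r} \<and> \<not> module.dependent sc (e ` {..<r}) \<and> module.span sc (e ` {..<r}) = A"

definition dual_space :: "('k::field \<Rightarrow> 'e::ab_group_add \<Rightarrow> 'e) \<Rightarrow> ('e \<Rightarrow> 'k) set"
  where "dual_space sc = {l. Vector_Spaces.linear sc (*) l}"

text \<open>The tensor product of \<open>S\<close> with a subspace \<open>A\<close> of \<open>E\<close>. The elementary tensor of \<open>s\<close> and
  \<open>e\<close> is realised as the \<open>S\<close>-valued function on the dual of \<open>E\<close> that sends \<open>l\<close> to \<open>l e \<cdot> s\<close>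
  (extended by \<open>0\<close> to non-linear functions). Since the dual separates the points of \<open>E\<close>, the
  canonical map from the algebraic tensor product to these functions is injective, so the span of
  the elementary tensors is a model of the tensor product: see \<open>tensor_elem_sum_eq_0\<close>.\<close>

definition tensor_elem ::
  "('k::field \<Rightarrow> 's::ab_group_add \<Rightarrow> 's) \<Rightarrow> ('k \<Rightarrow> 'e::ab_group_add \<Rightarrow> 'e) \<Rightarrow>
   's \<Rightarrow> 'e \<Rightarrow> ('e \<Rightarrow> 'k) \<Rightarrow> 's"
  where "tensor_elem sS sE s e = (\<lambda>l. if l \<in> dual_space sE then sS (l e) s else 0)"

definition tensor_space ::
  "('k::field \<Rightarrow> 's::ab_group_add \<Rightarrow> 's) \<Rightarrow> ('k \<Rightarrow> 'e::ab_group_add \<Rightarrow> 'e) \<Rightarrow>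
   'e set \<Rightarrow> (('e \<Rightarrow> 'k) \<Rightarrow> 's) set"
  where "tensor_space sS sE A = module.span (fscale sS) {tensor_elem sS sE s e | s e. e \<in> A}"

context
  fixes sS :: "'k::field \<Rightarrow> 's::ab_group_add \<Rightarrow> 's" and sE :: "'k \<Rightarrow> 'e::ab_group_add \<Rightarrow> 'e"
  assumes S: "vector_space sS" and E: "vector_space sE"
begin

interpretation S: vector_space sS by (rule S)
interpretation E: vector_space sE by (rule E)

lemma tensor_elem_bilinear:
  "tensor_elem sS sE (s + s') e = tensor_elem sS sE s e + tensor_elem sS sE s' e"
  "tensor_elem sS sE s (e + e') = tensor_elem sS sE s e + tensor_elem sS sE s e'"
  "tensor_elem sS sE (sS c s) e = fscale sS c (tensor_elem sS sE s e)"
  "tensor_elem sS sE s (sE c e) = fscale sS c (tensor_elem sS sE s e)"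
proof -
  have "l (e + e') = l e + l e'" "l (sE c e) = c * l e" if "l \<in> dual_space sE" for l
    using that Vector_Spaces.linear_iff[of sE "(*)" l] unfolding dual_space_def by auto
  note lin = this
  show "tensor_elem sS sE (s + s') e = tensor_elem sS sE s e + tensor_elem sS sE s' e"
    "tensor_elem sS sE (sS c s) e = fscale sS c (tensor_elem sS sE s e)"
    by (auto simp: tensor_elem_def fscale_def fun_eq_iff S.scale_right_distrib mult.commute)
  show "tensor_elem sS sE s (e + e') = tensor_elem sS sE s e + tensor_elem sS sE s e'"
    using lin(1) by (force simp: tensor_elem_def fun_eq_iff simp flip: S.scale_left_distrib)
  show "tensor_elem sS sE s (sE c e) = fscale sS c (tensor_elem sS sE s e)"
    using lin(2) by (force simp: tensor_elem_def fscale_def fun_eq_iff)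
qed

lemma tensor_elem_sum_eq_0:
  assumes fin: "finite I" and inj: "inj_on s I" and indep: "\<not> S.dependent (s ` I)"
    and zero: "(\<Sum>i\<in>I. tensor_elem sS sE (s i) (e i)) = 0" and i: "i \<in> I"
  shows "e i = 0"
proof (rule ccontr)
  assume "e i \<noteq> 0"
  interpret EK: vector_space_pair sE "(*) :: 'k \<Rightarrow> 'k \<Rightarrow> 'k"
    by unfold_locales (auto simp: algebra_simps)
  have "\<not> E.dependent {e i}"
    using \<open>e i \<noteq> 0\<close> by simp
  from EK.linear_independent_extend[OF this, of "\<lambda>_. 1"]
  obtain l where l: "Vector_Spaces.linear sE (*) l" "l (e i) = 1" by auto
  have "(\<Sum>j\<in>I. tensor_elem sS sE (s j) (e j)) l = (\<Sum>j\<in>I. sS (l (e j)) (s j))"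
    using fin by (induction I rule: finite_induct)
      (auto simp: tensor_elem_def dual_space_def l(1))
  with zero have "(\<Sum>j\<in>I. sS (l (e j)) (s j)) = 0" by simp
  moreover have "(\<Sum>j\<in>I. sS (l (e j)) (s j)) =
      (\<Sum>v\<in>s ` I. sS (l (e (the_inv_into I s v))) v)"
    using inj by (subst sum.reindex) (auto simp: the_inv_into_f_f)
  ultimately have "l (e (the_inv_into I s (s i))) = 0"
    using S.independentD[OF indep, of "s ` I" "\<lambda>v. l (e (the_inv_into I s v))" "s i"] fin i
    by auto
  with l inj i show False by (simp add: the_inv_into_f_f)
qed

end

text \<open>The vector space \<open>V\<close> is the type \<open>'v\<close> with scalar multiplication \<open>sV\<close>. Points of the
  Grassmannian are the \<open>(k+1)\<close>-dimensional subspaces of the dual of \<open>V\<close>.\<close>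

definition grassmannian ::
  "('k::field \<Rightarrow> 'v::ab_group_add \<Rightarrow> 'v) \<Rightarrow> nat \<Rightarrow> ('v \<Rightarrow> 'k) set set"
  where "grassmannian sV k =
    {L. L \<subseteq> dual_space sV \<and> module.subspace (fscale (*)) L \<and> vector_space.dim (fscale (*)) L = k + 1}"

text \<open>The Pluecker coordinates of the subspace with basis \<open>\<xi> 0, \<dots>, \<xi> k\<close>, indexed by all families
  \<open>v 0, \<dots>, v k\<close> of vectors of \<open>V\<close>: the values of \<open>\<xi> 0 \<and> \<dots> \<and> \<xi> k\<close>. Another
  basis multiplies all of them by one non-zero scalar.\<close>

definition pluecker :: "nat \<Rightarrow> (nat \<Rightarrow> 'v \<Rightarrow> 'k::field) \<Rightarrow> (nat \<Rightarrow> 'v) \<Rightarrow> 'k"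
  where "pluecker k \<xi> v = det (mat (k + 1) (k + 1) (\<lambda>(i, j). \<xi> i (v j)))"

text \<open>Homogeneous polynomials of a given degree, as functions of coordinates \<open>p i\<close>.\<close>

inductive hom_poly :: "nat \<Rightarrow> (('i \<Rightarrow> 'k::field) \<Rightarrow> 'k) \<Rightarrow> bool" where
  const: "hom_poly 0 (\<lambda>p. c)"
| coord: "hom_poly 1 (\<lambda>p. p i)"
| add: "hom_poly d P \<Longrightarrow> hom_poly d Q \<Longrightarrow> hom_poly d (\<lambda>p. P p + Q p)"
| mult: "hom_poly d P \<Longrightarrow> hom_poly e Q \<Longrightarrow> hom_poly (d + e) (\<lambda>p. P p * Q p)"

text \<open>The locus where a homogeneous polynomial in the Pluecker coordinates does not vanish; these
  loci form a basis of the Zariski topology.\<close>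

definition basic_open ::
  "('k::field \<Rightarrow> 'v::ab_group_add \<Rightarrow> 'v) \<Rightarrow> nat \<Rightarrow> (((nat \<Rightarrow> 'v) \<Rightarrow> 'k) \<Rightarrow> 'k) \<Rightarrow> ('v \<Rightarrow> 'k) set set"
  where "basic_open sV k P =
    {L \<in> grassmannian sV k. \<forall>\<xi>. indexed_basis (fscale (*)) (k + 1) \<xi> L \<longrightarrow> P (pluecker k \<xi>) \<noteq> 0}"

definition zariski ::
  "('k::field \<Rightarrow> 'v::ab_group_add \<Rightarrow> 'v) \<Rightarrow> nat \<Rightarrow> ('v \<Rightarrow> 'k) set topology"
  where "zariski sV k = topology_generated_by {basic_open sV k P | P d. hom_poly d P}"

text \<open>The structure sheaf: functions that are locally quotients of homogeneous polynomials of the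
  same degree in the Pluecker coordinates. Values outside the open set \<open>W\<close> are irrelevant.\<close>

definition regular_on ::
  "('k::field \<Rightarrow> 'v::ab_group_add \<Rightarrow> 'v) \<Rightarrow> nat \<Rightarrow> ('v \<Rightarrow> 'k) set set \<Rightarrow> (('v \<Rightarrow> 'k) set \<Rightarrow> 'k) set"
  where "regular_on sV k W = {f. \<forall>L\<in>W. \<exists>U d P Q.
    openin (zariski sV k) U \<and> L \<in> U \<and> U \<subseteq> W \<and> hom_poly d P \<and> hom_poly d Q \<and>
    (\<forall>M\<in>U. \<forall>\<xi>. indexed_basis (fscale (*)) (k + 1) \<xi> M \<longrightarrow>
      Q (pluecker k \<xi>) \<noteq> 0 \<and> f M = P (pluecker k \<xi>) / Q (pluecker k \<xi>))}"

text \<open>A vector bundle over a space is given by its fibres, which are subspaces of an ambient vector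
  space (of arbitrary dimension) with scalar multiplication \<open>scl\<close>, and its regular
  sections over open sets. A section over \<open>W\<close> is a total function whose values outside
  \<open>W\<close> are irrelevant.\<close>

record ('x, 'k, 'e) vbundle =
  scl :: "'k \<Rightarrow> 'e \<Rightarrow> 'e"
  fibre :: "'x \<Rightarrow> 'e set"
  sections :: "'x set \<Rightarrow> ('x \<Rightarrow> 'e) set"

text \<open>In the following, \<open>X\<close> is the topology of the base and \<open>Reg\<close> its sheaf of regular functions.
  A vector bundle of rank \<open>r\<close> has a sheaf of sections, and near every point \<open>r\<close> sections which
  are a basis of each fibre and such that a section is regular iff its coordinates are.\<close>

definition vector_bundle ::
  "'x topology \<Rightarrow> ('x set \<Rightarrow> ('x \<Rightarrow> 'k::field) set) \<Rightarrow> ('x, 'k, 'e::ab_group_add) vbundle \<Rightarrow> nat \<Rightarrow> bool"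
  where "vector_bundle X Reg E r \<longleftrightarrow>
    vector_space (scl E) \<and>
    (\<forall>x\<in>topspace X. module.subspace (scl E) (fibre E x)) \<and>
    (\<forall>W U \<sigma>. openin X W \<longrightarrow> openin X U \<longrightarrow> U \<subseteq> W \<longrightarrow> \<sigma> \<in> sections E W \<longrightarrow> \<sigma> \<in> sections E U) \<and>
    (\<forall>W \<sigma>. openin X W \<longrightarrow> (\<forall>x\<in>W. \<exists>U. openin X U \<and> x \<in> U \<and> U \<subseteq> W \<and> \<sigma> \<in> sections E U) \<longrightarrow>
      \<sigma> \<in> sections E W) \<and>
    (\<forall>x\<in>topspace X. \<exists>U e. openin X U \<and> x \<in> U \<and>
      (\<forall>y\<in>U. indexed_basis (scl E) r (\<lambda>i. e i y) (fibre E y)) \<and>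
      (\<forall>W \<sigma>. openin X W \<longrightarrow> W \<subseteq> U \<longrightarrow>
        (\<sigma> \<in> sections E W \<longleftrightarrow>
          (\<exists>c. (\<forall>i<r. c i \<in> Reg W) \<and> (\<forall>y\<in>W. \<sigma> y = (\<Sum>i<r. scl E (c i y) (e i y)))))))"

definition bundle_hom ::
  "'x topology \<Rightarrow> ('x, 'k, 'e::ab_group_add) vbundle \<Rightarrow> ('x, 'k, 'f::ab_group_add) vbundle \<Rightarrow>
   ('x \<Rightarrow> 'e \<Rightarrow> 'f) \<Rightarrow> bool"
  where "bundle_hom X E F \<phi> \<longleftrightarrow>
    (\<forall>x\<in>topspace X. \<phi> x ` fibre E x \<subseteq> fibre F x \<and>
      (\<forall>a\<in>fibre E x. \<forall>b\<in>fibre E x. \<phi> x (a + b) = \<phi> x a + \<phi> x b) \<and>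
      (\<forall>c. \<forall>a\<in>fibre E x. \<phi> x (scl E c a) = scl F c (\<phi> x a))) \<and>
    (\<forall>W. openin X W \<longrightarrow> (\<forall>\<sigma>\<in>sections E W. (\<lambda>y. \<phi> y (\<sigma> y)) \<in> sections F W))"

text \<open>Exactness of \<open>0 \<rightarrow> A \<rightarrow> B \<rightarrow> C \<rightarrow> 0\<close> for vector bundles means exactness in every fibre. For
  bundles (locally free sheaves) this is the same as exactness of the sequence of sheaves of
  sections.\<close>

definition short_exact_bundles ::
  "'x topology \<Rightarrow> ('x, 'k, 'a::ab_group_add) vbundle \<Rightarrow> ('x \<Rightarrow> 'a \<Rightarrow> 'b) \<Rightarrow>
   ('x, 'k, 'b::ab_group_add) vbundle \<Rightarrow> ('x \<Rightarrow> 'b \<Rightarrow> 'c) \<Rightarrow> ('x, 'k, 'c::ab_group_add) vbundle \<Rightarrow> bool"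
  where "short_exact_bundles X A \<phi> B \<psi> C \<longleftrightarrow>
    bundle_hom X A B \<phi> \<and> bundle_hom X B C \<psi> \<and>
    (\<forall>x\<in>topspace X.
      inj_on (\<phi> x) (fibre A x) \<and>
      \<phi> x ` fibre A x = {b \<in> fibre B x. \<psi> x b = 0} \<and>
      \<psi> x ` fibre B x = fibre C x)"

definition trivial_line_bundle :: "('x set \<Rightarrow> ('x \<Rightarrow> 'k::field) set) \<Rightarrow> ('x, 'k, 'k) vbundle"
  where "trivial_line_bundle Reg = \<lparr>scl = (*), fibre = (\<lambda>x. UNIV), sections = Reg\<rparr>"

text \<open>The tensor product of a finite-dimensional vector space with a bundle. Sections are finite
  sums of \<open>s \<otimes> \<tau>\<close> for sections \<open>\<tau>\<close>; as the vector space is finite-dimensional, this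
  presheaf is already a sheaf.\<close>

definition tensor_bundle ::
  "('k::field \<Rightarrow> 's::ab_group_add \<Rightarrow> 's) \<Rightarrow> ('x, 'k, 'e::ab_group_add) vbundle \<Rightarrow>
   ('x, 'k, ('e \<Rightarrow> 'k) \<Rightarrow> 's) vbundle"
  where "tensor_bundle sS E =
    \<lparr>scl = fscale sS,
     fibre = (\<lambda>x. tensor_space sS (scl E) (fibre E x)),
     sections = (\<lambda>W. {\<sigma>. \<exists>(m::nat) s \<tau>. (\<forall>i<m. \<tau> i \<in> sections E W) \<and>
       (\<forall>x\<in>W. \<sigma> x = (\<Sum>i<m. tensor_elem sS (scl E) (s i) (\<tau> i x)))})\<rparr>"

text \<open>The tautological bundle, a subbundle of the trivial bundle with fibre the dual of \<open>V\<close>: its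
  regular sections are the regular dual-valued maps \<open>\<sigma>\<close> with \<open>\<sigma> L \<in> L\<close>; regularity is tested
  on the coordinates of the dual, that is on the evaluations at vectors of \<open>V\<close>.\<close>

definition universal_bundle ::
  "('k::field \<Rightarrow> 'v::ab_group_add \<Rightarrow> 'v) \<Rightarrow> nat \<Rightarrow> (('v \<Rightarrow> 'k) set, 'k, 'v \<Rightarrow> 'k) vbundle"
  where "universal_bundle sV k =
    \<lparr>scl = fscale (*),
     fibre = (\<lambda>L. L),
     sections = (\<lambda>W. {\<sigma>. (\<forall>L\<in>W. \<sigma> L \<in> L) \<and> (\<forall>v. (\<lambda>L. \<sigma> L v) \<in> regular_on sV k W)})\<rparr>"

definition steiner_resolution ::
  "('k::field \<Rightarrow> 'v::ab_group_add \<Rightarrow> 'v) \<Rightarrow> nat \<Rightarrow>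
   ('k \<Rightarrow> 's::ab_group_add \<Rightarrow> 's) \<Rightarrow> ('k \<Rightarrow> 't::ab_group_add \<Rightarrow> 't) \<Rightarrow>
   (('v \<Rightarrow> 'k) set \<Rightarrow> ((('v \<Rightarrow> 'k) \<Rightarrow> 'k) \<Rightarrow> 's) \<Rightarrow> (('k \<Rightarrow> 'k) \<Rightarrow> 't)) \<Rightarrow>
   (('v \<Rightarrow> 'k) set \<Rightarrow> (('k \<Rightarrow> 'k) \<Rightarrow> 't) \<Rightarrow> 'f) \<Rightarrow>
   (('v \<Rightarrow> 'k) set, 'k, 'f::ab_group_add) vbundle \<Rightarrow> bool"
  where "steiner_resolution sV k sS sT \<phi> \<psi> F \<longleftrightarrow>
    short_exact_bundles (zariski sV k)
      (tensor_bundle sS (universal_bundle sV k)) \<phi>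
      (tensor_bundle sT (trivial_line_bundle (regular_on sV k))) \<psi> F"

end

theory Submission
  imports Defs "Jordan_Normal_Form.Char_Poly"
begin

text \<open>For \<open>k = n\<close> the claimed bound is \<open>0\<close>, so let \<open>k < n\<close>. Put \<open>m = k + 1\<close>, \<open>N = n + 1\<close>, \<open>s = dim S\<close> and \<open>t = dim T\<close>. Exactness in one fibre bounds \<open>t\<close> by \<open>s * m + rk F\<close>
(\<open>dim_T_le\<close>), so the theorem amounts to a lower bound for \<open>t\<close>.

The map \<open>\<phi>\<close> is given by a single linear map \<open>f\<close> from \<open>S \<otimes> V\<^sup>*\<close> to \<open>T\<close>, because the homomorphisms from the
tautological bundle to the trivial line bundle are the evaluations at vectors of \<open>V\<close>. Indeed, consider such a
homomorphism along the pencil of all \<open>\<langle>C, x \<eta>0 + y \<eta>1\<rangle>\<close>, where \<open>C\<close> is spanned by \<open>k\<close> functionals. Its value at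
\<open>x \<eta>0 + y \<eta>1\<close> is a section of \<open>O(1)\<close> on the projective line, hence linear in \<open>(x, y)\<close> (\<open>pencil_additive\<close>). It
follows that the value at a functional does not depend on the subspace in which the functional is considered
(\<open>exchange_bases\<close>), and that this value is additive (\<open>linear_extension\<close>).

Since \<open>\<phi>\<close> is injective in every fibre, the kernel of \<open>f\<close> contains no non-zero element of \<open>S \<otimes> L\<close> for any
\<open>m\<close>-dimensional \<open>L\<close>. In coordinates, no non-zero \<open>s \<times> N\<close> matrix in the kernel has rank at most \<open>m\<close>. The
matrices of rank at most \<open>m' = min m s\<close> form a closed cone of dimension \<open>m' * (s + N - m')\<close>, and a linear space that
meets a closed cone in the origin only has at least the dimension of the cone as its codimension. Therefore
\<open>t \<ge> m' * (s + N - m')\<close> (\<open>linear_space_avoiding_rank_le\<close>, \<open>dim_T_ge\<close>), and the theorem follows by distinguishing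
\<open>s \<le> m\<close> and \<open>s \<ge> m\<close>.

The statement about cones (\<open>linear_section_dimension_bound\<close>) is proved by counting. If \<open>c\<close> linear forms have no common
zero on the cone except the origin, then by the Nullstellensatz a power of every coordinate is, on the cone, a
combination of these forms. Hence polynomials of degree at most \<open>d\<close> restrict to a space of dimension \<open>O(d ^ c)\<close>,
whereas \<open>q\<close> algebraically independent coordinates contribute about \<open>d ^ q\<close> independent monomials, so that \<open>q \<le> c\<close>. The
Nullstellensatz itself (\<open>weak_nullstellensatz\<close>) is proved for ideals of polynomial functions by induction on the
number of variables; a determinant takes the place of resultants.\<close>

section \<open>Polynomial functions\<close>

lemma fun_sum_apply: "sum g A x = (\<Sum>a\<in>A. g a x)"
  by (induction A rule: infinite_finite_induct) auto

text \<open>Polynomials are represented by the functions that they induce on \<open>'i \<Rightarrow> 'k\<close>; over an infinite field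
nothing is lost. Functions form a commutative ring under the pointwise operations, so univariate
polynomials and determinants over this ring are at hand. The second argument of \<open>polyfun\<close> bounds
the total degree from above; only the variables in \<open>J\<close> may occur.\<close>

inductive polyfun :: "'i set \<Rightarrow> nat \<Rightarrow> (('i \<Rightarrow> 'k::field) \<Rightarrow> 'k) \<Rightarrow> bool" for J where
  const: "polyfun J 0 (\<lambda>_. c)"
| coord: "i \<in> J \<Longrightarrow> polyfun J (Suc 0) (\<lambda>x. x i)"
| raise: "polyfun J d p \<Longrightarrow> d \<le> e \<Longrightarrow> polyfun J e p"
| add: "polyfun J d p \<Longrightarrow> polyfun J d q \<Longrightarrow> polyfun J d (p + q)"
| mult: "polyfun J d p \<Longrightarrow> polyfun J e q \<Longrightarrow> polyfun J (d + e) (p * q)"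

definition Pol :: "'i set \<Rightarrow> (('i \<Rightarrow> 'k::field) \<Rightarrow> 'k) set"
  where "Pol J = {p. \<exists>d. polyfun J d p}"

lemma polyfun_const: "polyfun J d (\<lambda>_. c)"
  using polyfun.raise[OF polyfun.const] by blast

lemma polyfun_0: "polyfun J d 0"
  using polyfun_const[of J d 0] by (simp add: zero_fun_def)

lemma polyfun_scale: "polyfun J d p \<Longrightarrow> polyfun J d ((\<lambda>_. c) * p)"
  using polyfun.mult[OF polyfun.const, of J d p c] by simp

lemma polyfun_add_max: "polyfun J d p \<Longrightarrow> polyfun J e q \<Longrightarrow> polyfun J (max d e) (p + q)"
  by (intro polyfun.add) (erule polyfun.raise, simp)+

lemma polyfun_sum: "(\<And>a. a \<in> A \<Longrightarrow> polyfun J d (f a)) \<Longrightarrow> polyfun J d (sum f A)"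
  by (induction A rule: infinite_finite_induct) (auto intro: polyfun_0 polyfun.add)

lemma Pol_const [simp]: "(\<lambda>_. c) \<in> Pol J"
  unfolding Pol_def by (rule CollectI, rule exI, rule polyfun.const)

lemma Pol_0 [intro]: "0 \<in> Pol J"
  using Pol_const[of 0 J] by (simp add: zero_fun_def)

lemma Pol_1 [intro]: "1 \<in> Pol J"
  using Pol_const[of 1 J] by (simp add: one_fun_def)

lemma Pol_coord: "i \<in> J \<Longrightarrow> (\<lambda>x. x i) \<in> Pol J"
  unfolding Pol_def by (rule CollectI, rule exI, rule polyfun.coord)

lemma Pol_add [intro]: assumes "p \<in> Pol J" "q \<in> Pol J" shows "p + q \<in> Pol J"
proof -
  from assms obtain d e where "polyfun J d p" "polyfun J e q" by (auto simp: Pol_def)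
  then show ?thesis unfolding Pol_def using polyfun_add_max by blast
qed

lemma Pol_mult [intro]: "p \<in> Pol J \<Longrightarrow> q \<in> Pol J \<Longrightarrow> p * q \<in> Pol J"
  unfolding Pol_def using polyfun.mult by blast

lemma Pol_uminus [intro]: assumes "p \<in> Pol J" shows "- p \<in> Pol J"
proof -
  have "- p = (\<lambda>_. - 1) * p" by (simp add: fun_eq_iff)
  then show ?thesis using Pol_mult[OF Pol_const assms] by metis
qed

lemma Pol_diff [intro]: "p \<in> Pol J \<Longrightarrow> q \<in> Pol J \<Longrightarrow> p - q \<in> Pol J"
  using Pol_add[OF _ Pol_uminus, of p J q] by simp

lemma Pol_sum: "(\<And>a. a \<in> A \<Longrightarrow> f a \<in> Pol J) \<Longrightarrow> sum f A \<in> Pol J"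
  by (induction A rule: infinite_finite_induct) auto

lemma Pol_prod: "(\<And>a. a \<in> A \<Longrightarrow> f a \<in> Pol J) \<Longrightarrow> prod f A \<in> Pol J"
  by (induction A rule: infinite_finite_induct) auto

lemma Pol_power: "p \<in> Pol J \<Longrightarrow> p ^ n \<in> Pol J"
  by (induction n) auto

lemma Pol_of_sign: "of_int (sign \<pi>) \<in> Pol J"
  by (cases "sign \<pi> = 1") (auto simp: sign_def)

lemma Pol_det:
  assumes "\<And>i j. i < dim_row A \<Longrightarrow> j < dim_col A \<Longrightarrow> A $$ (i, j) \<in> Pol J"
  shows "det A \<in> Pol J"
proof (cases "dim_row A = dim_col A")
  case True
  then show ?thesis unfolding det_def using assms
    by (auto intro!: Pol_sum Pol_mult Pol_prod Pol_of_sign dest: permutes_in_image)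
qed (auto simp: det_def)

lemma Pol_mono: assumes "J \<subseteq> J'" "p \<in> Pol J" shows "p \<in> Pol J'"
proof -
  from assms(2) obtain d where "polyfun J d p" by (auto simp: Pol_def)
  then have "polyfun J' d p"
  proof induction
    case (coord i)
    with assms(1) show ?case by (intro polyfun.coord) auto
  qed (rule polyfun.intros; assumption)+
  then show ?thesis by (auto simp: Pol_def)
qed

lemma Pol_cong:
  assumes "p \<in> Pol J" "\<And>i. i \<in> J \<Longrightarrow> x i = y i" shows "p x = p y"
proof -
  from assms(1) obtain d where "polyfun J d p" by (auto simp: Pol_def)
  then show ?thesis by induction (use assms(2) in auto)
qed

lemma Pol_compose:
  assumes "p \<in> Pol J" "\<And>i. i \<in> J \<Longrightarrow> (\<lambda>x. u x i) \<in> Pol J'"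
  shows "(\<lambda>x. p (u x)) \<in> Pol J'"
proof -
  from assms(1) obtain d where "polyfun J d p" by (auto simp: Pol_def)
  then show ?thesis
  proof induction
    case (add d p q)
    from Pol_add[OF add.IH] show ?case by (simp add: plus_fun_def)
  next
    case (mult d p e q)
    from Pol_mult[OF mult.IH] show ?case by (simp add: times_fun_def)
  qed (use assms(2) in auto)
qed

lemma polyfun_compose_linear:
  assumes "polyfun J d p" "\<And>i. i \<in> J \<Longrightarrow> polyfun J' (Suc 0) (\<lambda>x. u x i)"
  shows "polyfun J' d (\<lambda>x. p (u x))"
  using assms(1)
proof induction
  case (add d p q)
  from polyfun.add[OF add.IH] show ?case by (simp add: plus_fun_def)
next
  case (mult d p e q)
  from polyfun.mult[OF mult.IH] show ?case by (simp add: times_fun_def)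
next
  case (raise d p e)
  from polyfun.raise[OF raise.IH raise.hyps(2)] show ?case .
qed (auto intro: assms(2) polyfun_const)

lemma polyfun_line:
  assumes "polyfun J d p"
  shows "\<exists>u. degree u \<le> d \<and> (\<forall>s. p (\<lambda>i. x i + s * w i) = poly u s)"
  using assms
proof induction
  case (const c)
  show ?case by (rule exI[of _ "[:c:]"]) simp
next
  case (coord i)
  show ?case by (rule exI[of _ "[:x i, w i:]"]) simp
next
  case (raise d p e)
  then show ?case using le_trans by blast
next
  case (add d p q)
  then obtain u v where "degree u \<le> d" "degree v \<le> d"
    "\<forall>s. p (\<lambda>i. x i + s * w i) = poly u s" "\<forall>s. q (\<lambda>i. x i + s * w i) = poly v s" by blast
  then show ?case by (intro exI[of _ "u + v"]) (auto intro: degree_add_le)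
next
  case (mult d p e q)
  then obtain u v where "degree u \<le> d" "degree v \<le> e"
    "\<forall>s. p (\<lambda>i. x i + s * w i) = poly u s" "\<forall>s. q (\<lambda>i. x i + s * w i) = poly v s" by blast
  then show ?case
    by (intro exI[of _ "u * v"]) (auto intro: order.trans[OF degree_mult_le])
qed

lemma polyfun_0_const: "polyfun J d p \<Longrightarrow> d = 0 \<Longrightarrow> \<exists>c. p = (\<lambda>_. c)"
  by (induction rule: polyfun.induct) (auto simp: plus_fun_def times_fun_def)

definition homogeneous :: "nat \<Rightarrow> (('i \<Rightarrow> 'k::field) \<Rightarrow> 'k) \<Rightarrow> bool"
  where "homogeneous d h \<longleftrightarrow> (\<forall>c x. h (\<lambda>i. c * x i) = c ^ d * h x)"

text \<open>Splits off the homogeneous part of degree \<open>d\<close>; the rest is \<open>0\<close> or of smaller degree. Applied with the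
least possible \<open>d\<close>, the homogeneous part is non-zero.\<close>

lemma polyfun_top_form:
  assumes "polyfun J d p"
  shows "\<exists>h q. p = h + q \<and> polyfun J d h \<and> homogeneous d h \<and> (q = 0 \<or> (\<exists>e<d. polyfun J e q))"
  using assms unfolding homogeneous_def
proof induction
  case (const c)
  show ?case by (rule exI[of _ "\<lambda>_. c"], rule exI[of _ 0]) (auto intro: polyfun.const)
next
  case (coord i)
  then show ?case by (intro exI[of _ "\<lambda>x. x i"] exI[of _ 0]) (auto intro: polyfun.coord)
next
  case (raise d p e)
  show ?case
  proof (cases "d = e")
    case False
    with raise(2) have "d < e" by simp
    moreover from this have "(0 :: ('a \<Rightarrow> 'b) \<Rightarrow> 'b) x = c ^ e * 0" for x c by simp
    ultimately show ?thesis using raise(1)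
      by (intro exI[of _ 0] exI[of _ p] conjI polyfun_0) auto
  next
    case True
    with raise.IH show ?thesis by blast
  qed
next
  case (add d p q)
  then obtain h1 q1 h2 q2 where *: "p = h1 + q1" "polyfun J d h1"
    "\<forall>c x. h1 (\<lambda>i. c * x i) = c ^ d * h1 x" "q1 = 0 \<or> (\<exists>e<d. polyfun J e q1)"
    "q = h2 + q2" "polyfun J d h2"
    "\<forall>c x. h2 (\<lambda>i. c * x i) = c ^ d * h2 x" "q2 = 0 \<or> (\<exists>e<d. polyfun J e q2)" by blast
  have "q1 + q2 = 0 \<or> (\<exists>e<d. polyfun J e (q1 + q2))"
  proof -
    have "\<exists>e<d. polyfun J e (q1 + q2)" if "e1 < d" "polyfun J e1 q1" "e2 < d" "polyfun J e2 q2" for e1 e2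
      using that polyfun_add_max by (intro exI[of _ "max e1 e2"]) auto
    with *(4,8) show ?thesis by (metis add.left_neutral add.right_neutral)
  qed
  moreover have "p + q = (h1 + h2) + (q1 + q2)"
    unfolding *(1,5) by (simp only: ac_simps)
  moreover have "\<forall>c x. (h1 + h2) (\<lambda>i. c * x i) = c ^ d * (h1 + h2) x"
    using *(3,7) by (simp add: algebra_simps)
  ultimately show ?case using polyfun.add[OF *(2,6)] by blast
next
  case (mult d p e q)
  then obtain h1 q1 h2 q2 where *: "p = h1 + q1" "polyfun J d h1"
    "\<forall>c x. h1 (\<lambda>i. c * x i) = c ^ d * h1 x" "q1 = 0 \<or> (\<exists>e<d. polyfun J e q1)"
    "q = h2 + q2" "polyfun J e h2"
    "\<forall>c x. h2 (\<lambda>i. c * x i) = c ^ e * h2 x" "q2 = 0 \<or> (\<exists>d<e. polyfun J d q2)" by blast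
  have 1: "q1 * q = 0 \<or> (\<exists>f<d+e. polyfun J f (q1 * q))"
    using *(4) polyfun.mult[OF _ mult(2), of _ q1] by (metis add_strict_right_mono mult_zero_left)
  have 2: "h1 * q2 = 0 \<or> (\<exists>f<d+e. polyfun J f (h1 * q2))"
    using *(8) polyfun.mult[OF *(2), of _ q2] by (metis add_strict_left_mono mult_zero_right)
  have "q1 * q + h1 * q2 = 0 \<or> (\<exists>f<d+e. polyfun J f (q1 * q + h1 * q2))"
  proof -
    have "\<exists>f<d+e. polyfun J f (q1 * q + h1 * q2)"
      if "e1 < d+e" "polyfun J e1 (q1 * q)" "e2 < d+e" "polyfun J e2 (h1 * q2)" for e1 e2
      using that polyfun_add_max by (intro exI[of _ "max e1 e2"]) auto
    with 1 2 show ?thesis by (metis add.left_neutral add.right_neutral)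
  qed
  moreover have "p * q = h1 * h2 + (q1 * q + h1 * q2)"
    unfolding *(1,5) by (simp add: algebra_simps)
  moreover have "\<forall>c x. (h1 * h2) (\<lambda>i. c * x i) = c ^ (d + e) * (h1 * h2) x"
    using *(3,7) by (simp add: power_add algebra_simps)
  ultimately show ?case using polyfun.mult[OF *(2,6)] by blast
qed

text \<open>One variable is singled out: \<open>Q\<close> is a univariate polynomial whose coefficients are polynomial
functions of the remaining variables, and it is evaluated at the coordinate function of \<open>j\<close>. The
degree bound matters because it makes the coefficient of degree \<open>d\<close> a constant.\<close>

lemma polyfun_expand:
  assumes "polyfun (insert j J) d p"
  shows "\<exists>Q. p = poly Q (\<lambda>x. x j) \<and> degree Q \<le> d \<and> (\<forall>l\<le>d. polyfun J (d - l) (coeff Q l))"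
  using assms
proof induction
  case (const c)
  show ?case by (rule exI[of _ "[:(\<lambda>_. c):]"]) (auto intro: polyfun.const)
next
  case (coord i)
  show ?case
  proof (cases "i = j")
    case True
    then show ?thesis
      using polyfun_const[of J _ 1] polyfun_0[of J "Suc 0"]
      by (intro exI[of _ "[:0, 1:]"]) (auto simp: coeff_pCons one_fun_def le_Suc_eq split: nat.splits)
  next
    case False
    with coord have "i \<in> J" by auto
    then show ?thesis
      using polyfun.coord[of i J] polyfun_0[of J]
      by (intro exI[of _ "[:(\<lambda>x. x i):]"]) (auto simp: coeff_pCons split: nat.splits)
  qed
next
  case (raise d p e)
  then obtain Q where Q: "p = poly Q (\<lambda>x. x j)" "degree Q \<le> d" "\<forall>l\<le>d. polyfun J (d - l) (coeff Q l)"
    by blast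
  have "polyfun J (e - l) (coeff Q l)" if "l \<le> e" for l
  proof (cases "l \<le> d")
    case True
    with Q(3) raise(2) show ?thesis
      by (intro polyfun.raise[of J "d - l" _ "e - l"]) (auto intro: diff_le_mono)
  next
    case False
    with Q(2) have "coeff Q l = 0" by (intro coeff_eq_0) auto
    then show ?thesis by (simp add: polyfun_0)
  qed
  with Q raise(2) show ?case by (intro exI[of _ Q]) auto
next
  case (add d p q)
  then obtain P Q where "p = poly P (\<lambda>x. x j)" "degree P \<le> d" "\<forall>l\<le>d. polyfun J (d - l) (coeff P l)"
   "q = poly Q (\<lambda>x. x j)" "degree Q \<le> d" "\<forall>l\<le>d. polyfun J (d - l) (coeff Q l)"
    by blast
  then show ?case
    by (intro exI[of _ "P + Q"]) (auto intro!: degree_add_le polyfun.add simp del: plus_fun_apply)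
next
  case (mult d p e q)
  then obtain P Q where PQ: "p = poly P (\<lambda>x. x j)" "degree P \<le> d" "\<forall>l\<le>d. polyfun J (d - l) (coeff P l)"
   "q = poly Q (\<lambda>x. x j)" "degree Q \<le> e" "\<forall>l\<le>e. polyfun J (e - l) (coeff Q l)"
    by blast
  have "polyfun J (d + e - l) (coeff (P * Q) l)" if "l \<le> d + e" for l
    unfolding coeff_mult
  proof (rule polyfun_sum)
    fix i assume i: "i \<in> {..l}"
    show "polyfun J (d + e - l) (coeff P i * coeff Q (l - i))"
    proof (cases "i \<le> d \<and> l - i \<le> e")
      case True
      with i have eq: "d + e - l = (d - i) + (e - (l - i))" by auto
      from True PQ have "polyfun J (d - i) (coeff P i)" "polyfun J (e - (l - i)) (coeff Q (l - i))"
        by auto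
      then show ?thesis unfolding eq by (rule polyfun.mult)
    next
      case False
      with PQ have "coeff P i * coeff Q (l - i) = 0" by (auto simp: coeff_eq_0)
      then show ?thesis by (simp add: polyfun_0)
    qed
  qed
  moreover have "degree (P * Q) \<le> d + e"
    using degree_mult_le[of P Q] PQ by linarith
  ultimately show ?case using PQ by (intro exI[of _ "P * Q"]) (auto simp: poly_mult)
qed

section \<open>The Nullstellensatz for ideals of polynomial functions\<close>

definition poly_ideal :: "'i set \<Rightarrow> (('i \<Rightarrow> 'k::field) \<Rightarrow> 'k) set \<Rightarrow> bool"
  where "poly_ideal J I \<longleftrightarrow> I \<subseteq> Pol J \<and> 0 \<in> I \<and> (\<forall>p\<in>I. \<forall>q\<in>I. p + q \<in> I) \<and>
    (\<forall>p\<in>I. \<forall>q\<in>Pol J. q * p \<in> I)"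

lemma poly_ideal_sum:
  "poly_ideal J I \<Longrightarrow> (\<And>a. a \<in> A \<Longrightarrow> f a \<in> I) \<Longrightarrow> sum f A \<in> I"
  by (induction A rule: infinite_finite_induct) (auto simp: poly_ideal_def)

lemma poly_ideal_mult: "poly_ideal J I \<Longrightarrow> p \<in> I \<Longrightarrow> q \<in> Pol J \<Longrightarrow> q * p \<in> I"
  by (auto simp: poly_ideal_def)

lemma poly_ideal_diff:
  assumes "poly_ideal J I" "p \<in> I" "q \<in> I" shows "p - q \<in> I"
proof -
  have "- q = (- 1) * q" by simp
  then have "- q \<in> I" using assms by (metis Pol_1 Pol_uminus poly_ideal_def)
  then show ?thesis using assms unfolding poly_ideal_def by (metis diff_conv_add_uminus)
qed

lemma poly_fun_apply:
  fixes g :: "'a \<Rightarrow> 'b::comm_ring_1" shows "poly Q g x = (\<Sum>l\<le>degree Q. coeff Q l x * g x ^ l)"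
proof -
  have p: "(g ^ l) x = g x ^ l" for l :: nat by (induction l) auto
  show ?thesis by (simp add: poly_altdef fun_sum_apply p)
qed

lemma poly_mem_Pol:
  assumes "\<And>l. coeff Q l \<in> Pol K" "g \<in> Pol K" shows "poly Q g \<in> Pol K"
  unfolding poly_altdef using assms by (intro Pol_sum Pol_mult Pol_power)

lemma Pol_expand:
  assumes "p \<in> Pol (insert j J)"
  obtains Q where "p = poly Q (\<lambda>x. x j)" "\<And>l. coeff Q l \<in> Pol J"
proof -
  from assms obtain d where "polyfun (insert j J) d p" by (auto simp: Pol_def)
  from polyfun_expand[OF this] obtain Q where Q: "p = poly Q (\<lambda>x. x j)"
    "degree Q \<le> d" "\<forall>l\<le>d. polyfun J (d - l) (coeff Q l)" by blast
  have "coeff Q l \<in> Pol J" for l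
  proof (cases "l \<le> d")
    case True
    with Q(3) show ?thesis unfolding Pol_def by blast
  next
    case False
    with Q(2) show ?thesis by (simp add: coeff_eq_0 Pol_0)
  qed
  with Q(1) that show thesis by blast
qed

text \<open>Division with remainder by a monic polynomial in \<open>I\<close>. Since the leading coefficient is \<open>1\<close>, the
division does not leave an ideal \<open>A\<close> of the coefficient ring.\<close>

lemma monic_reduce:
  fixes Fp :: "(('i \<Rightarrow> 'k::field) \<Rightarrow> 'k) poly"
  assumes I: "poly_ideal K I" and X: "X \<in> Pol K" and JK: "J \<subseteq> K"
    and F: "poly Fp X \<in> I" and Fd: "degree Fp = d" "coeff Fp d = 1" "\<And>l. coeff Fp l \<in> Pol J"
    and A: "poly_ideal J A" and Q: "\<And>l. coeff Q l \<in> A"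
  shows "\<exists>N. (\<forall>l. coeff N l \<in> A) \<and> (\<forall>l\<ge>d. coeff N l = 0) \<and> poly Q X - poly N X \<in> I"
proof -
  have "(\<forall>l. coeff Q l \<in> A) \<Longrightarrow> (\<forall>l\<ge>d + n. coeff Q l = 0) \<Longrightarrow> ?thesis" for n
  proof (induction n arbitrary: Q)
    case 0
    have "poly Q X - poly Q X \<in> I" using I unfolding poly_ideal_def diff_self by blast
    moreover from 0 have "\<forall>l\<ge>d. coeff Q l = 0" by (simp only: add_0_right)
    ultimately show ?case using 0(1) by blast
  next
    case (Suc n)
    define c where "c = coeff Q (d + n)"
    \<comment> \<open>Cancel the coefficient of degree \<open>d + n\<close>.\<close>
    define Q' where "Q' = Q - monom c n * Fp"
    have c: "c \<in> A" using Suc.prems by (auto simp: c_def)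
    have coeff_mon: "coeff (monom c n * Fp) l = (if l < n then 0 else c * coeff Fp (l - n))" for l
      by (simp add: coeff_monom_mult)
    have 0: "0 \<in> A" using A by (simp add: poly_ideal_def)
    have mem: "c * coeff Fp m \<in> A" for m
      using A c Fd(3)[of m] unfolding poly_ideal_def by (metis mult.commute)
    have 1: "coeff Q' l \<in> A" for l
      unfolding Q'_def coeff_diff coeff_mon
      using Suc.prems mem 0 by (intro poly_ideal_diff[OF A]) auto
    have 2: "coeff Q' l = 0" if "l \<ge> d + n" for l
    proof (cases "l = d + n")
      case True
      have "coeff (monom c n * Fp) l = c" using True Fd(2) by (simp only: coeff_mon) simp
      then show ?thesis using True by (simp only: Q'_def coeff_diff c_def diff_self)
    next
      case False
      with that have "coeff Q l = 0" "coeff Fp (l - n) = 0"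
        using Suc.prems Fd(1) by (auto intro: coeff_eq_0)
      then show ?thesis by (simp only: Q'_def coeff_diff coeff_mon) simp
    qed
    from Suc.IH[of Q'] 1 2 obtain N where N: "\<forall>l. coeff N l \<in> A" "\<forall>l\<ge>d. coeff N l = 0"
      "poly Q' X - poly N X \<in> I" by blast
    have "(c * X ^ n) * poly Fp X \<in> I"
      using I F c A X Pol_mono[OF JK] Pol_mult Pol_power unfolding poly_ideal_def by (meson subsetD)
    then have "(poly Q' X - poly N X) + (c * X ^ n) * poly Fp X \<in> I"
      using N I unfolding poly_ideal_def by blast
    also have "(poly Q' X - poly N X) + (c * X ^ n) * poly Fp X = poly Q X - poly N X"
      by (simp add: Q'_def poly_monom)
    finally show ?case using N by blast
  qed
  moreover have "\<forall>l\<ge>d + Suc (degree Q). coeff Q l = 0" by (auto intro: coeff_eq_0)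
  ultimately show ?thesis using Q by blast
qed

lemma poly_map_apply:
  assumes "\<And>l. coeff Q l \<in> Pol J" "j \<notin> J"
  shows "poly Q (\<lambda>x. x j) (a(j := t)) = poly (map_poly (\<lambda>c. c a) Q) t"
proof -
  have "coeff Q l (a(j := t)) = coeff Q l a" for l
    by (rule Pol_cong[OF assms(1)]) (use assms(2) in auto)
  then have "poly Q (\<lambda>x. x j) (a(j := t)) = (\<Sum>l\<le>degree Q. coeff Q l a * t ^ l)"
    by (simp add: poly_fun_apply)
  also have "\<dots> = poly (map_poly (\<lambda>c. c a) Q) t"
    unfolding poly_altdef
    by (rule sum.mono_neutral_cong_right)
      (use map_poly_degree_leq[of "\<lambda>c. c a" Q] coeff_eq_0[of "map_poly (\<lambda>c. c a) Q"]
        in \<open>auto simp: coeff_map_poly\<close>)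
  finally show ?thesis .
qed

lemma poly_eq_0_of_infinite_field:
  fixes u :: "'k::{field, ring_char_0} poly"
  assumes "\<And>t. poly u t = 0" shows "u = 0"
  using assms poly_all_0_iff_0 by auto

text \<open>The geometric content is that the projection of the zero set of \<open>I\<close> along the coordinate \<open>j\<close> is
closed when \<open>I\<close> contains an element that is monic in this coordinate. The proof replaces resultants
by a determinant. If the fibre over \<open>a\<close> were empty, then \<open>I\<close> would contain a \<open>p\<close> that is \<open>1\<close> on the
whole line over \<open>a\<close>. Then \<open>1 - p\<close> has all its coefficients in the ideal \<open>A\<close> of functions vanishing at \<open>a\<close>, and
multiplying by the powers \<open>X ^ i\<close>, \<open>i < d\<close>, and reducing gives \<open>X ^ i \<equiv> \<Sum>l<d. N i l * X ^ l\<close> modulo \<open>I\<close>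
with entries \<open>N i l\<close> in \<open>A\<close>. By Cramer's rule \<open>det (1 - N)\<close> lies in \<open>I\<close>; it does not involve the
coordinate \<open>j\<close> and takes the value \<open>1\<close> at \<open>a\<close>.\<close>

lemma zero_extends:
  fixes I :: "(('i \<Rightarrow> 'k::{alg_closed_field, field_char_0}) \<Rightarrow> 'k) set"
  assumes j: "j \<notin> J" and I: "poly_ideal (insert j J) I"
    and F: "poly Fp (\<lambda>x. x j) \<in> I" "degree Fp = d" "coeff Fp d = 1" "\<And>l. coeff Fp l \<in> Pol J"
    and a: "\<And>p. p \<in> I \<Longrightarrow> p \<in> Pol J \<Longrightarrow> p a = 0"
  shows "\<exists>t. \<forall>p\<in>I. p (a(j := t)) = 0"
proof (rule ccontr)
  assume no: "\<not> ?thesis"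
  define X :: "('i \<Rightarrow> 'k) \<Rightarrow> 'k" where "X = (\<lambda>x. x j)"
  have X: "X \<in> Pol (insert j J)" unfolding X_def by (rule Pol_coord) simp
  \<comment> \<open>The restrictions of the elements of \<open>I\<close> to the line over \<open>a\<close>; they form an ideal of \<open>'k[t]\<close>, and a
    generator of it without root is a non-zero constant.\<close>
  define T where "T = {u. \<exists>p\<in>I. \<forall>t. p (a(j := t)) = poly u t}"
  have Tadd: "u + v \<in> T" if "u \<in> T" "v \<in> T" for u v
  proof -
    from that obtain p q where "p \<in> I" "q \<in> I" "\<forall>t. p (a(j := t)) = poly u t" 
      "\<forall>t. q (a(j := t)) = poly v t" by (auto simp: T_def)
    with I show ?thesis unfolding T_def poly_ideal_def by (intro CollectI bexI[of _ "p + q"]) auto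
  qed
  have Tmult: "v * u \<in> T" if u: "u \<in> T" for u v
  proof -
    from u obtain p where p: "p \<in> I" "\<forall>t. p (a(j := t)) = poly u t" by (auto simp: T_def)
    define V where "V = map_poly (\<lambda>c. (\<lambda>_ :: 'i \<Rightarrow> 'k. c)) v"
    have cV: "coeff V l = (\<lambda>_. coeff v l)" for l
      by (simp add: V_def coeff_map_poly zero_fun_def)
    have "poly V X \<in> Pol (insert j J)" using X by (intro poly_mem_Pol) (auto simp: cV Pol_const)
    with p(1) I have "poly V X * p \<in> I" by (auto simp: poly_ideal_def)
    moreover have "map_poly (\<lambda>c. c a) V = v" by (rule poly_eqI) (simp add: coeff_map_poly cV)
    then have "(poly V X * p) (a(j := t)) = poly (v * u) t" for t
      using p(2) poly_map_apply[of V J j a t] j by (simp add: X_def cV Pol_const)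
    ultimately show ?thesis unfolding T_def by blast
  qed
  have T0: "\<exists>u\<in>T. u \<noteq> 0"
  proof -
    from no obtain p where p: "p \<in> I" "p (a(j := 0)) \<noteq> 0" by blast
    with I have "p \<in> Pol (insert j J)" by (auto simp: poly_ideal_def)
    from Pol_expand[OF this] obtain Q where Q: "p = poly Q (\<lambda>x. x j)" "\<And>l. coeff Q l \<in> Pol J" by blast
    have "map_poly (\<lambda>c. c a) Q \<in> T"
      unfolding T_def using p(1) poly_map_apply[OF Q(2) j] Q(1) by blast
    moreover have "map_poly (\<lambda>c. c a) Q \<noteq> 0"
      using poly_map_apply[OF Q(2) j, of a 0] p(2) Q(1) by auto
    ultimately show ?thesis by blast
  qed
  define u where "u = arg_min degree (\<lambda>u. u \<in> T \<and> u \<noteq> 0)"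
  have u: "u \<in> T" "u \<noteq> 0" and umin: "\<And>v. v \<in> T \<Longrightarrow> v \<noteq> 0 \<Longrightarrow> degree u \<le> degree v"
    using arg_min_nat_lemma[of "\<lambda>u. u \<in> T \<and> u \<noteq> 0" _ degree] T0 unfolding u_def by blast+
  have udvd: "u dvd v" if "v \<in> T" for v
  proof (rule ccontr)
    assume nd: "\<not> u dvd v"
    then have "v mod u \<noteq> 0" by (simp add: dvd_eq_mod_eq_0)
    moreover have "v mod u = v + (- (v div u)) * u" by (simp add: minus_div_mult_eq_mod[symmetric])
    then have "v mod u \<in> T" using Tadd[OF that Tmult[OF u(1)]] by metis
    ultimately have "degree u \<le> degree (v mod u)" using umin by blast
    with degree_mod_less[OF u(2), of v] \<open>v mod u \<noteq> 0\<close> show False by auto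
  qed
  have "degree u = 0"
  proof (rule ccontr)
    assume "degree u \<noteq> 0"
    then obtain t where t: "poly u t = 0" using alg_closed_imp_poly_has_root[of u] by auto
    have "p (a(j := t)) = 0" if p: "p \<in> I" for p
    proof -
      from p I have "p \<in> Pol (insert j J)" by (auto simp: poly_ideal_def)
      from Pol_expand[OF this] obtain Q where Q: "p = poly Q (\<lambda>x. x j)" "\<And>l. coeff Q l \<in> Pol J" by blast
      have "map_poly (\<lambda>c. c a) Q \<in> T"
        unfolding T_def using p poly_map_apply[OF Q(2) j] Q(1) by blast
      from udvd[OF this] t have "poly (map_poly (\<lambda>c. c a) Q) t = 0" by (auto elim!: dvdE)
      then show ?thesis using poly_map_apply[OF Q(2) j] Q(1) by simp
    qed
    with no show False by blast
  qed
  with u obtain c where c: "u = [:c:]" "c \<noteq> 0" by (metis degree_eq_zeroE pCons_0_0)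
  have "[:inverse c:] * u \<in> T" by (rule Tmult[OF u(1)])
  with c have "1 \<in> T" by (simp add: one_pCons)
  then obtain p where p: "p \<in> I" "\<And>t. p (a(j := t)) = 1" by (auto simp: T_def)
  \<comment> \<open>The maximal ideal of \<open>a\<close> in the smaller ring.\<close>
  define A where "A = {q \<in> Pol J. q a = 0}"
  have A: "poly_ideal J A" unfolding poly_ideal_def A_def by auto
  have "p \<in> Pol (insert j J)" using p I by (auto simp: poly_ideal_def)
  from Pol_expand[OF this] obtain Q where Q: "p = poly Q X" "\<And>l. coeff Q l \<in> Pol J"
    unfolding X_def by blast
  define Q1 where "Q1 = 1 - Q"
  have "map_poly (\<lambda>c. c a) Q = 1"
  proof -
    have "poly (map_poly (\<lambda>c. c a) Q - 1) t = 0" for t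
      using poly_map_apply[OF Q(2) j, of a t] p(2)[of t] Q(1) by (simp add: X_def)
    from poly_eq_0_of_infinite_field[OF this] show ?thesis by simp
  qed
  then have Qa: "coeff Q l a = coeff (1 :: 'k poly) l" for l
    by (metis coeff_map_poly zero_fun_apply)
  have Q1: "coeff Q1 l \<in> A" for l
  proof -
    have "coeff (1 :: (('i \<Rightarrow> 'k) \<Rightarrow> 'k) poly) l \<in> Pol J" by (cases "l = 0") (simp_all add: coeff_1 Pol_0 Pol_1)
    from Pol_diff[OF this Q(2)[of l]] have "coeff Q1 l \<in> Pol J" by (simp only: Q1_def coeff_diff)
    with Qa[of l] show ?thesis by (auto simp: A_def Q1_def coeff_1)
  qed
  have Q1I: "1 - poly Q1 X \<in> I" using p(1) Q(1) by (simp add: Q1_def)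
  have "\<exists>N. (\<forall>l. coeff N l \<in> A) \<and> (\<forall>l\<ge>d. coeff N l = 0) \<and> X ^ i - poly N X \<in> I" for i
  proof -
    have "coeff (monom 1 i * Q1) l \<in> A" for l
      using Q1 A by (auto simp: coeff_monom_mult poly_ideal_def)
    from monic_reduce[OF I X subset_insertI F(1)[folded X_def] F(2-4) A this]
    obtain N where N: "\<forall>l. coeff N l \<in> A" "\<forall>l\<ge>d. coeff N l = 0" "X ^ i * poly Q1 X - poly N X \<in> I"
      by (auto simp: poly_monom)
    have "X ^ i * (1 - poly Q1 X) \<in> I"
      using I Q1I Pol_power[OF X, of i] unfolding poly_ideal_def by blast
    then have "X ^ i * (1 - poly Q1 X) + (X ^ i * poly Q1 X - poly N X) \<in> I"
      using N(3) I unfolding poly_ideal_def by blast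
    also have "X ^ i * (1 - poly Q1 X) + (X ^ i * poly Q1 X - poly N X) = X ^ i - poly N X"
      by (simp add: algebra_simps)
    finally show ?thesis using N by blast
  qed
  then obtain N where N: "\<And>i l. coeff (N i) l \<in> A" "\<And>i l. l \<ge> d \<Longrightarrow> coeff (N i) l = 0"
    "\<And>i. X ^ i - poly (N i) X \<in> I" by metis
  have NX: "poly (N i) X = (\<Sum>l<d. coeff (N i) l * X ^ l)" for i
  proof -
    have "poly (N i) X = (\<Sum>l\<le>degree (N i). coeff (N i) l * X ^ l)" by (rule poly_altdef)
    also have "\<dots> = (\<Sum>l<d. coeff (N i) l * X ^ l)"
      by (rule sum.mono_neutral_cong) (auto simp: N(2) coeff_eq_0 not_le not_less)
    finally show ?thesis .
  qed
  define M where "M = mat d d (\<lambda>(i, l). (if i = l then 1 else 0) - coeff (N i) l)"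
  have M: "M \<in> carrier_mat d d" by (simp add: M_def)
  have Me: "M $$ (i, l) \<in> Pol J" if "i < d" "l < d" for i l
    using that N(1)[of i l] by (auto simp: M_def A_def intro!: Pol_diff)
  have detM: "det M \<in> Pol J" using Me M by (intro Pol_det) auto
  have Mrow: "(\<Sum>l<d. M $$ (i, l) * X ^ l) \<in> I" if "i < d" for i
  proof -
    have "(\<Sum>l<d. M $$ (i, l) * X ^ l) =
        (\<Sum>l<d. (if i = l then X ^ l else 0)) - (\<Sum>l<d. coeff (N i) l * X ^ l)"
      unfolding sum_subtractf[symmetric] using that
      by (intro sum.cong) (auto simp: M_def algebra_simps)
    also have "\<dots> = X ^ i - poly (N i) X" using that by (simp add: NX)
    finally show ?thesis using N(3) by simp
  qed
  have "det M \<in> I"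
  proof (cases "d = 0")
    case True
    with F(2) obtain c where "Fp = [:c:]" by (auto elim: degree_eq_zeroE)
    with F(3) True have "Fp = 1" by (simp add: one_pCons)
    with F(1) have "1 \<in> I" by simp
    then show ?thesis using True M by simp
  next
    case False
    have adj: "adj_mat M \<in> carrier_mat d d" "adj_mat M * M = det M \<cdot>\<^sub>m 1\<^sub>m d"
      using adj_mat[OF M] by auto
    have adje: "adj_mat M $$ (0, i) \<in> Pol J" if "i < d" for i
    proof -
      have "det (mat_delete M i 0) \<in> Pol J"
        using M that False by (intro Pol_det) (auto simp: mat_delete_def intro!: Me)
      moreover have "(-1) ^ (i + 0) \<in> (Pol J :: (('i \<Rightarrow> 'k) \<Rightarrow> 'k) set)"
        by (intro Pol_power Pol_uminus Pol_1)
      ultimately show ?thesis using M that False by (auto simp: adj_mat_def cofactor_def)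
    qed
    have ent: "(\<Sum>i<d. adj_mat M $$ (0, i) * M $$ (i, l)) = (if l = 0 then det M else 0)" if "l < d" for l
    proof -
      have "(adj_mat M * M) $$ (0, l) = (\<Sum>i<d. adj_mat M $$ (0, i) * M $$ (i, l))"
        using adj(1) M that False by (simp add: scalar_prod_def atLeast0LessThan)
      moreover have "(adj_mat M * M) $$ (0, l) = (det M \<cdot>\<^sub>m 1\<^sub>m d) $$ (0, l)"
        by (simp only: adj(2))
      ultimately show ?thesis using that False by (cases "l = 0") simp_all
    qed
    \<comment> \<open>Row \<open>0\<close> of the adjugate, because \<open>X ^ 0 = 1\<close>.\<close>
    have "(\<Sum>i<d. adj_mat M $$ (0, i) * (\<Sum>l<d. M $$ (i, l) * X ^ l)) \<in> I"
    proof (rule poly_ideal_sum[OF I])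
      fix i assume "i \<in> {..<d}"
      then show "adj_mat M $$ (0, i) * (\<Sum>l<d. M $$ (i, l) * X ^ l) \<in> I"
        using Mrow[of i] Pol_mono[OF subset_insertI adje[of i], of j] I
        unfolding poly_ideal_def by blast
    qed
    also have "(\<Sum>i<d. adj_mat M $$ (0, i) * (\<Sum>l<d. M $$ (i, l) * X ^ l)) =
        (\<Sum>l<d. (\<Sum>i<d. adj_mat M $$ (0, i) * M $$ (i, l)) * X ^ l)"
      unfolding sum_distrib_left sum_distrib_right
      by (subst sum.swap) (simp add: mult.assoc)
    also have "\<dots> = (\<Sum>l<d. if l = 0 then det M else 0)"
      by (intro sum.cong) (auto simp: ent)
    also have "\<dots> = det M" using False by simp
    finally show ?thesis .
  qed
  from a[OF this detM] have "det M a = 0" .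
  moreover have "det M a = 1"
  proof -
    interpret ev: comm_ring_hom "\<lambda>f :: ('i \<Rightarrow> 'k) \<Rightarrow> 'k. f a"
      by unfold_locales auto
    have "map_mat (\<lambda>f. f a) M = 1\<^sub>m d"
      using N(1) by (intro eq_matI) (auto simp: M_def A_def)
    then show ?thesis using ev.hom_det[of M] by simp
  qed
  ultimately show False by simp
qed

text \<open>Invertible substitutions map ideals to ideals; \<open>\<sigma>\<close> is the inverse that makes the image absorb products.\<close>

lemma poly_ideal_substitute:
  fixes I :: "(('i \<Rightarrow> 'k::field) \<Rightarrow> 'k) set"
  assumes I: "poly_ideal K I"
    and \<tau>: "\<And>p. p \<in> Pol K \<Longrightarrow> (\<lambda>x. p (\<tau> x)) \<in> Pol K"
    and \<sigma>: "\<And>p. p \<in> Pol K \<Longrightarrow> (\<lambda>x. p (\<sigma> x)) \<in> Pol K"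
    and inv: "\<And>x. \<sigma> (\<tau> x) = x"
  shows "poly_ideal K ((\<lambda>p x. p (\<tau> x)) ` I)"
  unfolding poly_ideal_def
proof (intro conjI ballI)
  show "(\<lambda>p x. p (\<tau> x)) ` I \<subseteq> Pol K" using I \<tau> by (auto simp: poly_ideal_def)
  show "0 \<in> (\<lambda>p x. p (\<tau> x)) ` I"
    using I by (intro image_eqI[of _ _ 0]) (auto simp: poly_ideal_def)
next
  fix p q assume "p \<in> (\<lambda>p x. p (\<tau> x)) ` I" "q \<in> (\<lambda>p x. p (\<tau> x)) ` I"
  then obtain p' q' where "p' \<in> I" "p = (\<lambda>x. p' (\<tau> x))" "q' \<in> I" "q = (\<lambda>x. q' (\<tau> x))" by blast
  with I show "p + q \<in> (\<lambda>p x. p (\<tau> x)) ` I"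
    by (intro image_eqI[of _ _ "p' + q'"]) (auto simp: poly_ideal_def)
next
  fix p r :: "('i \<Rightarrow> 'k) \<Rightarrow> 'k" assume "p \<in> (\<lambda>p x. p (\<tau> x)) ` I" and r: "r \<in> Pol K"
  then obtain p' where p': "p' \<in> I" "p = (\<lambda>x. p' (\<tau> x))" by blast
  show "r * p \<in> (\<lambda>p x. p (\<tau> x)) ` I"
  proof (rule image_eqI)
    show "r * p = (\<lambda>x. ((\<lambda>x. r (\<sigma> x)) * p') (\<tau> x))" by (simp add: p' inv times_fun_def)
    show "(\<lambda>x. r (\<sigma> x)) * p' \<in> I" using \<sigma>[OF r] p' I by (auto simp: poly_ideal_def)
  qed
qed

text \<open>A small perturbation: along the line through \<open>v\<close> in direction \<open>j\<close> only finitely many points are bad.\<close>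

lemma polyfun_nonzero_direction:
  fixes h :: "('i \<Rightarrow> 'k::{field, ring_char_0}) \<Rightarrow> 'k"
  assumes h: "polyfun K d h" "h v \<noteq> 0"
  shows "\<exists>w. w j \<noteq> 0 \<and> h w \<noteq> 0"
proof -
  define w where "w s = (\<lambda>i. v i + s * (if i = j then 1 else 0))" for s :: 'k
  from polyfun_line[OF h(1), of v "\<lambda>i. if i = j then 1 else 0"]
  obtain u where u: "\<And>s. h (w s) = poly u s" unfolding w_def by blast
  from u[of 0] h(2) have "u \<noteq> 0" by (auto simp: w_def)
  then have "finite ({s. poly u s = 0} \<union> {- v j})" using poly_roots_finite by auto
  from ex_new_if_finite[OF infinite_UNIV_char_0 this]
  obtain s where s: "poly u s \<noteq> 0" "s \<noteq> - v j" by blast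
  from s(2) have "w s j \<noteq> 0" by (auto simp: w_def add_eq_0_iff)
  moreover have "h (w s) \<noteq> 0" using s(1) u by simp
  ultimately show ?thesis by blast
qed

text \<open>The coordinate change of Noether normalization. In the direction \<open>v\<close> the coefficient of the top power
of \<open>x j\<close> is the value of the top form of \<open>f\<close> at \<open>v\<close>, so it suffices that this value is not \<open>0\<close>.\<close>

lemma monic_in_direction:
  fixes f :: "('i \<Rightarrow> 'k::{field, ring_char_0}) \<Rightarrow> 'k"
  assumes f: "f \<in> Pol (insert j J)" "f \<noteq> 0" and j: "j \<notin> J"
  shows "\<exists>v Q d c. v j = 1 \<and> c \<noteq> 0 \<and> degree Q = d \<and> coeff Q d = (\<lambda>_. c) \<and> (\<forall>l. coeff Q l \<in> Pol J) \<and>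
    (\<lambda>x. f (\<lambda>i. if i = j then x j else x i + v i * x j)) = poly Q (\<lambda>x. x j)"
proof -
  define d where "d = (LEAST d. polyfun (insert j J) d f)"
  have d: "polyfun (insert j J) d f" using f(1) unfolding d_def Pol_def by (auto intro: LeastI)
  have dmin: "\<not> polyfun (insert j J) e f" if "e < d" for e
    using that not_less_Least unfolding d_def by blast
  from polyfun_top_form[OF d] obtain h q where hq: "f = h + q" "polyfun (insert j J) d h"
    "homogeneous d h" "q = 0 \<or> (\<exists>e<d. polyfun (insert j J) e q)" by blast
  have hom: "h (\<lambda>i. c * x i) = c ^ d * h x" for c x using hq(3) by (simp add: homogeneous_def)
  have "h \<noteq> 0"
  proof
    assume "h = 0"
    with hq f(2) dmin show False by auto
  qed
  then obtain w0 where "h w0 \<noteq> 0" by (metis ext zero_fun_apply)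
  from polyfun_nonzero_direction[OF hq(2) this, of j] obtain w where w: "w j \<noteq> 0" "h w \<noteq> 0" by blast
  define v where "v = (\<lambda>i. inverse (w j) * w i)"
  have v: "v j = 1" "h v \<noteq> 0" unfolding v_def using w hom[of "inverse (w j)" w] by auto
  define \<tau> where "\<tau> x = (\<lambda>i. if i = j then x j else x i + v i * x j)" for x
  have \<tau>1: "polyfun (insert j J) (Suc 0) (\<lambda>x. \<tau> x i)" if "i \<in> insert j J" for i
  proof (cases "i = j")
    case True
    then show ?thesis by (simp add: \<tau>_def polyfun.coord)
  next
    case False
    have "polyfun (insert j J) (Suc 0) ((\<lambda>x. x i) + (\<lambda>_. v i) * (\<lambda>x. x j))"
      using that by (intro polyfun.add polyfun_scale polyfun.coord) auto
    with False show ?thesis by (simp add: \<tau>_def plus_fun_def times_fun_def)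
  qed
  from polyfun_expand[OF polyfun_compose_linear[where u = \<tau>, OF d \<tau>1]]
  obtain Q where Q: "(\<lambda>x. f (\<tau> x)) = poly Q (\<lambda>x. x j)" "degree Q \<le> d"
    "\<forall>l\<le>d. polyfun J (d - l) (coeff Q l)" by blast
  have QJ: "coeff Q l \<in> Pol J" for l
  proof (cases "l \<le> d")
    case True
    with Q(3) show ?thesis unfolding Pol_def by blast
  next
    case False
    with Q(2) show ?thesis by (simp add: coeff_eq_0 Pol_0)
  qed
  from Q(3) have "polyfun J 0 (coeff Q d)" by (metis diff_self_eq_0 le_refl)
  from polyfun_0_const[OF this] obtain c where c: "coeff Q d = (\<lambda>_. c)" by blast
  \<comment> \<open>Compare the coefficients of \<open>t ^ d\<close> in \<open>f (t v) = t ^ d * h v + q (t v)\<close>; the last summand has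
    smaller degree in \<open>t\<close>.\<close>
  have "c = h v"
  proof -
    obtain u where u: "\<And>s. q (\<lambda>i. 0 + s * v i) = poly u s" "coeff u d = 0"
    proof -
      from hq(4) consider "q = 0" | e where "e < d" "polyfun (insert j J) e q" by blast
      then show thesis
      proof cases
        case 1
        then show thesis using that[of 0] by simp
      next
        case 2
        from polyfun_line[OF 2(2), of "\<lambda>_. 0" v] 2(1) that show thesis
          by (metis coeff_eq_0 order.strict_trans1)
      qed
    qed
    let ?U = "map_poly (\<lambda>c. c (\<lambda>_. 0)) Q"
    have "poly (?U - (monom (h v) d + u)) t = 0" for t
    proof -
      have "\<tau> ((\<lambda>_. 0)(j := t)) = (\<lambda>i. t * v i)" using v by (auto simp: \<tau>_def)
      then have "poly ?U t = f (\<lambda>i. t * v i)"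
        using poly_map_apply[OF QJ j, of "\<lambda>_. 0" t] fun_cong[OF Q(1), of "(\<lambda>_. 0)(j := t)"] by simp
      also have "\<dots> = t ^ d * h v + poly u t" using hq(1) hom u(1)[of t] by simp
      finally show ?thesis by (simp add: poly_monom)
    qed
    from poly_eq_0_of_infinite_field[OF this] have "coeff ?U d = coeff (monom (h v) d + u) d" by simp
    then show ?thesis using u(2) c by (simp add: coeff_map_poly)
  qed
  with v have c0: "c \<noteq> 0" by simp
  have "degree Q = d" using Q(2) c c0 le_degree[of Q d] by (force simp: fun_eq_iff)
  with c c0 v(1) QJ Q(1) show ?thesis unfolding \<tau>_def by blast
qed

text \<open>Induction on the number of variables: after a linear change of coordinates a non-zero element of the
ideal becomes monic in the variable \<open>j\<close>, the elements free of \<open>j\<close> have a common zero by induction, and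
this zero extends.\<close>

theorem weak_nullstellensatz:
  fixes I :: "(('i \<Rightarrow> 'k::{alg_closed_field, field_char_0}) \<Rightarrow> 'k) set"
  assumes "finite J" "poly_ideal J I" "1 \<notin> I"
  shows "\<exists>a. \<forall>p\<in>I. p a = 0"
  using assms
proof (induction J arbitrary: I rule: finite_induct)
  case empty
  have "p (\<lambda>_. 0) = 0" if p: "p \<in> I" for p
  proof (rule ccontr)
    assume nz: "p (\<lambda>_. 0) \<noteq> 0"
    have "p x = p (\<lambda>_. 0)" for x
      by (rule Pol_cong[of p "{}"]) (use p empty in \<open>auto simp: poly_ideal_def\<close>)
    then have "p = (\<lambda>_. p (\<lambda>_. 0))" by (rule ext)
    then have "(\<lambda>_. inverse (p (\<lambda>_. 0))) * p = (\<lambda>_. inverse (p (\<lambda>_. 0)) * p (\<lambda>_. 0))"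
      by (metis times_fun_def)
    then have "(\<lambda>_. inverse (p (\<lambda>_. 0))) * p = 1" using nz by (simp add: one_fun_def)
    moreover have "(\<lambda>_. inverse (p (\<lambda>_. 0))) * p \<in> I"
      by (rule poly_ideal_mult[OF empty(1) p Pol_const])
    ultimately show False using empty(2) by simp
  qed
  then show ?case by blast
next
  case (insert j J)
  let ?K = "insert j J"
  show ?case
  proof (cases "\<exists>f\<in>I. f \<noteq> 0")
    case False
    then have "p (\<lambda>_. 0) = 0" if "p \<in> I" for p using that by (metis zero_fun_apply)
    then show ?thesis by blast
  next
    case True
    then obtain f where f: "f \<in> I" "f \<noteq> 0" by blast
    with insert.prems have "f \<in> Pol ?K" by (auto simp: poly_ideal_def)
    from monic_in_direction[OF this f(2) insert.hyps(2)]
    obtain v Q d c where v: "v j = 1" and c: "c \<noteq> 0" and Q: "degree Q = d" "coeff Q d = (\<lambda>_. c)"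
      "\<And>l. coeff Q l \<in> Pol J"
      and fQ: "(\<lambda>x. f (\<lambda>i. if i = j then x j else x i + v i * x j)) = poly Q (\<lambda>x. x j)" by blast
    define \<tau> where "\<tau> x = (\<lambda>i. if i = j then x j else x i + v i * x j)" for x :: "'i \<Rightarrow> 'k"
    define \<sigma> where "\<sigma> x = (\<lambda>i. if i = j then x j else x i - v i * x j)" for x :: "'i \<Rightarrow> 'k"
    have mem: "(\<lambda>x. if i = j then x j else x i + b * x j) \<in> Pol ?K" if "i \<in> ?K" for i and b :: 'k
    proof (cases "i = j")
      case True
      then show ?thesis by (simp add: Pol_coord)
    next
      case False
      have "(\<lambda>x. x i) + (\<lambda>_. b) * (\<lambda>x. x j) \<in> Pol ?K"
        using that by (intro Pol_add Pol_mult Pol_const Pol_coord) simp_all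
      with False show ?thesis by (simp add: plus_fun_def times_fun_def)
    qed
    have \<tau>: "(\<lambda>x. p (\<tau> x)) \<in> Pol ?K" if "p \<in> Pol ?K" for p
      by (rule Pol_compose[OF that]) (unfold \<tau>_def, rule mem)
    have \<sigma>: "(\<lambda>x. p (\<sigma> x)) \<in> Pol ?K" if "p \<in> Pol ?K" for p
    proof (rule Pol_compose[OF that])
      fix i assume "i \<in> ?K"
      have "(\<lambda>x. \<sigma> x i) = (\<lambda>x. if i = j then x j else x i + - v i * x j)"
        by (rule ext) (simp add: \<sigma>_def)
      with mem[OF \<open>i \<in> ?K\<close>, of "- v i"] show "(\<lambda>x. \<sigma> x i) \<in> Pol ?K" by simp
    qed
    define I' where "I' = (\<lambda>p x. p (\<tau> x)) ` I"
    have I': "poly_ideal ?K I'" unfolding I'_def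
      by (rule poly_ideal_substitute[OF insert.prems(1) \<tau> \<sigma>]) (auto simp: \<tau>_def \<sigma>_def)
    define I0 where "I0 = I' \<inter> Pol J"
    have "poly_ideal J I0"
      unfolding poly_ideal_def
    proof (intro conjI ballI)
      show "0 \<in> I0" using I' Pol_0 by (simp add: poly_ideal_def I0_def)
      fix p assume p: "p \<in> I0"
      show "p + q \<in> I0" if "q \<in> I0" for q
        using p that I' by (simp add: poly_ideal_def I0_def Pol_add)
      show "q * p \<in> I0" if "q \<in> Pol J" for q
        using p that poly_ideal_mult[OF I' _ Pol_mono[OF subset_insertI that]]
        by (simp add: I0_def Pol_mult)
    qed (simp add: I0_def)
    moreover have "1 \<notin> I0"
    proof
      assume "1 \<in> I0"
      then obtain p where p: "p \<in> I" "1 = (\<lambda>x. p (\<tau> x))" by (auto simp: I0_def I'_def)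
      have "p y = 1" for y
      proof -
        have "\<tau> (\<sigma> y) = y" by (auto simp: \<tau>_def \<sigma>_def)
        with fun_cong[OF p(2), of "\<sigma> y"] show ?thesis by simp
      qed
      then have "p = 1" by auto
      with p insert.prems show False by simp
    qed
    ultimately obtain a where a: "\<And>p. p \<in> I0 \<Longrightarrow> p a = 0" using insert.IH by blast
    define Fp where "Fp = smult (\<lambda>_. inverse c) Q"
    have cc: "(\<lambda>_. inverse c) * (\<lambda>_. c) = (1 :: ('i \<Rightarrow> 'k) \<Rightarrow> 'k)" using c by auto
    have Fp: "coeff Fp d = 1" "\<And>l. coeff Fp l \<in> Pol J"
      unfolding Fp_def coeff_smult Q(2) cc using Q(3) by auto
    have "degree Fp = d"
    proof (rule antisym)
      show "degree Fp \<le> d" unfolding Fp_def using degree_smult_le Q(1) by blast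
      show "d \<le> degree Fp" using Fp(1) by (intro le_degree) simp
    qed
    moreover have "poly Fp (\<lambda>x. x j) \<in> I'"
    proof -
      have "poly Q (\<lambda>x. x j) \<in> I'"
        unfolding fQ[symmetric] I'_def \<tau>_def by (rule imageI[OF f(1)])
      then show ?thesis unfolding Fp_def poly_smult
        by (rule poly_ideal_mult[OF I' _ Pol_const])
    qed
    moreover have "p a = 0" if "p \<in> I'" "p \<in> Pol J" for p
      using a[of p] that by (simp add: I0_def)
    ultimately have "\<exists>t. \<forall>p\<in>I'. p (a(j := t)) = 0"
      using zero_extends[OF insert.hyps(2) I', of Fp d a] Fp by blast
    then obtain t where t: "\<forall>p\<in>I'. p (a(j := t)) = 0" ..
    show ?thesis
    proof (rule exI, rule ballI)
      fix p assume "p \<in> I"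
      then have "(\<lambda>x. p (\<tau> x)) \<in> I'" unfolding I'_def by (rule imageI)
      with t show "p (\<tau> (a(j := t))) = 0" by (rule bspec)
    qed
  qed
qed

section \<open>Counting monomials on a cone\<close>

lemma vector_space_functions: "vector_space (fscale ((*) :: 'k::field \<Rightarrow> 'k \<Rightarrow> 'k))"
  by (rule vector_space_fscale) (unfold_locales, auto simp: algebra_simps)

interpretation FS: vector_space "fscale ((*) :: 'k::field \<Rightarrow> 'k \<Rightarrow> 'k)"
  by (rule vector_space_functions)

definition pmon :: "'i set \<Rightarrow> ('i \<Rightarrow> nat) \<Rightarrow> ('i \<Rightarrow> 'k::field) \<Rightarrow> 'k"
  where "pmon J \<beta> = (\<lambda>x. \<Prod>i\<in>J. x i ^ \<beta> i)"

lemma pmon_mult: "pmon J \<beta> * pmon J \<gamma> = pmon J (\<lambda>i. \<beta> i + \<gamma> i)"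
  by (rule ext) (simp add: pmon_def power_add prod.distrib)

lemma fscale_apply: "fscale (*) c f x = c * f x"
  by (simp add: fscale_def)

lemma span_mult:
  fixes p q :: "'a \<Rightarrow> 'k::field"
  assumes "p \<in> FS.span A" "q \<in> FS.span B" "\<And>a b. a \<in> A \<Longrightarrow> b \<in> B \<Longrightarrow> a * b \<in> FS.span C"
  shows "p * q \<in> FS.span C"
  using assms(1)
proof (induction rule: FS.span_induct_alt)
  case base
  show ?case by (simp only: mult_zero_left FS.span_zero)
next
  case (step c a p)
  have "a * q \<in> FS.span C"
    using assms(2)
  proof (induction rule: FS.span_induct_alt)
    case base
    show ?case by (simp only: mult_zero_right FS.span_zero)
  next
    case (step c' b q)
    have "a * (fscale (*) c' b + q) = fscale (*) c' (a * b) + a * q"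
      by (rule ext) (simp add: fscale_def algebra_simps)
    then show ?case using step assms(3)[OF \<open>a \<in> A\<close>] by (simp only: FS.span_add FS.span_scale)
  qed
  moreover have "(fscale (*) c a + p) * q = fscale (*) c (a * q) + p * q"
    by (rule ext) (simp add: fscale_def algebra_simps)
  ultimately show ?case using step(2) by (simp only: FS.span_add FS.span_scale)
qed

lemma polyfun_span_mon:
  fixes p :: "('i \<Rightarrow> 'k::field) \<Rightarrow> 'k"
  assumes "finite J" "polyfun J d p"
  shows "p \<in> FS.span {pmon J \<beta> | \<beta>. sum \<beta> J \<le> d}"
  using assms(2)
proof induction
  case (const c)
  have eq: "(\<lambda>_. c) = fscale (*) c (pmon J (\<lambda>_. 0))" by (rule ext) (simp add: pmon_def fscale_def)
  have "sum (\<lambda>_. 0) J \<le> (0::nat)" by simp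
  then have "pmon J (\<lambda>_. 0) \<in> {pmon J \<beta> | \<beta>. sum \<beta> J \<le> 0}" by blast
  then have "fscale (*) c (pmon J (\<lambda>_. 0)) \<in> FS.span {pmon J \<beta> | \<beta>. sum \<beta> J \<le> 0}"
    by (intro FS.span_scale FS.span_base)
  then show ?case by (subst eq)
next
  case (coord i)
  have "(\<lambda>x :: 'i \<Rightarrow> 'k. x i) = pmon J (\<lambda>l. if l = i then 1 else 0)"
  proof
    fix x :: "'i \<Rightarrow> 'k"
    have "pmon J (\<lambda>l. if l = i then 1 else 0) x = (\<Prod>l\<in>J. if l = i then x l else 1)"
      unfolding pmon_def by (rule prod.cong) auto
    then show "x i = pmon J (\<lambda>l. if l = i then 1 else 0) x" using assms(1) coord by simp
  qed
  moreover have "sum (\<lambda>l. if l = i then 1 else 0) J \<le> Suc 0" using assms(1) by simp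
  ultimately show ?case by (intro FS.span_base) blast
next
  case (raise d p e)
  have "{pmon J \<beta> | \<beta>. sum \<beta> J \<le> d} \<subseteq> {pmon J \<beta> | \<beta>. sum \<beta> J \<le> e}"
    using raise(2) by force
  from FS.span_mono[OF this] raise.IH show ?case by blast
next
  case (add d p q)
  then show ?case by (simp only: FS.span_add)
next
  case (mult d p e q)
  show ?case
  proof (rule span_mult[OF mult.IH])
    fix a b :: "('i \<Rightarrow> 'k) \<Rightarrow> 'k"
    assume "a \<in> {pmon J \<beta> | \<beta>. sum \<beta> J \<le> d}" "b \<in> {pmon J \<beta> | \<beta>. sum \<beta> J \<le> e}"
    then obtain \<beta> \<gamma> where "a = pmon J \<beta>" "sum \<beta> J \<le> d" "b = pmon J \<gamma>" "sum \<gamma> J \<le> e" by blast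
    then have "a * b = pmon J (\<lambda>i. \<beta> i + \<gamma> i)" "sum (\<lambda>i. \<beta> i + \<gamma> i) J \<le> d + e"
      by (auto simp only: pmon_mult sum.distrib intro: add_mono)
    then show "a * b \<in> FS.span {pmon J \<beta> | \<beta>. sum \<beta> J \<le> d + e}" by (intro FS.span_base) blast
  qed
qed

text \<open>The function \<open>x j ^ e * p (x / x j)\<close> is polynomial as soon as \<open>e \<ge> d\<close>. The strict inequality leaves a
spare factor \<open>x j\<close>, so that the homogenization vanishes where \<open>x j = 0\<close>.\<close>

lemma homogenize:
  fixes p :: "('i \<Rightarrow> 'k::field) \<Rightarrow> 'k"
  assumes J: "finite J" "j \<in> J" and p: "polyfun J d p" and e: "d < e"
  shows "\<exists>g \<in> FS.span {pmon J \<beta> | \<beta>. sum \<beta> J = e}.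
    \<forall>x. g x = (if x j = 0 then 0 else x j ^ e * p (\<lambda>i. x i / x j))"
  using polyfun_span_mon[OF J(1) p]
proof (induction rule: FS.span_induct_alt)
  case base
  show ?case by (rule bexI[OF _ FS.span_zero]) simp
next
  case (step c a p)
  from step.hyps(1) obtain \<beta> where \<beta>: "a = pmon J \<beta>" "sum \<beta> J \<le> d" by blast
  from step.IH obtain g where g: "g \<in> FS.span {pmon J \<beta> | \<beta>. sum \<beta> J = e}"
    "\<And>x. g x = (if x j = 0 then 0 else x j ^ e * p (\<lambda>i. x i / x j))" by blast
  define \<gamma> where "\<gamma> = \<beta>(j := \<beta> j + (e - sum \<beta> J))"
  have "sum \<gamma> J = (\<Sum>i\<in>J. \<beta> i + (if i = j then e - sum \<beta> J else 0))"
    unfolding \<gamma>_def by (rule sum.cong) auto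
  also have "\<dots> = e" using J \<beta>(2) e by (simp add: sum.distrib)
  finally have "pmon J \<gamma> \<in> {pmon J \<beta> | \<beta>. sum \<beta> J = e}" by blast
  from FS.span_add[OF FS.span_scale[OF FS.span_base[OF this]] g(1)] have mem: "fscale (*) c (pmon J \<gamma>) + g \<in> FS.span {pmon J \<beta> | \<beta>. sum \<beta> J = e}"
    .
  have pmon\<gamma>: "pmon J \<gamma> x = x j ^ (e - sum \<beta> J) * pmon J \<beta> x" for x :: "'i \<Rightarrow> 'k"
  proof -
    have "pmon J \<gamma> x = (\<Prod>i\<in>J. x i ^ \<beta> i * (if i = j then x i ^ (e - sum \<beta> J) else 1))"
      unfolding pmon_def \<gamma>_def by (rule prod.cong) (auto simp: power_add)
    then show ?thesis using J by (simp add: prod.distrib pmon_def)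
  qed
  have "pmon J \<gamma> x = (if x j = 0 then 0 else x j ^ e * pmon J \<beta> (\<lambda>i. x i / x j))" for x :: "'i \<Rightarrow> 'k"
  proof (cases "x j = 0")
    case True
    then show ?thesis using \<beta>(2) e by (simp add: pmon\<gamma>)
  next
    case False
    have "pmon J \<beta> (\<lambda>i. x i / x j) = pmon J \<beta> x / x j ^ sum \<beta> J"
      unfolding pmon_def by (simp add: power_divide prod_dividef power_sum)
    then show ?thesis using False \<beta>(2) e by (simp add: pmon\<gamma> power_diff)
  qed
  then have "(fscale (*) c (pmon J \<gamma>) + g) x =
      (if x j = 0 then 0 else x j ^ e * (fscale (*) c a + p) (\<lambda>i. x i / x j))" for x
    by (simp add: g(2) \<beta>(1) fscale_def algebra_simps)
  with mem show ?case by blast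
qed

text \<open>The exponent vectors in \<open>B\<close> need only be distinguished by their values on \<open>J\<close>; this form passes to the
subset of vectors with a fixed exponent of \<open>j\<close>, which is what the induction needs.\<close>

lemma monomials_independent:
  fixes c :: "('i \<Rightarrow> nat) \<Rightarrow> 'k::{field, ring_char_0}"
  assumes "finite J" "finite B" "\<And>\<beta> \<beta>'. \<beta> \<in> B \<Longrightarrow> \<beta>' \<in> B \<Longrightarrow> (\<And>i. i \<in> J \<Longrightarrow> \<beta> i = \<beta>' i) \<Longrightarrow> \<beta> = \<beta>'"
    and "\<And>x. (\<Sum>\<beta>\<in>B. c \<beta> * pmon J \<beta> x) = 0" and "\<beta> \<in> B"
  shows "c \<beta> = 0"
  using assms
proof (induction J arbitrary: B rule: finite_induct)
  case empty
  then have "B = {\<beta>}" by auto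
  with empty.prems(3) show ?case by (simp add: pmon_def)
next
  case (insert j J)
  define B' where "B' = {\<gamma> \<in> B. \<gamma> j = \<beta> j}"
  show ?case
  proof (rule insert.IH[of B'])
    show "finite B'" "\<beta> \<in> B'" using insert.prems by (auto simp: B'_def)
    show "\<gamma> = \<gamma>'" if "\<gamma> \<in> B'" "\<gamma>' \<in> B'" "\<And>i. i \<in> J \<Longrightarrow> \<gamma> i = \<gamma>' i" for \<gamma> \<gamma>'
      using that by (intro insert.prems(2)) (auto simp: B'_def)
    fix x :: "'i \<Rightarrow> 'k"
    define u where "u = (\<Sum>\<gamma>\<in>B. monom (c \<gamma> * pmon J \<gamma> x) (\<gamma> j))"
    have mon_upd: "pmon J \<gamma> (x(j := t)) = pmon J \<gamma> x" for \<gamma> t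
      unfolding pmon_def using insert.hyps(2) by (intro prod.cong) auto
    have mon_ins: "pmon (insert j J) \<gamma> y = y j ^ \<gamma> j * pmon J \<gamma> y" for \<gamma> and y :: "'i \<Rightarrow> 'k"
      unfolding pmon_def using insert.hyps by simp
    have "poly u t = 0" for t
      using insert.prems(3)[of "x(j := t)"]
      by (simp add: u_def poly_sum poly_monom mon_ins mon_upd algebra_simps del: fun_upd_apply add: fun_upd_same)
    from poly_eq_0_of_infinite_field[OF this] have "coeff u (\<beta> j) = 0" by simp
    moreover have "coeff u (\<beta> j) = (\<Sum>\<gamma>\<in>B'. c \<gamma> * pmon J \<gamma> x)"
      unfolding u_def coeff_sum coeff_monom B'_def
      using insert.prems(1) by (subst sum.inter_filter) (auto intro: sum.cong)
    ultimately show "(\<Sum>\<gamma>\<in>B'. c \<gamma> * pmon J \<gamma> x) = 0" by simp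
  qed
qed

text \<open>Restriction to \<open>X\<close>, extended by zero. Restricted functions stay in the same type, hence in the same
vector space.\<close>

definition restr :: "'a set \<Rightarrow> ('a \<Rightarrow> 'k::zero) \<Rightarrow> 'a \<Rightarrow> 'k"
  where "restr X f = (\<lambda>x. if x \<in> X then f x else 0)"

lemma restr_add: "restr X (f + g) = restr X f + restr X (g :: 'a \<Rightarrow> 'k::field)"
  by (rule ext) (simp add: restr_def)

lemma restr_0: "restr X (0 :: 'a \<Rightarrow> 'k::field) = 0"
  by (rule ext) (simp add: restr_def)

lemma restr_scale: "restr X (fscale (*) c f) = fscale (*) c (restr X (f :: 'a \<Rightarrow> 'k::field))"
  by (rule ext) (simp add: restr_def fscale_def)

lemma restr_span:
  fixes f :: "'a \<Rightarrow> 'k::field"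
  assumes "f \<in> FS.span A" "\<And>a. a \<in> A \<Longrightarrow> restr X (a * h) \<in> FS.span B"
  shows "restr X (f * h) \<in> FS.span B"
  using assms(1)
proof (induction rule: FS.span_induct_alt)
  case base
  show ?case by (simp only: mult_zero_left restr_0 FS.span_zero)
next
  case (step c a p)
  have "(fscale (*) c a + p) * h = fscale (*) c (a * h) + p * h"
    by (rule ext) (simp add: fscale_def algebra_simps)
  then show ?case using step assms(2) by (simp only: restr_add restr_scale FS.span_add FS.span_scale)
qed

text \<open>Products of powers of the forms \<open>y l\<close> with exponents at most \<open>d\<close> and of coordinates with exponents at
most \<open>D\<close>. Extensional exponent functions make the set visibly finite.\<close>

definition gens :: "nat \<Rightarrow> (nat \<Rightarrow> ('i \<Rightarrow> 'k) \<Rightarrow> 'k) \<Rightarrow> 'i set \<Rightarrow> nat \<Rightarrow> nat \<Rightarrow> (('i \<Rightarrow> 'k::field) \<Rightarrow> 'k) set"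
  where "gens c y J D d = (\<lambda>(\<alpha>, \<beta>). (\<lambda>x. \<Prod>l<c. y l x ^ \<alpha> l) * pmon J \<beta>) `
    (PiE {..<c} (\<lambda>_. {..d}) \<times> PiE J (\<lambda>_. {..D}))"

lemma gens_memI:
  assumes "\<And>l. l < c \<Longrightarrow> \<alpha> l \<le> d" "\<And>i. i \<in> J \<Longrightarrow> \<beta> i \<le> D"
  shows "(\<lambda>x. \<Prod>l<c. y l x ^ \<alpha> l) * pmon J \<beta> \<in> gens c y J D d"
proof -
  have e1: "(\<lambda>x. \<Prod>l<c. y l x ^ \<alpha> l) = (\<lambda>x. \<Prod>l<c. y l x ^ restrict \<alpha> {..<c} l)"
    by (intro ext prod.cong) auto
  have e2: "pmon J \<beta> = pmon J (restrict \<beta> J)"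
    unfolding pmon_def by (intro ext prod.cong) auto
  show ?thesis unfolding gens_def
  proof (rule image_eqI)
    show "(\<lambda>x. \<Prod>l<c. y l x ^ \<alpha> l) * pmon J \<beta> =
        (\<lambda>(\<alpha>, \<beta>). (\<lambda>x. \<Prod>l<c. y l x ^ \<alpha> l) * pmon J \<beta>) (restrict \<alpha> {..<c}, restrict \<beta> J)"
      unfolding prod.case by (rule arg_cong2[where f = "(*)", OF e1 e2])
  qed (use assms in auto)
qed

lemma gens_mon:
  assumes "\<And>i. i \<in> J \<Longrightarrow> \<beta> i \<le> D" shows "pmon J \<beta> \<in> gens c y J D d"
proof -
  have "(\<lambda>x. \<Prod>l<c. y l x ^ 0) * pmon J \<beta> = pmon J \<beta>" by (rule ext) simp
  with gens_memI[of c "\<lambda>_. 0" d J \<beta> D y] assms show ?thesis by simp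
qed

lemma gens_memE:
  assumes "f \<in> gens c y J D d"
  obtains \<alpha> \<beta> where "\<forall>l<c. \<alpha> l \<le> d" "\<forall>i\<in>J. \<beta> i \<le> D"
    "f = (\<lambda>x. \<Prod>l<c. y l x ^ \<alpha> l) * pmon J \<beta>"
proof -
  from assms obtain p where p: "f = (\<lambda>(\<alpha>, \<beta>). (\<lambda>x. \<Prod>l<c. y l x ^ \<alpha> l) * pmon J \<beta>) p"
    "p \<in> PiE {..<c} (\<lambda>_. {..d}) \<times> PiE J (\<lambda>_. {..D})" unfolding gens_def by (rule imageE)
  obtain \<alpha> \<beta> where ab: "p = (\<alpha>, \<beta>)" by (cases p)
  show thesis
  proof (rule that)
    show "f = (\<lambda>x. \<Prod>l<c. y l x ^ \<alpha> l) * pmon J \<beta>" using p(1) unfolding ab prod.case .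
  qed (use p(2) ab in auto)
qed

lemma card_gens:
  assumes "finite J"
  shows "finite (gens c y J D d)" "card (gens c y J D d) \<le> (d + 1) ^ c * (D + 1) ^ card J"
proof -
  let ?P = "PiE {..<c} (\<lambda>_. {..d}) \<times> PiE J (\<lambda>_. {..D})"
  have f: "finite ?P" using assms by (auto intro: finite_PiE)
  then show "finite (gens c y J D d)" unfolding gens_def by (rule finite_imageI)
  have "card (gens c y J D d) \<le> card ?P" unfolding gens_def by (rule card_image_le[OF f])
  also have "\<dots> = (d + 1) ^ c * (D + 1) ^ card J"
    using assms by (simp add: card_cartesian_product card_PiE)
  finally show "card (gens c y J D d) \<le> (d + 1) ^ c * (D + 1) ^ card J" .
qed

lemma gens_mono: "d \<le> d' \<Longrightarrow> gens c y J D d \<subseteq> gens c y J D d'"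
  unfolding gens_def by (intro image_mono Sigma_mono PiE_mono) auto

lemma gens_mult:
  assumes "f \<in> gens c y J D d" "l < c"
  shows "y l * f \<in> gens c y J D (Suc d)"
proof -
  from assms(1) obtain \<alpha> \<beta> where *: "\<forall>l<c. \<alpha> l \<le> d" "\<forall>i\<in>J. \<beta> i \<le> D"
    "f = (\<lambda>x. \<Prod>l<c. y l x ^ \<alpha> l) * pmon J \<beta>" by (rule gens_memE)
  have "(\<Prod>m<c. y m x ^ (\<alpha>(l := Suc (\<alpha> l))) m) = y l x * (\<Prod>m<c. y m x ^ \<alpha> m)" for x
  proof -
    have "(\<Prod>m<c. y m x ^ (\<alpha>(l := Suc (\<alpha> l))) m) = (\<Prod>m<c. (if m = l then y m x else 1) * y m x ^ \<alpha> m)"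
      by (rule prod.cong) auto
    then show ?thesis using assms(2) by (simp add: prod.distrib)
  qed
  then have "y l * f = (\<lambda>x. \<Prod>m<c. y m x ^ (\<alpha>(l := Suc (\<alpha> l))) m) * pmon J \<beta>"
    unfolding *(3) by (intro ext) (simp add: mult.assoc)
  moreover have "(\<alpha>(l := Suc (\<alpha> l))) m \<le> Suc d" if "m < c" for m using *(1) that by (auto simp: le_SucI)
  ultimately show ?thesis using gens_memI[of c "\<alpha>(l := Suc (\<alpha> l))" "Suc d" J \<beta> D y] *(2) by (simp only:)
qed

text \<open>On \<open>X\<close> a power \<open>x i ^ Suc D\<close> can be traded for the forms \<open>y l\<close>, at the cost of coefficients of degree
\<open>D\<close>. Each trade lowers by one the degree of the monomial that multiplies the \<open>y l\<close>. So a monomial of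
degree \<open>d\<close> is reached after at most \<open>d\<close> trades, and only bounded powers of the coordinates are left.\<close>

lemma monomials_spanned:
  fixes y :: "nat \<Rightarrow> ('i \<Rightarrow> 'k::field) \<Rightarrow> 'k"
  assumes J: "finite J"
    and g: "\<And>i l. i \<in> J \<Longrightarrow> l < c \<Longrightarrow> g i l \<in> FS.span {pmon J \<beta> | \<beta>. sum \<beta> J = D}"
    and rel: "\<And>i x. i \<in> J \<Longrightarrow> x \<in> X \<Longrightarrow> x i ^ Suc D = (\<Sum>l<c. g i l x * y l x)"
  shows "sum \<gamma> J = d \<Longrightarrow> restr X (pmon J \<gamma>) \<in> FS.span (restr X ` gens c y J D d)"
proof (induction d arbitrary: \<gamma>)
  case 0
  have "pmon J \<gamma> \<in> gens c y J D 0"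
    using 0 J by (intro gens_mon) auto
  then show ?case by (intro FS.span_base imageI)
next
  case (Suc d)
  show ?case
  proof (cases "\<forall>i\<in>J. \<gamma> i \<le> D")
    case True
    then have "pmon J \<gamma> \<in> gens c y J D (Suc d)" by (intro gens_mon) auto
    then show ?thesis by (intro FS.span_base imageI)
  next
    case False
    then obtain i where i: "i \<in> J" "\<gamma> i \<ge> Suc D" by auto
    define \<gamma>' where "\<gamma>' = \<gamma>(i := \<gamma> i - Suc D)"
    have pm: "pmon J \<gamma> x = x i ^ Suc D * pmon J \<gamma>' x" for x :: "'i \<Rightarrow> 'k"
    proof -
      have "pmon J \<gamma> x = (\<Prod>m\<in>J. (if m = i then x m ^ Suc D else 1) * x m ^ \<gamma>' m)"
        unfolding pmon_def \<gamma>'_def using i(2)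
        by (intro prod.cong) (auto simp: power_add[symmetric] simp del: power_Suc)
      then show ?thesis using J i(1) by (simp add: prod.distrib pmon_def del: power_Suc)
    qed
    have "sum \<gamma> J = (\<Sum>m\<in>J. (if m = i then Suc D else 0) + \<gamma>' m)"
      unfolding \<gamma>'_def using i(2) by (intro sum.cong) auto
    then have sum': "sum \<gamma>' J + D = d" using J i(1) Suc.prems by (simp add: sum.distrib)
    have "restr X (pmon J \<gamma>) = (\<Sum>l<c. restr X (y l * (g i l * pmon J \<gamma>')))"
    proof
      fix x
      have "(\<Sum>l<c. restr X (y l * (g i l * pmon J \<gamma>'))) x = (\<Sum>l<c. restr X (y l * (g i l * pmon J \<gamma>')) x)"
        by (induction c) auto
      moreover have "restr X (pmon J \<gamma>) x = (\<Sum>l<c. restr X (y l * (g i l * pmon J \<gamma>')) x)"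
      proof (cases "x \<in> X")
        case True
        have "pmon J \<gamma> x = (\<Sum>l<c. g i l x * y l x) * pmon J \<gamma>' x"
          by (simp only: pm rel[OF i(1) True])
        also have "\<dots> = (\<Sum>l<c. y l x * (g i l x * pmon J \<gamma>' x))"
          by (simp add: sum_distrib_right sum_distrib_left mult_ac)
        finally show ?thesis using True by (simp add: restr_def)
      qed (simp add: restr_def)
      ultimately show "restr X (pmon J \<gamma>) x = (\<Sum>l<c. restr X (y l * (g i l * pmon J \<gamma>'))) x"
        by simp
    qed
    moreover have "restr X (y l * (g i l * pmon J \<gamma>')) \<in> FS.span (restr X ` gens c y J D (Suc d))"
      if l: "l < c" for l
    proof -
      have "restr X (g i l * pmon J \<gamma>') \<in> FS.span (restr X ` gens c y J D d)"
      proof (rule restr_span[OF g[OF i(1) l]])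
        fix a :: "('i \<Rightarrow> 'k) \<Rightarrow> 'k" assume "a \<in> {pmon J \<beta> | \<beta>. sum \<beta> J = D}"
        then obtain \<beta> where \<beta>: "a = pmon J \<beta>" "sum \<beta> J = D" by blast
        have "sum (\<lambda>i. \<beta> i + \<gamma>' i) J = d" using \<beta> sum' by (simp add: sum.distrib)
        from Suc.IH[OF this] show "restr X (a * pmon J \<gamma>') \<in> FS.span (restr X ` gens c y J D d)"
          by (simp only: \<beta>(1) pmon_mult)
      qed
      then have "restr X (restr X (g i l * pmon J \<gamma>') * y l) \<in> FS.span (restr X ` gens c y J D (Suc d))"
      proof (rule restr_span)
        fix a assume "a \<in> restr X ` gens c y J D d"
        then obtain f where f: "f \<in> gens c y J D d" "a = restr X f" by blast
        have "restr X (a * y l) = restr X (y l * f)"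
          unfolding f(2) by (rule ext) (simp add: restr_def)
        with gens_mult[OF f(1) l] show "restr X (a * y l) \<in> FS.span (restr X ` gens c y J D (Suc d))"
          by (simp only:) (intro FS.span_base imageI)
      qed
      moreover have "restr X (restr X (g i l * pmon J \<gamma>') * y l) = restr X (y l * (g i l * pmon J \<gamma>'))"
        by (rule ext) (simp add: restr_def)
      ultimately show ?thesis by (simp only:)
    qed
    ultimately show ?thesis by (simp only:) (intro FS.span_sum, simp)
  qed
qed

text \<open>The left side grows like \<open>e ^ q\<close>, the right side like \<open>e ^ c\<close>.\<close>

lemma polynomial_growth:
  fixes q c a b :: nat
  assumes "\<And>e. (e + 1) ^ q \<le> (e * q + 1) ^ c * b"
  shows "q \<le> c"
proof (rule ccontr)
  assume "\<not> q \<le> c"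
  then have q: "Suc c \<le> q" by simp
  \<comment> \<open>For \<open>q > c\<close> and this \<open>e\<close> the inequality would give \<open>(e + 1) ^ (c + 1) \<le> (e + 1) ^ c * e\<close>.\<close>
  define e where "e = q ^ c * b"
  have "(e + 1) ^ Suc c \<le> (e + 1) ^ q" using q by (intro power_increasing) auto
  also have "\<dots> \<le> (e * q + 1) ^ c * b" by (rule assms)
  also have "\<dots> \<le> ((e + 1) * q) ^ c * b"
    using q by (intro mult_right_mono power_mono) (auto simp: algebra_simps)
  also have "\<dots> = (e + 1) ^ c * e" by (simp only: power_mult_distrib e_def mult.assoc)
  finally have "(e + 1) ^ c * (e + 1) \<le> (e + 1) ^ c * e" by (simp add: algebra_simps)
  then show False by simp
qed

lemma pmon_Pol: "pmon J \<beta> \<in> (Pol J :: (('i \<Rightarrow> 'k::field) \<Rightarrow> 'k) set)"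
proof -
  have "pmon J \<beta> x = (\<Prod>i\<in>J. (\<lambda>x. x i) ^ \<beta> i) x" for x :: "'i \<Rightarrow> 'k"
  proof -
    have "(f ^ n) x = f x ^ n" for f :: "('i \<Rightarrow> 'k) \<Rightarrow> 'k" and n by (induction n) auto
    moreover have "prod g A x = (\<Prod>a\<in>A. g a x)" for g :: "'i \<Rightarrow> ('i \<Rightarrow> 'k) \<Rightarrow> 'k" and A
      by (induction A rule: infinite_finite_induct) auto
    ultimately show ?thesis by (simp add: pmon_def)
  qed
  then have "pmon J \<beta> = (\<Prod>i\<in>J. (\<lambda>x :: 'i \<Rightarrow> 'k. x i) ^ \<beta> i)" by (rule ext)
  then show ?thesis by (simp only:) (intro Pol_prod Pol_power Pol_coord)
qed

lemma independent_family:
  fixes f :: "'b \<Rightarrow> 'a \<Rightarrow> 'k::field"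
  assumes fin: "finite B" and lin: "\<And>c. (\<forall>x. (\<Sum>\<beta>\<in>B. c \<beta> * f \<beta> x) = 0) \<Longrightarrow> \<forall>\<beta>\<in>B. c \<beta> = 0"
  shows "inj_on f B" "\<not> FS.dependent (f ` B)"
proof -
  show inj: "inj_on f B"
  proof (rule inj_onI, rule ccontr)
    fix \<beta> \<gamma> assume *: "\<beta> \<in> B" "\<gamma> \<in> B" "f \<beta> = f \<gamma>" "\<beta> \<noteq> \<gamma>"
    define c :: "'b \<Rightarrow> 'k" where "c \<delta> = (if \<delta> = \<beta> then 1 else 0) - (if \<delta> = \<gamma> then 1 else 0)" for \<delta>
    have "(\<Sum>\<delta>\<in>B. c \<delta> * f \<delta> x) = 0" for x
    proof -
      have "(\<Sum>\<delta>\<in>B. c \<delta> * f \<delta> x) = (\<Sum>\<delta>\<in>B. (if \<delta> = \<beta> then f \<delta> x else 0)) - (\<Sum>\<delta>\<in>B. (if \<delta> = \<gamma> then f \<delta> x else 0))"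
        unfolding sum_subtractf[symmetric] by (rule sum.cong) (auto simp: c_def)
      then show ?thesis using * fin by simp
    qed
    then have "c \<beta> = 0" using lin *(1) by blast
    with *(4) show False by (simp add: c_def)
  qed
  show "\<not> FS.dependent (f ` B)"
  proof
    assume "FS.dependent (f ` B)"
    then obtain u where u: "\<exists>v\<in>f ` B. u v \<noteq> 0" "(\<Sum>v\<in>f ` B. fscale (*) (u v) v) = 0"
      using FS.dependent_finite[of "f ` B"] fin by auto
    have "(\<Sum>\<beta>\<in>B. fscale (*) (u (f \<beta>)) (f \<beta>)) = 0"
      using u(2) by (simp add: sum.reindex[OF inj])
    then have "(\<Sum>\<beta>\<in>B. fscale (*) (u (f \<beta>)) (f \<beta>)) x = 0" for x by simp
    then have "(\<Sum>\<beta>\<in>B. u (f \<beta>) * f \<beta> x) = 0" for x by (simp only: fun_sum_apply fscale_apply)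
    then have "\<forall>\<beta>\<in>B. u (f \<beta>) = 0" by (intro lin allI)
    with u(1) show False by auto
  qed
qed

text \<open>Both sides count functions on \<open>X\<close>: the \<open>(e + 1) ^ card J0\<close> monomials with exponents at most \<open>e\<close> in the
variables of \<open>J0\<close> are independent there by \<open>dense\<close>, and they lie in the span of \<open>gens\<close>, which has
\<open>O(e ^ c)\<close> elements.\<close>

lemma dimension_bound_of_relations:
  fixes y :: "nat \<Rightarrow> ('i \<Rightarrow> 'k::{field, ring_char_0}) \<Rightarrow> 'k"
  assumes J: "finite J" "J0 \<subseteq> J"
    and g: "\<And>i l. i \<in> J \<Longrightarrow> l < c \<Longrightarrow> g i l \<in> FS.span {pmon J \<beta> | \<beta>. sum \<beta> J = D}"
    and rel: "\<And>i x. i \<in> J \<Longrightarrow> x \<in> X \<Longrightarrow> x i ^ Suc D = (\<Sum>l<c. g i l x * y l x)"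
    and dense: "\<And>p. p \<in> Pol J0 \<Longrightarrow> (\<And>x. x \<in> X \<Longrightarrow> p x = 0) \<Longrightarrow> p = 0"
  shows "card J0 \<le> c"
proof (rule polynomial_growth)
  fix e :: nat
  have J0: "finite J0" using J finite_subset by blast
  define B where "B = PiE J0 (\<lambda>_. {..e})"
  define f where "f \<beta> = restr X (pmon J0 \<beta> :: ('i \<Rightarrow> 'k) \<Rightarrow> 'k)" for \<beta>
  have B: "finite B" unfolding B_def using J0 by (auto intro: finite_PiE)
  have lin: "\<forall>\<beta>\<in>B. a \<beta> = 0" if zero: "\<forall>x. (\<Sum>\<beta>\<in>B. a \<beta> * f \<beta> x) = 0" for a :: "('i \<Rightarrow> nat) \<Rightarrow> 'k"
  proof
    fix \<beta> assume "\<beta> \<in> B"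
    define p :: "('i \<Rightarrow> 'k) \<Rightarrow> 'k" where "p = (\<Sum>\<beta>\<in>B. (\<lambda>_. a \<beta>) * pmon J0 \<beta>)"
    have px: "p x = (\<Sum>\<beta>\<in>B. a \<beta> * pmon J0 \<beta> x)" for x by (simp add: p_def fun_sum_apply)
    have "p \<in> Pol J0" unfolding p_def by (intro Pol_sum Pol_mult Pol_const pmon_Pol)
    moreover have "p x = 0" if "x \<in> X" for x
      using spec[OF zero, of x] that by (simp add: px f_def restr_def)
    ultimately have "p = 0" by (rule dense)
    then have "(\<Sum>\<beta>\<in>B. a \<beta> * pmon J0 \<beta> x) = 0" for x using px[of x] by simp
    moreover have "\<beta> = \<beta>'" if "\<beta> \<in> B" "\<beta>' \<in> B" "\<And>i. i \<in> J0 \<Longrightarrow> \<beta> i = \<beta>' i" for \<beta> \<beta>'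
      using that unfolding B_def by (rule PiE_ext)
    ultimately show "a \<beta> = 0" using monomials_independent[OF J0 B, where c = a] \<open>\<beta> \<in> B\<close> by simp
  qed
  note indep = independent_family[where f = f, OF B, OF lin]
  define G where "G = restr X ` gens c y J D (e * card J0)"
  have "f ` B \<subseteq> FS.span G"
  proof
    fix v assume "v \<in> f ` B"
    then obtain \<beta> where \<beta>: "\<beta> \<in> B" "v = f \<beta>" by blast
    define \<gamma> where "\<gamma> i = (if i \<in> J0 then \<beta> i else 0)" for i
    have "pmon J \<gamma> = (pmon J0 \<beta> :: ('i \<Rightarrow> 'k) \<Rightarrow> 'k)"
      unfolding pmon_def \<gamma>_def using J by (intro ext prod.mono_neutral_cong_right) auto
    then have v: "v = restr X (pmon J \<gamma>)" by (simp add: \<beta>(2) f_def)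
    have "sum \<gamma> J = sum \<beta> J0"
      unfolding \<gamma>_def using J by (intro sum.mono_neutral_cong_right) auto
    also have "\<dots> \<le> card J0 * e"
      using \<beta>(1) sum_bounded_above[of J0 \<beta> e] unfolding B_def by (auto simp: PiE_iff)
    finally have "gens c y J D (sum \<gamma> J) \<subseteq> gens c y J D (e * card J0)"
      by (intro gens_mono) (simp add: mult.commute)
    then have "FS.span (restr X ` gens c y J D (sum \<gamma> J)) \<subseteq> FS.span G"
      unfolding G_def by (intro FS.span_mono image_mono)
    with monomials_spanned[OF J(1) g rel refl, of X \<gamma>] show "v \<in> FS.span G"
      unfolding v by blast
  qed
  moreover have G: "finite G" "card G \<le> (e * card J0 + 1) ^ c * (D + 1) ^ card J"
  proof -
    show "finite G" unfolding G_def using card_gens(1)[OF J(1)] by (rule finite_imageI)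
    have "card G \<le> card (gens c y J D (e * card J0))"
      unfolding G_def by (rule card_image_le[OF card_gens(1)[OF J(1)]])
    also note card_gens(2)[OF J(1)]
    finally show "card G \<le> (e * card J0 + 1) ^ c * (D + 1) ^ card J" .
  qed
  ultimately have "card (f ` B) \<le> card G"
    using FS.independent_span_bound[OF G(1) indep(2)] by (simp only: simp_thms)
  then have "card B \<le> card G" using card_image[OF indep(1)] by simp
  moreover have "card B = (e + 1) ^ card J0" unfolding B_def using J0 by (simp add: card_PiE)
  ultimately show "(e + 1) ^ card J0 \<le> (e * card J0 + 1) ^ c * (D + 1) ^ card J" using G(2) by linarith
qed

text \<open>If \<open>c\<close> linear forms have only the origin as a common zero on the closed cone \<open>X\<close>, then \<open>dim X \<le> c\<close>.
The dimension of \<open>X\<close> is bounded from below by a set \<open>J0\<close> of coordinates that are algebraically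
independent on \<open>X\<close>. In the chart \<open>x i = 1\<close> the linear forms have no common zero on \<open>X\<close>, so the
Nullstellensatz writes \<open>1\<close> as a combination of them; homogenizing this relation gives the
relations of the previous lemmas.\<close>

theorem linear_section_dimension_bound:
  fixes Y :: "nat \<Rightarrow> 'i \<Rightarrow> 'k::{alg_closed_field, field_char_0}"
  assumes J: "finite J" "J0 \<subseteq> J"
    and cone: "\<And>x t. x \<in> X \<Longrightarrow> (\<lambda>i. t * x i) \<in> X"
    and closed: "\<And>a. a \<notin> X \<Longrightarrow> \<exists>p\<in>Pol J. (\<forall>x\<in>X. p x = 0) \<and> p a \<noteq> 0"
    and dense: "\<And>p. p \<in> Pol J0 \<Longrightarrow> (\<And>x. x \<in> X \<Longrightarrow> p x = 0) \<Longrightarrow> p = 0"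
    and trivial: "\<And>x i. x \<in> X \<Longrightarrow> (\<And>l. l < c \<Longrightarrow> (\<Sum>i\<in>J. Y l i * x i) = 0) \<Longrightarrow> i \<in> J \<Longrightarrow> x i = 0"
  shows "card J0 \<le> c"
proof -
  define y where "y l = (\<Sum>i\<in>J. (\<lambda>_. Y l i) * (\<lambda>x :: 'i \<Rightarrow> 'k. x i))" for l
  have yx: "y l x = (\<Sum>i\<in>J. Y l i * x i)" for l x by (simp add: y_def fun_sum_apply)
  have y: "y l \<in> Pol J" for l unfolding y_def by (intro Pol_sum Pol_mult Pol_const Pol_coord)
  have ex: "\<exists>h. (\<forall>l<c. h l \<in> Pol J) \<and> (\<forall>x\<in>X. x i = 1 \<longrightarrow> 1 = (\<Sum>l<c. h l x * y l x))" if i: "i \<in> J" for i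
  proof -
    \<comment> \<open>The ideal generated by the linear forms and by the functions that vanish on \<open>X\<close> in the chart
      \<open>x i = 1\<close>.\<close>
    define I where "I = {p \<in> Pol J. \<exists>h. (\<forall>l<c. h l \<in> Pol J) \<and> (\<forall>x\<in>X. x i = 1 \<longrightarrow> p x = (\<Sum>l<c. h l x * y l x))}"
    have memI: "p \<in> I" if "p \<in> Pol J" "\<And>l. l < c \<Longrightarrow> h l \<in> Pol J"
      "\<And>x. x \<in> X \<Longrightarrow> x i = 1 \<Longrightarrow> p x = (\<Sum>l<c. h l x * y l x)" for p h
      unfolding I_def using that by blast
    have mem0: "p \<in> I" if "p \<in> Pol J" "\<And>x. x \<in> X \<Longrightarrow> x i = 1 \<Longrightarrow> p x = 0" for p
      by (rule memI[OF that(1), of "\<lambda>_. 0"]) (use that(2) Pol_0 in simp_all)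
    have memE: "\<exists>h. (\<forall>l<c. h l \<in> Pol J) \<and> (\<forall>x\<in>X. x i = 1 \<longrightarrow> p x = (\<Sum>l<c. h l x * y l x))"
      if "p \<in> I" for p using that unfolding I_def by blast
    have "poly_ideal J I"
      unfolding poly_ideal_def
    proof (intro conjI ballI)
      show sub: "I \<subseteq> Pol J" by (auto simp: I_def)
      show "0 \<in> I" by (rule mem0[OF Pol_0]) simp
      fix p assume p: "p \<in> I"
      from memE[OF p] obtain h where h: "\<forall>l<c. h l \<in> Pol J"
        "\<forall>x\<in>X. x i = 1 \<longrightarrow> p x = (\<Sum>l<c. h l x * y l x)" by (elim exE conjE)
      show "p + q \<in> I" if q: "q \<in> I" for q
      proof -
        from memE[OF q] obtain h' where h': "\<forall>l<c. h' l \<in> Pol J"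
          "\<forall>x\<in>X. x i = 1 \<longrightarrow> q x = (\<Sum>l<c. h' l x * y l x)" by (elim exE conjE)
        show ?thesis
        proof (rule memI)
          show "p + q \<in> Pol J" using p q sub Pol_add by blast
          show "h l + h' l \<in> Pol J" if "l < c" for l using h h' that Pol_add by blast
          show "(p + q) x = (\<Sum>l<c. (h l + h' l) x * y l x)" if "x \<in> X" "x i = 1" for x
            using h(2) h'(2) that by (simp add: distrib_right sum.distrib)
        qed
      qed
      show "q * p \<in> I" if q: "q \<in> Pol J" for q
      proof (rule memI)
        show "q * p \<in> Pol J" using p q sub Pol_mult by blast
        show "q * h l \<in> Pol J" if "l < c" for l using h q that Pol_mult by blast
        show "(q * p) x = (\<Sum>l<c. (q * h l) x * y l x)" if "x \<in> X" "x i = 1" for x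
          using h(2) that by (simp add: sum_distrib_left mult.assoc)
      qed
    qed
    have "1 \<in> I"
    proof (rule ccontr)
      assume "1 \<notin> I"
      from weak_nullstellensatz[OF J(1) \<open>poly_ideal J I\<close> this] obtain a where a: "\<And>p. p \<in> I \<Longrightarrow> p a = 0" by blast
      have "a \<in> X"
      proof (rule ccontr)
        assume "a \<notin> X"
        from closed[OF this] obtain p where p: "p \<in> Pol J" "\<forall>x\<in>X. p x = 0" "p a \<noteq> 0" by blast
        then have "p \<in> I" by (intro mem0) simp_all
        with a p(3) show False by blast
      qed
      have "(\<lambda>x. x i) - 1 \<in> I"
        by (intro mem0 Pol_diff Pol_1 Pol_coord i) simp
      from a[OF this] have "a i = 1" by simp
      have "y l \<in> I" if l: "l < c" for l
      proof -
        define e where "e m = (if m = l then 1 else 0 :: ('i \<Rightarrow> 'k) \<Rightarrow> 'k)" for m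
        show ?thesis
        proof (rule memI[OF y])
          show "e m \<in> Pol J" for m unfolding e_def by (cases "m = l") (simp_all add: Pol_0 Pol_1)
          show "y l x = (\<Sum>m<c. e m x * y m x)" for x
          proof -
            have "(\<Sum>m<c. e m x * y m x) = (\<Sum>m<c. if m = l then y m x else 0)"
              by (rule sum.cong) (auto simp: e_def)
            then show ?thesis using l by simp
          qed
        qed
      qed
      then have "(\<Sum>i\<in>J. Y l i * a i) = 0" if "l < c" for l using a that yx by metis
      from trivial[OF \<open>a \<in> X\<close> this i] \<open>a i = 1\<close> show False by simp
    qed
    then show ?thesis by (simp add: I_def)
  qed
  then obtain h where h: "\<And>i l. i \<in> J \<Longrightarrow> l < c \<Longrightarrow> h i l \<in> Pol J"
    "\<And>i x. i \<in> J \<Longrightarrow> x \<in> X \<Longrightarrow> x i = 1 \<Longrightarrow> 1 = (\<Sum>l<c. h i l x * y l x)" by metis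
  from h(1) have "\<exists>d. polyfun J d (h i l)" if "i \<in> J" "l < c" for i l using that by (auto simp: Pol_def)
  then obtain dd where dd: "\<And>i l. i \<in> J \<Longrightarrow> l < c \<Longrightarrow> polyfun J (dd i l) (h i l)" by metis
  define D where "D = Suc (\<Sum>i\<in>J. \<Sum>l<c. dd i l)"
  have "dd i l < D" if "i \<in> J" "l < c" for i l
  proof -
    have "dd i l \<le> (\<Sum>l<c. dd i l)" using that by (intro member_le_sum) auto
    also have "\<dots> \<le> (\<Sum>i\<in>J. \<Sum>l<c. dd i l)" using that J(1) by (intro member_le_sum[of i J "\<lambda>i. \<Sum>l<c. dd i l"]) auto
    finally show ?thesis by (simp add: D_def)
  qed
  note D = this
  define g where "g i l = (SOME g. g \<in> FS.span {pmon J \<beta> | \<beta>. sum \<beta> J = D} \<and>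
      (\<forall>x. g x = (if x i = 0 then 0 else x i ^ D * h i l (\<lambda>m. x m / x i))))" for i l
  have g: "g i l \<in> FS.span {pmon J \<beta> | \<beta>. sum \<beta> J = D} \<and>
      (\<forall>x. g i l x = (if x i = 0 then 0 else x i ^ D * h i l (\<lambda>m. x m / x i)))" if "i \<in> J" "l < c" for i l
    unfolding g_def using homogenize[OF J(1) that(1) dd[OF that] D[OF that]]
    unfolding Bex_def by (rule someI_ex)
  have g1: "g i l \<in> FS.span {pmon J \<beta> | \<beta>. sum \<beta> J = D}" if "i \<in> J" "l < c" for i l
    using g[OF that] by (rule conjunct1)
  have g2: "g i l x = (if x i = 0 then 0 else x i ^ D * h i l (\<lambda>m. x m / x i))" if "i \<in> J" "l < c" for i l x
    using g[OF that, THEN conjunct2] by (rule spec)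
  have rel: "x i ^ Suc D = (\<Sum>l<c. g i l x * y l x)" if i: "i \<in> J" and x: "x \<in> X" for i x
  proof (cases "x i = 0")
    case True
    then show ?thesis using g2[OF i] by simp
  next
    case False
    have "(\<lambda>m. x m / x i) \<in> X" using cone[OF x, of "inverse (x i)"] by (simp add: divide_inverse mult.commute)
    have "1 = (\<Sum>l<c. h i l (\<lambda>m. x m / x i) * y l (\<lambda>m. x m / x i))"
      using False by (intro h(2)[OF i \<open>(\<lambda>m. x m / x i) \<in> X\<close>]) simp
    moreover have "y l (\<lambda>m. x m / x i) = y l x / x i" for l by (simp add: yx sum_divide_distrib)
    ultimately have 1: "(\<Sum>l<c. h i l (\<lambda>m. x m / x i) * (y l x / x i)) = 1" by simp
    have "x i ^ Suc D = x i ^ Suc D * (\<Sum>l<c. h i l (\<lambda>m. x m / x i) * (y l x / x i))"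
      unfolding 1 by simp
    also have "\<dots> = (\<Sum>l<c. g i l x * y l x)"
      unfolding sum_distrib_left using False g2[OF i] by (intro sum.cong) auto
    finally show ?thesis .
  qed
  show ?thesis
  proof (rule dimension_bound_of_relations[where X = X and g = g and y = y and D = D, OF J])
    show "g i l \<in> FS.span {pmon J \<beta> | \<beta>. sum \<beta> J = D}" if "i \<in> J" "l < c" for i l
      using that by (rule g1)
    show "x i ^ Suc D = (\<Sum>l<c. g i l x * y l x)" if "i \<in> J" "x \<in> X" for i x
      using that by (rule rel)
    show "p = 0" if "p \<in> Pol J0" "\<And>x. x \<in> X \<Longrightarrow> p x = 0" for p
      using that by (rule dense)
  qed
qed

section \<open>Matrices of bounded rank\<close>

definition minor :: "nat \<Rightarrow> (nat \<Rightarrow> nat) \<Rightarrow> (nat \<Rightarrow> nat) \<Rightarrow> (nat \<times> nat \<Rightarrow> 'k::comm_ring_1) \<Rightarrow> 'k"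
  where "minor r \<rho> \<kappa> A = det (mat r r (\<lambda>(a, b). A (\<rho> a, \<kappa> b)))"

text \<open>Matrices of rank at most \<open>m\<close>, by a factorization through an \<open>m\<close>-dimensional space. Only the entries
with \<open>i < s\<close> and \<open>j < N\<close> matter.\<close>

definition rank_le :: "nat \<Rightarrow> nat \<Rightarrow> nat \<Rightarrow> (nat \<times> nat \<Rightarrow> 'k::field) set"
  where "rank_le s N m = {A. \<exists>B C. \<forall>i<s. \<forall>j<N. A (i, j) = (\<Sum>l<m. B i l * C l j)}"

lemma rank_leI:
  "(\<And>i j. i < s \<Longrightarrow> j < N \<Longrightarrow> A (i, j) = (\<Sum>l<m. B i l * C l j)) \<Longrightarrow> A \<in> rank_le s N m"
  unfolding rank_le_def by blast

lemma rank_le_mono: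
  assumes "r \<le> m" shows "rank_le s N r \<subseteq> rank_le s N m"
proof
  fix A :: "nat \<times> nat \<Rightarrow> 'k::field" assume "A \<in> rank_le s N r"
  then obtain B C where *: "\<forall>i<s. \<forall>j<N. A (i, j) = (\<Sum>l<r. B i l * C l j)"
    unfolding rank_le_def by blast
  have "(\<Sum>l<m. (if l < r then B i l else 0) * C l j) = (\<Sum>l<r. B i l * C l j)" for i j
    using assms by (intro sum.mono_neutral_cong_right) auto
  with * have "\<forall>i<s. \<forall>j<N. A (i, j) = (\<Sum>l<m. (if l < r then B i l else 0) * C l j)" by simp
  then show "A \<in> rank_le s N m"
    unfolding rank_le_def by (intro CollectI exI[of _ "\<lambda>i l. if l < r then B i l else 0"] exI[of _ C])
qed

lemma minor_Pol:
  assumes "\<And>a. a < r \<Longrightarrow> \<rho> a < s" "\<And>b. b < r \<Longrightarrow> \<kappa> b < N"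
  shows "minor r \<rho> \<kappa> \<in> (Pol ({..<s} \<times> {..<N}) :: ((nat \<times> nat \<Rightarrow> 'k::field) \<Rightarrow> 'k) set)"
proof -
  define M :: "((nat \<times> nat \<Rightarrow> 'k) \<Rightarrow> 'k) mat" where "M = mat r r (\<lambda>(a, b) A. A (\<rho> a, \<kappa> b))"
  have "minor r \<rho> \<kappa> A = det M A" for A :: "nat \<times> nat \<Rightarrow> 'k"
  proof -
    interpret ev: comm_ring_hom "\<lambda>f :: (nat \<times> nat \<Rightarrow> 'k) \<Rightarrow> 'k. f A"
      by unfold_locales auto
    have "map_mat (\<lambda>f. f A) M = mat r r (\<lambda>(a, b). A (\<rho> a, \<kappa> b))"
      by (intro eq_matI) (auto simp: M_def)
    then show ?thesis using ev.hom_det[of M] by (simp add: minor_def)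
  qed
  then have "minor r \<rho> \<kappa> = det M" by (rule ext)
  moreover have "det M \<in> Pol ({..<s} \<times> {..<N})"
  proof (rule Pol_det)
    fix i j assume "i < dim_row M" "j < dim_col M"
    then have ij: "i < r" "j < r" by (auto simp: M_def)
    then have "M $$ (i, j) = (\<lambda>A. A (\<rho> i, \<kappa> j))" by (simp add: M_def)
    moreover have "(\<lambda>A :: nat \<times> nat \<Rightarrow> 'k. A (\<rho> i, \<kappa> j)) \<in> Pol ({..<s} \<times> {..<N})"
      using assms ij by (intro Pol_coord) auto
    ultimately show "M $$ (i, j) \<in> Pol ({..<s} \<times> {..<N})" by simp
  qed
  ultimately show ?thesis by simp
qed

lemma minor_rank_le:
  fixes A :: "nat \<times> nat \<Rightarrow> 'k::field"
  assumes "A \<in> rank_le s N m" "\<And>a. a < Suc m \<Longrightarrow> \<rho> a < s" "\<And>b. b < Suc m \<Longrightarrow> \<kappa> b < N"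
  shows "minor (Suc m) \<rho> \<kappa> A = 0"
proof -
  from assms(1) obtain B C where *: "\<And>i j. i < s \<Longrightarrow> j < N \<Longrightarrow> A (i, j) = (\<Sum>l<m. B i l * C l j)"
    unfolding rank_le_def by blast
  define P where "P = mat (Suc m) (Suc m) (\<lambda>(a, l). if l < m then B (\<rho> a) l else 0)"
  define Q where "Q = mat (Suc m) (Suc m) (\<lambda>(l, b). C l (\<kappa> b))"
  have P: "P \<in> carrier_mat (Suc m) (Suc m)" and Q: "Q \<in> carrier_mat (Suc m) (Suc m)"
    by (auto simp: P_def Q_def)
  have "det P = (\<Sum>a<Suc m. P $$ (a, m) * cofactor P a m)"
    by (rule laplace_expansion_column[OF P]) simp
  then have "det P = 0" by (simp add: P_def)
  have "mat (Suc m) (Suc m) (\<lambda>(a, b). A (\<rho> a, \<kappa> b)) = P * Q"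
  proof (rule eq_matI)
    fix a b assume "a < dim_row (P * Q)" "b < dim_col (P * Q)"
    then have ab: "a < Suc m" "b < Suc m" using P Q by auto
    have "(P * Q) $$ (a, b) = (\<Sum>l<Suc m. P $$ (a, l) * Q $$ (l, b))"
      using P Q ab by (simp add: scalar_prod_def atLeast0LessThan)
    also have "\<dots> = (\<Sum>l<m. B (\<rho> a) l * C l (\<kappa> b))" using ab by (simp add: P_def Q_def)
    also have "\<dots> = A (\<rho> a, \<kappa> b)" using *[of "\<rho> a" "\<kappa> b"] assms ab by simp
    finally show "mat (Suc m) (Suc m) (\<lambda>(a, b). A (\<rho> a, \<kappa> b)) $$ (a, b) = (P * Q) $$ (a, b)"
      using ab by simp
  qed (use P Q in auto)
  then have "minor (Suc m) \<rho> \<kappa> A = det P * det Q" unfolding minor_def by (simp add: det_mult[OF P Q])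
  with \<open>det P = 0\<close> show ?thesis by simp
qed

text \<open>Expand a vanishing bordered minor along its last row. The cofactors depend on the added column only,
and the last one is the given non-zero minor. So every row of \<open>A\<close> is a combination of the same \<open>r\<close>
rows of cofactors.\<close>

lemma rank_le_of_bordered_minors:
  fixes A :: "nat \<times> nat \<Rightarrow> 'k::field"
  assumes nz: "minor r \<rho> \<kappa> A \<noteq> 0"
    and zero: "\<And>i j. i < s \<Longrightarrow> j < N \<Longrightarrow> minor (Suc r) (\<rho>(r := i)) (\<kappa>(r := j)) A = 0"
  shows "A \<in> rank_le s N r"
proof -
  define M where "M i j = mat (Suc r) (Suc r) (\<lambda>(a, b). A ((\<rho>(r := i)) a, (\<kappa>(r := j)) b))" for i j
  define K where "K b j = cofactor (M 0 j) r b" for b j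
  have M: "M i j \<in> carrier_mat (Suc r) (Suc r)" for i j by (simp add: M_def)
  have K: "cofactor (M i j) r b = K b j" if "b \<le> r" for i j b
  proof -
    have "mat_delete (M i j) r b = mat_delete (M 0 j) r b"
      using that by (intro eq_matI) (auto simp: mat_delete_def M_def)
    then show ?thesis by (simp add: K_def cofactor_def)
  qed
  have Kr: "K r j = minor r \<rho> \<kappa> A" for j
  proof -
    have "mat_delete (M 0 j) r r = mat r r (\<lambda>(a, b). A (\<rho> a, \<kappa> b))"
      by (intro eq_matI) (auto simp: mat_delete_def M_def)
    then show ?thesis by (simp add: K_def cofactor_def minor_def)
  qed
  have Mr: "M i j $$ (r, b) = (if b < r then A (i, \<kappa> b) else A (i, j))" if "b \<le> r" for i j b
    using that by (simp add: M_def)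
  have "A (i, j) = (\<Sum>b<r. A (i, \<kappa> b) * (- K b j / minor r \<rho> \<kappa> A))" if "i < s" "j < N" for i j
  proof -
    have "0 = det (M i j)" using zero[OF that] by (simp add: minor_def M_def)
    also have "\<dots> = (\<Sum>b<Suc r. M i j $$ (r, b) * cofactor (M i j) r b)"
      by (rule laplace_expansion_row[OF M]) simp
    also have "\<dots> = (\<Sum>b<r. A (i, \<kappa> b) * K b j) + A (i, j) * minor r \<rho> \<kappa> A"
      unfolding sum.lessThan_Suc
      by (intro arg_cong2[where f = "(+)"] sum.cong) (simp_all add: K Kr Mr)
    finally have "A (i, j) * minor r \<rho> \<kappa> A = - (\<Sum>b<r. A (i, \<kappa> b) * K b j)"
      by (simp add: eq_neg_iff_add_eq_0 add.commute)
    then have "A (i, j) = - (\<Sum>b<r. A (i, \<kappa> b) * K b j) / minor r \<rho> \<kappa> A"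
      using nz by (simp add: field_simps)
    also have "\<dots> = (\<Sum>b<r. A (i, \<kappa> b) * (- K b j / minor r \<rho> \<kappa> A))"
      by (simp add: sum_negf sum_divide_distrib)
    finally show ?thesis .
  qed
  then show ?thesis by (rule rank_leI)
qed

text \<open>If all the minors that border a non-zero minor vanish, then the rank is at most its size. Hence, below
the rank, a non-zero minor can be enlarged. This shows that matrices of rank at most \<open>m\<close> are cut out by
minors.\<close>

lemma nonzero_minor_of_rank_gt:
  fixes A :: "nat \<times> nat \<Rightarrow> 'k::field"
  assumes "A \<notin> rank_le s N m" "r \<le> Suc m"
  shows "\<exists>\<rho> \<kappa>. (\<forall>a<r. \<rho> a < s) \<and> (\<forall>b<r. \<kappa> b < N) \<and> minor r \<rho> \<kappa> A \<noteq> 0"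
  using assms(2)
proof (induction r)
  case 0
  show ?case by (intro exI) (simp add: minor_def)
next
  case (Suc r)
  then obtain \<rho> \<kappa> where *: "\<forall>a<r. \<rho> a < s" "\<forall>b<r. \<kappa> b < N" "minor r \<rho> \<kappa> A \<noteq> 0" by auto
  show ?case
  proof (rule ccontr)
    assume no: "\<not> ?thesis"
    have "minor (Suc r) (\<rho>(r := i)) (\<kappa>(r := j)) A = 0" if ij: "i < s" "j < N" for i j
    proof -
      have "\<forall>a<Suc r. (\<rho>(r := i)) a < s" "\<forall>b<Suc r. (\<kappa>(r := j)) b < N"
        using * ij by (auto simp: less_Suc_eq)
      with no show ?thesis by blast
    qed
    from rank_le_of_bordered_minors[OF *(3) this] have "A \<in> rank_le s N r" .
    with rank_le_mono[of r m s N] Suc.prems assms(1) show False by auto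
  qed
qed

text \<open>The entries in the first \<open>m\<close> rows and columns are algebraically independent on the matrices of rank at
most \<open>m\<close>: they can be prescribed freely as long as the upper left block \<open>P\<close> is invertible. Adding
\<open>t\<close> to the diagonal of this block makes it invertible for all but finitely many \<open>t\<close>.\<close>

lemma rank_le_dense:
  fixes p :: "(nat \<times> nat \<Rightarrow> 'k::{field, ring_char_0}) \<Rightarrow> 'k"
  assumes p: "p \<in> Pol {(i, j). i < s \<and> j < N \<and> (i < m \<or> j < m)}"
    and zero: "\<And>A. A \<in> rank_le s N m \<Longrightarrow> p A = 0"
  shows "p = 0"
proof
  fix A :: "nat \<times> nat \<Rightarrow> 'k"
  define E :: "nat \<times> nat \<Rightarrow> 'k" where "E = (\<lambda>(i, j). if i = j \<and> i < m then 1 else 0)"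
  from p obtain d where "polyfun {(i, j). i < s \<and> j < N \<and> (i < m \<or> j < m)} d p" by (auto simp: Pol_def)
  from polyfun_line[OF this, of A E] obtain u where u: "\<And>t. p (\<lambda>i. A i + t * E i) = poly u t" by blast
  define P where "P t = mat m m (\<lambda>(a, b). A (a, b) + t * E (a, b))" for t
  define Pm where "Pm = mat m m (\<lambda>(a, b). - A (a, b))"
  have Pm: "Pm \<in> carrier_mat m m" by (simp add: Pm_def)
  \<comment> \<open>Up to sign the matrix \<open>Pm\<close> is the upper left block, and \<open>q\<close> is the determinant of the perturbed block.\<close>
  define q where "q = char_poly Pm"
  have q: "poly q t = det (P t)" for t
  proof -
    have ev: "comm_ring_hom (\<lambda>f. poly f t)" by unfold_locales auto
    have "map_mat (\<lambda>f. poly f t) (char_poly_matrix Pm) = P t"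
      by (intro eq_matI) (auto simp: char_poly_matrix_def Pm_def P_def E_def)
    then show ?thesis using comm_ring_hom.hom_det[OF ev, of "char_poly_matrix Pm"] by (simp add: q_def char_poly_def)
  qed
  have "q \<noteq> 0" using degree_monic_char_poly[OF Pm] unfolding q_def by auto
  have "poly u t = 0" if t: "det (P t) \<noteq> 0" for t
  proof -
    have P: "P t \<in> carrier_mat m m" by (simp add: P_def)
    define R where "R a l = inverse (det (P t)) * adj_mat (P t) $$ (a, l)" for a l
    have inv: "(\<Sum>l<m. R a l * (A (l, j) + t * E (l, j))) = (if a = j then 1 else 0)" if "a < m" "j < m" for a j
    proof -
      have "(adj_mat (P t) * P t) $$ (a, j) = (\<Sum>l<m. adj_mat (P t) $$ (a, l) * P t $$ (l, j))"
        using adj_mat(1)[OF P] P that by (simp add: scalar_prod_def atLeast0LessThan)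
      moreover have "(adj_mat (P t) * P t) $$ (a, j) = (if a = j then det (P t) else 0)"
        unfolding adj_mat(3)[OF P] using that by simp
      ultimately have "(\<Sum>l<m. adj_mat (P t) $$ (a, l) * (A (l, j) + t * E (l, j))) = (if a = j then det (P t) else 0)"
        using that by (simp add: P_def)
      then have "inverse (det (P t)) * (\<Sum>l<m. adj_mat (P t) $$ (a, l) * (A (l, j) + t * E (l, j))) =
          (if a = j then 1 else 0)" using t by simp
      then show ?thesis by (simp add: R_def sum_distrib_left mult.assoc)
    qed
    \<comment> \<open>The remaining block is \<open>R P\<^sup>-\<^sup>1 Q\<close>.\<close>
    define B where "B i l = (if i < m then (if i = l then 1 else 0) else (\<Sum>a<m. A (i, a) * R a l))" for i l
    define At where "At = (\<lambda>(i, j). \<Sum>l<m. B i l * (A (l, j) + t * E (l, j)))"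
    have "At \<in> rank_le s N m"
      unfolding rank_le_def At_def
      by (intro CollectI exI[of _ B] exI[of _ "\<lambda>l j. A (l, j) + t * E (l, j)"]) simp
    then have "p At = 0" by (rule zero)
    have "p At = p (\<lambda>i. A i + t * E i)"
    proof (rule Pol_cong[OF p])
      fix ij assume "ij \<in> {(i, j). i < s \<and> j < N \<and> (i < m \<or> j < m)}"
      then obtain i j where ij: "ij = (i, j)" "i < m \<or> j < m" by blast
      show "At ij = A ij + t * E ij"
      proof (cases "i < m")
        case True
        have "At (i, j) = (\<Sum>l<m. if i = l then A (l, j) + t * E (l, j) else 0)"
          unfolding At_def prod.case by (rule sum.cong) (use True in \<open>auto simp: B_def\<close>)
        then show ?thesis using True ij by simp
      next
        case False
        with ij have j: "j < m" by simp
        have "At (i, j) = (\<Sum>l<m. \<Sum>a<m. A (i, a) * (R a l * (A (l, j) + t * E (l, j))))"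
          unfolding At_def prod.case using False by (simp add: B_def sum_distrib_right mult.assoc)
        also have "\<dots> = (\<Sum>a<m. A (i, a) * (\<Sum>l<m. R a l * (A (l, j) + t * E (l, j))))"
          by (subst sum.swap) (simp add: sum_distrib_left)
        also have "\<dots> = (\<Sum>a<m. if a = j then A (i, a) else 0)"
          by (rule sum.cong) (use j in \<open>auto simp: inv\<close>)
        also have "\<dots> = A (i, j)" using j by simp
        finally show ?thesis using False ij by (simp add: E_def)
      qed
    qed
    with \<open>p At = 0\<close> u show ?thesis by simp
  qed
  then have "poly (u * q) t = 0" for t using q by auto
  from poly_eq_0_of_infinite_field[OF this] \<open>q \<noteq> 0\<close> have "u = 0" by simp
  with u[of 0] show "p A = 0 A" by simp
qed

text \<open>The cone of matrices of rank at most \<open>m\<close> has dimension \<open>m * (s + N - m)\<close>, the number of entries that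
lie in the first \<open>m\<close> rows or columns.\<close>

theorem linear_space_avoiding_rank_le:
  fixes Y :: "nat \<Rightarrow> nat \<times> nat \<Rightarrow> 'k::{alg_closed_field, field_char_0}"
  assumes m: "m \<le> s" "m \<le> N"
    and trivial: "\<And>A i j. A \<in> rank_le s N m \<Longrightarrow>
      (\<And>l. l < c \<Longrightarrow> (\<Sum>ij\<in>{..<s} \<times> {..<N}. Y l ij * A ij) = 0) \<Longrightarrow> i < s \<Longrightarrow> j < N \<Longrightarrow> A (i, j) = 0"
  shows "m * (s + N - m) \<le> c"
proof -
  let ?J = "{..<s} \<times> {..<N}" and ?K = "{(i, j). i < s \<and> j < N \<and> (i < m \<or> j < m)}"
  have "card ?K \<le> c"
  proof (rule linear_section_dimension_bound[where J = ?J and X = "rank_le s N m" and Y = Y])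
    show "finite ?J" "?K \<subseteq> ?J" by auto
    show "(\<lambda>i. t * A i) \<in> rank_le s N m" if "A \<in> rank_le s N m" for A :: "nat \<times> nat \<Rightarrow> 'k" and t
    proof -
      from that obtain B C where "\<forall>i<s. \<forall>j<N. A (i, j) = (\<Sum>l<m. B i l * C l j)"
        unfolding rank_le_def by blast
      then show ?thesis unfolding rank_le_def
        by (intro CollectI exI[of _ "\<lambda>i l. t * B i l"] exI[of _ C]) (simp add: sum_distrib_left mult.assoc)
    qed
    show "\<exists>p\<in>Pol ?J. (\<forall>A\<in>rank_le s N m. p A = 0) \<and> p a \<noteq> 0" if "a \<notin> rank_le s N m" for a :: "nat \<times> nat \<Rightarrow> 'k"
    proof -
      from nonzero_minor_of_rank_gt[OF that order_refl] obtain \<rho> \<kappa> where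
        *: "\<forall>a<Suc m. \<rho> a < s" "\<forall>b<Suc m. \<kappa> b < N" "minor (Suc m) \<rho> \<kappa> a \<noteq> 0" by blast
      have "minor (Suc m) \<rho> \<kappa> \<in> (Pol ?J :: ((nat \<times> nat \<Rightarrow> 'k) \<Rightarrow> 'k) set)"
        using * by (intro minor_Pol) auto
      moreover have "\<forall>A\<in>rank_le s N m. minor (Suc m) \<rho> \<kappa> A = 0" using * minor_rank_le by blast
      ultimately show ?thesis using *(3) by blast
    qed
    show "p = 0" if "p \<in> Pol ?K" "\<And>A. A \<in> rank_le s N m \<Longrightarrow> p A = 0" for p :: "(nat \<times> nat \<Rightarrow> 'k) \<Rightarrow> 'k"
      using that by (rule rank_le_dense)
    show "A ij = 0" if "A \<in> rank_le s N m" "\<And>l. l < c \<Longrightarrow> (\<Sum>ij\<in>?J. Y l ij * A ij) = 0" "ij \<in> ?J" for A ij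
      using trivial[OF that(1,2)] that(3) by (cases ij) auto
  qed
  moreover have "card ?K = m * (s + N - m)"
  proof -
    have e: "?K = ?J - {m..<s} \<times> {m..<N}" by auto
    have "card (?J - {m..<s} \<times> {m..<N}) = card ?J - card ({m..<s} \<times> {m..<N})"
      by (rule card_Diff_subset) auto
    then have "card ?K = s * N - (s - m) * (N - m)"
      unfolding e by (simp add: card_cartesian_product)
    moreover from m obtain a b where "s = m + a" "N = m + b" by (auto simp: le_iff_add)
    then have "s * N - (s - m) * (N - m) = m * (s + N - m)" by (simp add: algebra_simps)
    ultimately show ?thesis by simp
  qed
  ultimately show ?thesis by simp
qed

section \<open>Rational functions on the projective line\<close>

text \<open>The function \<open>h\<close> is a quotient of polynomials near \<open>t0\<close> in the Zariski topology of the line, whose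
neighbourhoods are the cofinite sets.\<close>

definition rational_near :: "('k::field \<Rightarrow> 'k) \<Rightarrow> 'k \<Rightarrow> bool"
  where "rational_near h t0 \<longleftrightarrow> (\<exists>p q S. finite S \<and> t0 \<notin> S \<and>
    (\<forall>t. t \<notin> S \<longrightarrow> poly q t \<noteq> 0 \<and> h t = poly p t / poly q t))"

lemma rational_nearI:
  assumes "finite S" "t0 \<notin> S" "\<And>t. t \<notin> S \<Longrightarrow> poly q t \<noteq> 0" "\<And>t. t \<notin> S \<Longrightarrow> h t = poly p t / poly q t"
  shows "rational_near h t0"
  unfolding rational_near_def using assms by blast

lemma rational_nearE:
  assumes "rational_near h t0"
  obtains p q S where "finite S" "t0 \<notin> S" "\<forall>t. t \<notin> S \<longrightarrow> poly q t \<noteq> 0"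
    "\<forall>t. t \<notin> S \<longrightarrow> h t = poly p t / poly q t"
  using assms unfolding rational_near_def by blast

lemma rational_near_poly: "rational_near (\<lambda>t. poly p t) t0"
  by (rule rational_nearI[of "{}" _ 1 _ p]) auto

lemma rational_near_add:
  assumes "rational_near f t0" "rational_near g t0" shows "rational_near (\<lambda>t. f t + g t) t0"
proof -
  from assms(1) obtain p q S where 1: "finite S" "t0 \<notin> S" "\<forall>t. t \<notin> S \<longrightarrow> poly q t \<noteq> 0"
    "\<forall>t. t \<notin> S \<longrightarrow> f t = poly p t / poly q t" by (rule rational_nearE)
  from assms(2) obtain p' q' S' where 2: "finite S'" "t0 \<notin> S'" "\<forall>t. t \<notin> S' \<longrightarrow> poly q' t \<noteq> 0"
    "\<forall>t. t \<notin> S' \<longrightarrow> g t = poly p' t / poly q' t" by (rule rational_nearE)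
  show ?thesis
    by (rule rational_nearI[of "S \<union> S'" _ "q * q'" _ "p * q' + p' * q"])
      (use 1 2 in \<open>auto simp: add_frac_eq\<close>)
qed

lemma rational_near_mult:
  assumes "rational_near f t0" "rational_near g t0" shows "rational_near (\<lambda>t. f t * g t) t0"
proof -
  from assms(1) obtain p q S where 1: "finite S" "t0 \<notin> S" "\<forall>t. t \<notin> S \<longrightarrow> poly q t \<noteq> 0"
    "\<forall>t. t \<notin> S \<longrightarrow> f t = poly p t / poly q t" by (rule rational_nearE)
  from assms(2) obtain p' q' S' where 2: "finite S'" "t0 \<notin> S'" "\<forall>t. t \<notin> S' \<longrightarrow> poly q' t \<noteq> 0"
    "\<forall>t. t \<notin> S' \<longrightarrow> g t = poly p' t / poly q' t" by (rule rational_nearE)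
  show ?thesis
    by (rule rational_nearI[of "S \<union> S'" _ "q * q'" _ "p * p'"]) (use 1 2 in auto)
qed

lemma rational_near_sum:
  "(\<And>a. a \<in> A \<Longrightarrow> rational_near (f a) t0) \<Longrightarrow> rational_near (\<lambda>t. \<Sum>a\<in>A. f a t) t0"
  by (induction A rule: infinite_finite_induct)
    (auto intro: rational_near_add rational_near_poly[of 0, simplified])

lemma rational_near_cong:
  assumes "rational_near f t0" "finite S" "t0 \<notin> S" "\<And>t. t \<notin> S \<Longrightarrow> h t = f t"
  shows "rational_near h t0"
proof -
  from assms(1) obtain p q S' where 1: "finite S'" "t0 \<notin> S'" "\<forall>t. t \<notin> S' \<longrightarrow> poly q t \<noteq> 0"
    "\<forall>t. t \<notin> S' \<longrightarrow> f t = poly p t / poly q t" by (rule rational_nearE)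
  show ?thesis
    by (rule rational_nearI[of "S \<union> S'" _ q _ p]) (use 1 assms in auto)
qed

lemma poly_eq_of_cofinite:
  fixes p q :: "'k::{field, ring_char_0} poly"
  assumes "finite S" "\<And>t. t \<notin> S \<Longrightarrow> poly p t = poly q t"
  shows "p = q"
proof (rule ccontr)
  assume "p \<noteq> q"
  then have "finite {t. poly (p - q) t = 0}" by (intro poly_roots_finite) simp
  with assms(1) have "finite (S \<union> {t. poly (p - q) t = 0})" by simp
  from ex_new_if_finite[OF infinite_UNIV_char_0 this] assms(2) show False by auto
qed

text \<open>Take a global denominator \<open>q\<close> of least degree. At a root of \<open>q\<close> the local representation shows that the
numerator vanishes too, so a linear factor cancels. Therefore \<open>q\<close> has no root and is constant.\<close>

lemma everywhere_rational_imp_poly: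
  fixes h :: "'k::{alg_closed_field, field_char_0} \<Rightarrow> 'k"
  assumes "\<And>t. rational_near h t"
  shows "\<exists>p. \<forall>t. h t = poly p t"
proof -
  \<comment> \<open>Denominators of representations that hold up to finitely many points.\<close>
  define good where "good q \<longleftrightarrow> q \<noteq> 0 \<and> (\<exists>p S. finite S \<and> (\<forall>t. t \<notin> S \<longrightarrow> poly q t * h t = poly p t))" for q
  have "\<exists>q. good q"
  proof -
    from assms[of 0] obtain p q S where *: "finite S" "0 \<notin> S" "\<forall>t. t \<notin> S \<longrightarrow> poly q t \<noteq> 0"
      "\<forall>t. t \<notin> S \<longrightarrow> h t = poly p t / poly q t" by (rule rational_nearE)
    then have "q \<noteq> 0" by force
    moreover have "\<forall>t. t \<notin> S \<longrightarrow> poly q t * h t = poly p t" using * by simp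
    ultimately show ?thesis unfolding good_def using *(1) by blast
  qed
  define q where "q = arg_min degree good"
  from \<open>\<exists>q. good q\<close> have q: "good q" and qmin: "\<And>r. good r \<Longrightarrow> degree q \<le> degree r"
    using arg_min_nat_lemma[of good _ degree] unfolding q_def by blast+
  from q obtain p S where p: "q \<noteq> 0" "finite S" "\<And>t. t \<notin> S \<Longrightarrow> poly q t * h t = poly p t"
    unfolding good_def by blast
  have key: "poly q t0 \<noteq> 0 \<and> poly q t0 * h t0 = poly p t0" for t0
  proof -
    from assms[of t0] obtain P Q R where *: "finite R" "t0 \<notin> R" "\<forall>t. t \<notin> R \<longrightarrow> poly Q t \<noteq> 0"
      "\<forall>t. t \<notin> R \<longrightarrow> h t = poly P t / poly Q t" by (rule rational_nearE)
    have "q * P = p * Q"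
    proof (rule poly_eq_of_cofinite[of "S \<union> R"])
      fix t assume "t \<notin> S \<union> R"
      then have "poly Q t \<noteq> 0" "h t = poly P t / poly Q t" "poly q t * h t = poly p t"
        using *(3,4) p(3)[of t] by blast+
      then have "poly P t = h t * poly Q t" by simp
      then have "poly (q * P) t = (poly q t * h t) * poly Q t" by (simp add: mult.assoc)
      with \<open>poly q t * h t = poly p t\<close> show "poly (q * P) t = poly (p * Q) t" by simp
    qed (use * p in auto)
    then have eq: "poly q t0 * poly P t0 = poly p t0 * poly Q t0" by (metis poly_mult)
    have Q0: "poly Q t0 \<noteq> 0" and h0: "h t0 = poly P t0 / poly Q t0" using * by auto
    have "poly q t0 \<noteq> 0"
    proof
      assume q0: "poly q t0 = 0"
      with eq Q0 have "poly p t0 = 0" by simp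
      with q0 obtain q' p' where q': "q = [:- t0, 1:] * q'" and p': "p = [:- t0, 1:] * p'"
        by (meson poly_eq_0_iff_dvd dvdE)
      have "q' \<noteq> 0" using p(1) q' by auto
      moreover have "poly q' t * h t = poly p' t" if "t \<notin> insert t0 S" for t
      proof -
        have "poly q t = (t - t0) * poly q' t" "poly p t = (t - t0) * poly p' t"
          by (simp_all add: q' p' algebra_simps)
        with p(3)[of t] that have "(t - t0) * (poly q' t * h t) = (t - t0) * poly p' t"
          by (simp add: mult.assoc)
        with that show ?thesis by simp
      qed
      moreover have "finite (insert t0 S)" using p(2) by simp
      ultimately have "good q'" unfolding good_def by blast
      from qmin[OF this] have "degree q \<le> degree q'" .
      moreover have "degree q = Suc (degree q')" unfolding q' using \<open>q' \<noteq> 0\<close> by (subst degree_mult_eq) auto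
      ultimately show False by simp
    qed
    moreover have "poly P t0 = h t0 * poly Q t0" using Q0 h0 by simp
    with eq have "(poly q t0 * h t0) * poly Q t0 = poly p t0 * poly Q t0" by (simp add: mult.assoc)
    with Q0 have "poly q t0 * h t0 = poly p t0" by simp
    ultimately show ?thesis by blast
  qed
  have "degree q = 0"
  proof (rule ccontr)
    assume "degree q \<noteq> 0"
    then obtain t where "poly q t = 0" using alg_closed_imp_poly_has_root[of q] by auto
    with key show False by blast
  qed
  then obtain c where c: "q = [:c:]" by (rule degree_eq_zeroE)
  with p(1) have "c \<noteq> 0" by simp
  have "h t = poly (smult (inverse c) p) t" for t
    using key[of t] \<open>c \<noteq> 0\<close> unfolding c by (simp add: field_simps)
  then show ?thesis by blast
qed

text \<open>The functions \<open>p\<close> and \<open>q\<close> are the two charts of a section of \<open>O(1)\<close> on the projective line, which is a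
linear form \<open>a x + b y\<close> with \<open>a = p 0\<close> and \<open>b = q 0\<close>; its value at \<open>(1, 1)\<close> is \<open>a + b\<close>.\<close>

lemma two_chart_linear:
  fixes p q :: "'k::{field, ring_char_0} poly"
  assumes "\<And>t. t \<noteq> 0 \<Longrightarrow> poly p t = t * poly q (1 / t)"
  shows "poly p 1 = poly p 0 + poly q 0"
proof -
  define n where "n = degree q"
  \<comment> \<open>The polynomial \<open>t ^ (n + 1) * q (1 / t)\<close>.\<close>
  define r where "r = (\<Sum>i\<le>n. monom (coeff q i) (n + 1 - i))"
  have "monom 1 n * p = r"
  proof (rule poly_eq_of_cofinite[of "{0}"])
    fix t :: 'k assume "t \<notin> {0}"
    then have t: "t \<noteq> 0" by simp
    have "poly (monom 1 n * p) t = t ^ n * (t * (\<Sum>i\<le>n. coeff q i * (1 / t) ^ i))"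
    proof -
      have "poly (monom 1 n * p) t = t ^ n * (t * poly q (1 / t))" using assms[OF t] by (simp add: poly_monom)
      then show ?thesis by (simp only: poly_altdef[of q] n_def)
    qed
    also have "\<dots> = (\<Sum>i\<le>n. coeff q i * t ^ (n + 1 - i))"
      unfolding sum_distrib_left
    proof (rule sum.cong)
      fix i assume i: "i \<in> {..n}"
      then have "t ^ (n + 1) = t ^ (n + 1 - i) * t ^ i" by (simp add: power_add[symmetric])
      then have "t ^ n * (t * (1 / t) ^ i) = t ^ (n + 1 - i)"
        using t by (simp add: power_divide field_simps)
      then show "t ^ n * (t * (coeff q i * (1 / t) ^ i)) = coeff q i * t ^ (n + 1 - i)"
        by (metis mult.left_commute)
    qed simp
    also have "\<dots> = poly r t" by (simp add: r_def poly_sum poly_monom)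
    finally show "poly (monom 1 n * p) t = poly r t" .
  qed simp
  then have pr: "coeff p j = coeff r (n + j)" for j
    using coeff_monom_mult[of 1 n p "n + j"] by simp
  have rc: "coeff r (n + j) = (if j = 0 then coeff q 1 else if j = 1 then coeff q 0 else 0)" for j
  proof -
    have "coeff r (n + j) = (\<Sum>i\<le>n. if n + 1 - i = n + j then coeff q i else 0)"
      by (simp add: r_def coeff_sum)
    also have "\<dots> = (\<Sum>i\<le>n. if i + j = 1 then coeff q i else 0)"
      by (rule sum.cong) auto
    also have "\<dots> = (if j = 0 then coeff q 1 else if j = 1 then coeff q 0 else 0)"
    proof -
      consider "j = 0" | "j = 1" | "j \<ge> 2" by linarith
      then show ?thesis
      proof cases
        case 1
        then have "(\<Sum>i\<le>n. if i + j = 1 then coeff q i else 0) = (\<Sum>i\<le>n. if i = 1 then coeff q i else 0)" by simp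
        also have "\<dots> = coeff q 1" by (auto simp: n_def coeff_eq_0)
        finally show ?thesis using 1 by simp
      next
        case 2
        then show ?thesis by (simp add: sum.delta' flip: n_def)
      next
        case 3
        then show ?thesis by (auto intro: sum.neutral)
      qed
    qed
    finally show ?thesis .
  qed
  have "p = [:coeff q 1, coeff q 0:]"
    by (rule poly_eqI) (auto simp: pr rc coeff_pCons split: nat.splits)
  then show ?thesis by (simp add: poly_0_coeff_0)
qed

section \<open>Pluecker coordinates and local frames\<close>

lemma indexed_basis_expand:
  fixes \<xi> :: "nat \<Rightarrow> 'a \<Rightarrow> 'k::field"
  assumes "indexed_basis (fscale (*)) r \<xi> L" "\<zeta> \<in> L"
  shows "\<exists>a. \<zeta> = (\<lambda>u. \<Sum>l<r. a l * \<xi> l u)"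
proof -
  have inj: "inj_on \<xi> {..<r}" and span: "FS.span (\<xi> ` {..<r}) = L"
    using assms(1) unfolding indexed_basis_def by auto
  from assms(2) obtain b where "\<zeta> = (\<Sum>v\<in>\<xi> ` {..<r}. fscale (*) (b v) v)"
    unfolding span[symmetric] by (subst (asm) FS.span_finite) auto
  also have "\<dots> = (\<Sum>l<r. fscale (*) (b (\<xi> l)) (\<xi> l))"
    by (simp add: sum.reindex[OF inj])
  finally have "\<zeta> = (\<lambda>u. \<Sum>l<r. b (\<xi> l) * \<xi> l u)"
    by (simp add: fun_eq_iff fun_sum_apply fscale_apply)
  then show ?thesis by (intro exI[of _ "\<lambda>l. b (\<xi> l)"])
qed

lemma span_combination:
  fixes \<xi> :: "nat \<Rightarrow> 'a \<Rightarrow> 'k::field"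
  shows "(\<lambda>u. \<Sum>l<r. a l * \<xi> l u) \<in> FS.span (\<xi> ` {..<r})"
proof -
  have "(\<lambda>u. \<Sum>l<r. a l * \<xi> l u) = (\<Sum>l<r. fscale (*) (a l) (\<xi> l))"
    by (simp add: fun_eq_iff fun_sum_apply fscale_apply)
  also have "\<dots> \<in> FS.span (\<xi> ` {..<r})" by (intro FS.span_sum FS.span_scale FS.span_base) auto
  finally show ?thesis .
qed

lemma pluecker_combination:
  assumes "\<And>i u. i \<le> k \<Longrightarrow> \<xi>' i u = (\<Sum>l<k + 1. a i l * \<xi> l u)"
  shows "pluecker k \<xi>' v = det (mat (k + 1) (k + 1) (\<lambda>(i, l). a i l)) * pluecker k \<xi> v"
proof -
  let ?A = "mat (k + 1) (k + 1) (\<lambda>(i, l). a i l)" and ?B = "mat (k + 1) (k + 1) (\<lambda>(i, j). \<xi> i (v j))"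
  have "mat (k + 1) (k + 1) (\<lambda>(i, j). \<xi>' i (v j)) = ?A * ?B"
    by (intro eq_matI) (auto simp: assms scalar_prod_def atLeast0LessThan)
  then show ?thesis unfolding pluecker_def by (simp add: det_mult[of _ "k + 1"])
qed

text \<open>Laplace expansion along the replaced column: as a function of the new vector, the coordinate is a
combination of the basis functionals.\<close>

lemma pluecker_replace:
  fixes \<xi> :: "nat \<Rightarrow> 'v \<Rightarrow> 'k::field"
  assumes "i \<le> k"
  shows "pluecker k \<xi> (v(i := u)) =
    (\<Sum>l<k + 1. adj_mat (mat (k + 1) (k + 1) (\<lambda>(i, j). \<xi> i (v j))) $$ (i, l) * \<xi> l u)"
proof -
  define A where "A = mat (k + 1) (k + 1) (\<lambda>(i, j). \<xi> i (v j))"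
  define B where "B = mat (k + 1) (k + 1) (\<lambda>(a, j). \<xi> a ((v(i := u)) j))"
  have AB: "A \<in> carrier_mat (k + 1) (k + 1)" "B \<in> carrier_mat (k + 1) (k + 1)"
    by (auto simp: A_def B_def)
  have cof: "cofactor B l i = adj_mat A $$ (i, l)" if "l < k + 1" for l
  proof -
    have "mat_delete B l i = mat_delete A l i"
      by (intro eq_matI) (auto simp: mat_delete_def A_def B_def)
    then show ?thesis using that assms by (simp add: adj_mat_def cofactor_def A_def)
  qed
  have "pluecker k \<xi> (v(i := u)) = det B" by (simp add: pluecker_def B_def)
  also have "\<dots> = (\<Sum>l<k + 1. B $$ (l, i) * cofactor B l i)"
    using assms by (intro laplace_expansion_column[OF AB(2)]) simp
  also have "\<dots> = (\<Sum>l<k + 1. adj_mat A $$ (i, l) * \<xi> l u)"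
    using assms by (intro sum.cong) (auto simp: cof, simp add: B_def)
  finally show ?thesis unfolding A_def .
qed

text \<open>Cramer's rule: \<open>\<xi> m\<close> is recovered from its values at \<open>v 0, \<dots>, v k\<close>, with coefficients that are quotients
of Pluecker coordinates.\<close>

lemma pluecker_cramer:
  fixes \<xi> :: "nat \<Rightarrow> 'v \<Rightarrow> 'k::field"
  assumes "m \<le> k"
  shows "(\<Sum>i<k + 1. \<xi> m (v i) * pluecker k \<xi> (v(i := u))) = pluecker k \<xi> v * \<xi> m u"
proof -
  define A where "A = mat (k + 1) (k + 1) (\<lambda>(i, j). \<xi> i (v j))"
  have A: "A \<in> carrier_mat (k + 1) (k + 1)" by (simp add: A_def)
  have ent: "(\<Sum>i<k + 1. \<xi> m (v i) * adj_mat A $$ (i, l)) = (if m = l then det A else 0)" if "l < k + 1" for l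
  proof -
    have "(A * adj_mat A) $$ (m, l) = (\<Sum>i<k + 1. A $$ (m, i) * adj_mat A $$ (i, l))"
      using adj_mat(1)[OF A] A that assms by (simp add: scalar_prod_def atLeast0LessThan)
    moreover have "(A * adj_mat A) $$ (m, l) = (if m = l then det A else 0)"
      unfolding adj_mat(2)[OF A] using that assms by simp
    moreover have "A $$ (m, i) = \<xi> m (v i)" if "i < k + 1" for i using that assms by (simp add: A_def)
    ultimately show ?thesis by simp
  qed
  have "(\<Sum>i<k + 1. \<xi> m (v i) * pluecker k \<xi> (v(i := u))) =
      (\<Sum>i<k + 1. \<Sum>l<k + 1. \<xi> m (v i) * adj_mat A $$ (i, l) * \<xi> l u)"
  proof (rule sum.cong)
    fix i assume "i \<in> {..<k + 1}"
    then have "i \<le> k" by simp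
    show "\<xi> m (v i) * pluecker k \<xi> (v(i := u)) = (\<Sum>l<k + 1. \<xi> m (v i) * adj_mat A $$ (i, l) * \<xi> l u)"
      unfolding pluecker_replace[OF \<open>i \<le> k\<close>] A_def by (simp only: sum_distrib_left mult.assoc)
  qed simp
  also have "\<dots> = (\<Sum>l<k + 1. (\<Sum>i<k + 1. \<xi> m (v i) * adj_mat A $$ (i, l)) * \<xi> l u)"
    by (subst sum.swap) (simp only: sum_distrib_right)
  also have "\<dots> = (\<Sum>l<k + 1. if m = l then det A * \<xi> l u else 0)"
  proof (rule sum.cong)
    fix l assume "l \<in> {..<k + 1}"
    then have "l < k + 1" by simp
    show "(\<Sum>i<k + 1. \<xi> m (v i) * adj_mat A $$ (i, l)) * \<xi> l u = (if m = l then det A * \<xi> l u else 0)"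
      unfolding ent[OF \<open>l < k + 1\<close>] by simp
  qed simp
  also have "\<dots> = det A * \<xi> m u" using assms by simp
  finally show ?thesis by (simp add: pluecker_def A_def)
qed

lemma dual_space_iff:
  assumes "vector_space sV"
  shows "l \<in> dual_space sV \<longleftrightarrow> (\<forall>x y. l (x + y) = l x + l y) \<and> (\<forall>c x. l (sV c x) = c * l x)"
proof -
  have "vector_space ((*) :: 'a \<Rightarrow> 'a \<Rightarrow> 'a)" by unfold_locales (auto simp: algebra_simps)
  with assms show ?thesis by (simp add: dual_space_def Vector_Spaces.linear_iff)
qed

lemma subspace_dual_space:
  assumes "vector_space sV"
  shows "FS.subspace (dual_space sV)"
  by (rule FS.subspaceI) (auto simp: dual_space_iff[OF assms] fscale_def algebra_simps)

lemma indexed_basis_of_bij: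
  assumes "bij_betw e {..<r} B" "\<not> FS.dependent B"
  shows "indexed_basis (fscale (*)) r e (FS.span B)"
  using assms unfolding indexed_basis_def by (auto simp: bij_betw_def)

lemma grassmannian_indexed_basis:
  fixes L :: "('v::ab_group_add \<Rightarrow> 'k::field) set"
  assumes "L \<in> grassmannian sV k"
  shows "\<exists>\<xi>. indexed_basis (fscale (*)) (k + 1) \<xi> L"
proof -
  have L: "FS.subspace L" "FS.dim L = k + 1" using assms by (auto simp: grassmannian_def)
  obtain B where B: "B \<subseteq> L" "\<not> FS.dependent B" "L \<subseteq> FS.span B" "card B = FS.dim L"
    using FS.basis_exists by blast
  then have "finite B" using L(2) by (intro card_ge_0_finite) simp
  then obtain e where "bij_betw e {0..<card B} B" using ex_bij_betw_nat_finite by blast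
  then have "bij_betw e {..<k + 1} B" using B(4) L(2) by (simp add: atLeast0LessThan)
  from indexed_basis_of_bij[OF this B(2)] have "indexed_basis (fscale (*)) (k + 1) e (FS.span B)" .
  moreover have "FS.span B = L" using B L(1) by (metis FS.span_minimal subset_antisym)
  ultimately show ?thesis by blast
qed

lemma span_in_grassmannian:
  fixes B :: "('v::ab_group_add \<Rightarrow> 'k::field) set"
  assumes "vector_space sV" "B \<subseteq> dual_space sV" "\<not> FS.dependent B" "card B = k + 1"
  shows "FS.span B \<in> grassmannian sV k"
  using assms FS.dim_span_eq_card_independent[OF assms(3)]
    FS.span_minimal[OF assms(2) subspace_dual_space[OF assms(1)]]
  unfolding grassmannian_def by auto

lemma hom_poly_scale: "hom_poly d P \<Longrightarrow> P (\<lambda>i. c * p i) = c ^ d * P p"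
  by (induction rule: hom_poly.induct) (auto simp: algebra_simps power_add)

locale finite_dim_V = finite_dimensional_vector_space sV BV
  for sV :: "'k::{alg_closed_field, field_char_0} \<Rightarrow> 'v::ab_group_add \<Rightarrow> 'v" and BV +
  fixes k :: nat
begin

lemma vector_space_V: "vector_space sV"
  by (rule vector_space_axioms)

lemma dual_sum: "\<xi> \<in> dual_space sV \<Longrightarrow> \<xi> (\<Sum>a\<in>A. sV (c a) (x a)) = (\<Sum>a\<in>A. c a * \<xi> (x a))"
proof (induction A rule: infinite_finite_induct)
  case empty
  then have "\<xi> (sV 0 0) = 0 * \<xi> 0" unfolding dual_space_iff[OF vector_space_V] by blast
  then show ?case by simp
next
  case (infinite A)
  then have "\<xi> (sV 0 0) = 0 * \<xi> 0" unfolding dual_space_iff[OF vector_space_V] by blast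
  with infinite show ?case by simp
next
  case (insert a A)
  then show ?case unfolding dual_space_iff[OF vector_space_V] by simp
qed

lemma dual_basis:
  obtains b \<delta> where "\<forall>j<card BV. \<delta> j \<in> dual_space sV"
    "\<forall>i<card BV. \<forall>j<card BV. \<delta> i (b j) = (if i = j then 1 else 0)"
    "\<forall>l\<in>dual_space sV. l = (\<lambda>u. \<Sum>j<card BV. l (b j) * \<delta> j u)"
proof -
  define N where "N = card BV"
  obtain b where b: "bij_betw b {..<N} BV"
    using ex_bij_betw_nat_finite[OF finite_Basis] unfolding N_def by (auto simp: atLeast0LessThan)
  define \<delta> where "\<delta> j = (\<lambda>u. representation BV u (b j))" for j
  have bB: "b j \<in> BV" if "j < N" for j using b that by (auto simp: bij_betw_def)
  have expand: "u = (\<Sum>j<N. sV (\<delta> j u) (b j))" for u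
  proof -
    have "(\<Sum>v\<in>BV. sV (representation BV u v) v) = u"
      by (rule sum_representation_eq[OF independent_Basis]) (auto simp: span_Basis finite_Basis)
    then show ?thesis using sum.reindex_bij_betw[OF b, of "\<lambda>v. sV (representation BV u v) v"]
      by (simp add: \<delta>_def)
  qed
  show thesis
  proof (rule that[of \<delta> b], fold N_def)
    show "\<forall>j<N. \<delta> j \<in> dual_space sV"
      unfolding dual_space_iff[OF vector_space_V] \<delta>_def
      by (simp add: representation_add[OF independent_Basis] representation_scale[OF independent_Basis] span_Basis)
    show "\<forall>i<N. \<forall>j<N. \<delta> i (b j) = (if i = j then 1 else 0)"
    proof (intro allI impI)
      fix i j assume ij: "i < N" "j < N"
      then have "b i = b j \<longleftrightarrow> i = j" using b by (auto simp: bij_betw_def inj_on_def)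
      then show "\<delta> i (b j) = (if i = j then 1 else 0)"
        using bB[OF ij(2)] by (simp add: \<delta>_def representation_basis[OF independent_Basis])
    qed
    show "\<forall>l\<in>dual_space sV. l = (\<lambda>u. \<Sum>j<N. l (b j) * \<delta> j u)"
    proof (intro ballI ext)
      fix l u assume l: "l \<in> dual_space sV"
      show "l u = (\<Sum>j<N. l (b j) * \<delta> j u)"
        by (subst expand[of u]) (simp add: dual_sum[OF l] mult.commute)
    qed
  qed
qed

text \<open>If all the coordinates vanished, then all maximal minors of the matrix of \<open>\<xi>\<close> in a basis of \<open>V\<close> would
vanish, so the matrix would factor through a \<open>k\<close>-dimensional space and \<open>k + 1\<close> independent functionals
would lie in the span of \<open>k\<close> functionals.\<close>

lemma pluecker_nonzero:
  assumes \<xi>: "indexed_basis (fscale (*)) (k + 1) \<xi> L" and L: "L \<subseteq> dual_space sV"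
  shows "\<exists>v. pluecker k \<xi> v \<noteq> 0"
proof -
  have inj: "inj_on \<xi> {..<k + 1}" and ind: "\<not> FS.dependent (\<xi> ` {..<k + 1})"
    and span: "FS.span (\<xi> ` {..<k + 1}) = L" using \<xi> unfolding indexed_basis_def by auto
  have mem: "\<xi> i \<in> dual_space sV" if "i < k + 1" for i
    using that L FS.span_base[of "\<xi> i" "\<xi> ` {..<k + 1}"] span by auto
  obtain b \<delta> where expand: "\<forall>l\<in>dual_space sV. l = (\<lambda>u. \<Sum>j<card BV. l (b j) * \<delta> j u)"
    by (rule dual_basis)
  define N where "N = card BV"
  define A where "A = (\<lambda>(i, j). \<xi> i (b j))"
  have "A \<notin> rank_le (k + 1) N k"
  proof
    assume "A \<in> rank_le (k + 1) N k"
    then obtain B C where BC: "\<forall>i<k + 1. \<forall>j<N. A (i, j) = (\<Sum>l<k. B i l * C l j)"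
      unfolding rank_le_def by blast
    define \<omega> where "\<omega> l = (\<lambda>u. \<Sum>j<N. C l j * \<delta> j u)" for l
    have "\<xi> i = (\<lambda>u. \<Sum>l<k. B i l * \<omega> l u)" if i: "i < k + 1" for i
    proof
      fix u
      have "\<xi> i u = (\<Sum>j<N. A (i, j) * \<delta> j u)"
        using fun_cong[OF bspec[OF expand mem[OF i]], of u] by (simp only: A_def N_def prod.case)
      also have "\<dots> = (\<Sum>j<N. \<Sum>l<k. B i l * (C l j * \<delta> j u))"
        using BC i by (intro sum.cong) (auto simp: sum_distrib_right mult.assoc)
      also have "\<dots> = (\<Sum>l<k. B i l * \<omega> l u)"
        by (subst sum.swap) (simp add: \<omega>_def sum_distrib_left)
      finally show "\<xi> i u = (\<Sum>l<k. B i l * \<omega> l u)" .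
    qed
    then have "\<xi> ` {..<k + 1} \<subseteq> FS.span (\<omega> ` {..<k})"
      using span_combination[where r = k and \<xi> = \<omega>] by auto
    from FS.independent_span_bound[OF _ ind this] have "card (\<xi> ` {..<k + 1}) \<le> card (\<omega> ` {..<k})" by simp
    also have "\<dots> \<le> k" using card_image_le[of "{..<k}" \<omega>] by simp
    finally show False using card_image[OF inj] by simp
  qed
  from nonzero_minor_of_rank_gt[OF this order_refl] obtain \<rho> \<kappa> where
    *: "\<forall>a<Suc k. \<rho> a < k + 1" "minor (Suc k) \<rho> \<kappa> A \<noteq> 0" by blast
  have "minor (Suc k) \<rho> \<kappa> A = pluecker k (\<lambda>i. \<xi> (\<rho> i)) (\<lambda>j. b (\<kappa> j))"
    by (simp add: minor_def pluecker_def A_def)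
  also have "\<dots> = det (mat (k + 1) (k + 1) (\<lambda>(i, l). if l = \<rho> i then 1 else 0)) * pluecker k \<xi> (\<lambda>j. b (\<kappa> j))"
  proof (rule pluecker_combination)
    fix i u assume "i \<le> k"
    then have "\<rho> i < k + 1" using * by simp
    have "(\<Sum>l<k + 1. (if l = \<rho> i then 1 else 0) * \<xi> l u) = (\<Sum>l<k + 1. if l = \<rho> i then \<xi> l u else 0)"
      by (rule sum.cong) auto
    then show "\<xi> (\<rho> i) u = (\<Sum>l<k + 1. (if l = \<rho> i then 1 else 0) * \<xi> l u)"
      using \<open>\<rho> i < k + 1\<close> by simp
  qed
  finally show ?thesis using *(2) by (intro exI[of _ "\<lambda>j. b (\<kappa> j)"]) auto
qed

lemma pluecker_change_basis:
  assumes "indexed_basis (fscale (*)) (k + 1) \<xi> L" "indexed_basis (fscale (*)) (k + 1) \<xi>' L" "L \<subseteq> dual_space sV"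
  shows "\<exists>c. c \<noteq> 0 \<and> pluecker k \<xi>' = (\<lambda>v. c * pluecker k \<xi> v)"
proof -
  have "\<xi>' i \<in> L" if "i \<le> k" for i
    using that assms(2) FS.span_base[of "\<xi>' i" "\<xi>' ` {..<k + 1}"] unfolding indexed_basis_def by auto
  then have "\<exists>a. \<xi>' i = (\<lambda>u. \<Sum>l<k + 1. a l * \<xi> l u)" if "i \<le> k" for i
    using indexed_basis_expand[OF assms(1)] that by blast
  then obtain a where a: "\<And>i. i \<le> k \<Longrightarrow> \<xi>' i = (\<lambda>u. \<Sum>l<k + 1. a i l * \<xi> l u)" by metis
  define c where "c = det (mat (k + 1) (k + 1) (\<lambda>(i, l). a i l))"
  have eq: "pluecker k \<xi>' v = c * pluecker k \<xi> v" for v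
    unfolding c_def by (rule pluecker_combination) (simp add: a)
  moreover obtain v where "pluecker k \<xi>' v \<noteq> 0" using pluecker_nonzero[OF assms(2,3)] by blast
  ultimately show ?thesis by (intro exI[of _ c]) (auto simp: fun_eq_iff)
qed

lemma topspace_zariski: "topspace (zariski sV k) = grassmannian sV k"
proof
  show "topspace (zariski sV k) \<subseteq> grassmannian sV k"
    unfolding zariski_def topology_generated_by_topspace by (auto simp: basic_open_def)
  have "grassmannian sV k = basic_open sV k (\<lambda>p. 1)" by (auto simp: basic_open_def)
  then have "grassmannian sV k \<in> {basic_open sV k P | P d. hom_poly d P}"
    using hom_poly.const[of 1] by blast
  then show "grassmannian sV k \<subseteq> topspace (zariski sV k)"
    unfolding zariski_def topology_generated_by_topspace by blast
qed

lemma openin_basic_open: "hom_poly d P \<Longrightarrow> openin (zariski sV k) (basic_open sV k P)"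
  unfolding zariski_def by (rule topology_generated_by_Basis) blast

text \<open>Homogeneity makes the choice of the basis irrelevant.\<close>

lemma basic_open_iff:
  assumes "hom_poly d P" "L \<in> grassmannian sV k" "indexed_basis (fscale (*)) (k + 1) \<xi> L"
  shows "L \<in> basic_open sV k P \<longleftrightarrow> P (pluecker k \<xi>) \<noteq> 0"
proof
  assume "L \<in> basic_open sV k P"
  with assms(3) show "P (pluecker k \<xi>) \<noteq> 0" by (auto simp: basic_open_def)
next
  assume nz: "P (pluecker k \<xi>) \<noteq> 0"
  have "P (pluecker k \<xi>') \<noteq> 0" if \<xi>': "indexed_basis (fscale (*)) (k + 1) \<xi>' L" for \<xi>'
  proof -
    from assms(2) have "L \<subseteq> dual_space sV" by (auto simp: grassmannian_def)
    from pluecker_change_basis[OF assms(3) \<xi>' this] obtain c where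
      "c \<noteq> 0" "pluecker k \<xi>' = (\<lambda>v. c * pluecker k \<xi> v)" by blast
    with nz hom_poly_scale[OF assms(1), of c "pluecker k \<xi>"] show ?thesis by simp
  qed
  with assms(2) show "L \<in> basic_open sV k P" by (auto simp: basic_open_def)
qed

text \<open>The tautological bundle has a regular frame near every point. Where the Pluecker coordinate of \<open>v\<close> does
not vanish, let \<open>\<sigma> 0 L, \<dots>, \<sigma> k L\<close> be the basis of \<open>L\<close> that is dual to \<open>v 0, \<dots>, v k\<close>. By Cramer's rule its
values are quotients of Pluecker coordinates.\<close>

lemma local_frame:
  assumes L0: "L0 \<in> grassmannian sV k"
  shows "\<exists>v W \<sigma>. openin (zariski sV k) W \<and> L0 \<in> W \<and>
    (\<forall>i<k + 1. \<sigma> i \<in> sections (universal_bundle sV k) W) \<and>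
    (\<forall>L\<in>W. \<forall>\<zeta>\<in>L. \<zeta> = (\<lambda>u. \<Sum>i<k + 1. \<zeta> (v i) * \<sigma> i L u))"
proof -
  from grassmannian_indexed_basis[OF L0] obtain \<xi>0 where \<xi>0: "indexed_basis (fscale (*)) (k + 1) \<xi>0 L0" by blast
  from L0 have "L0 \<subseteq> dual_space sV" by (auto simp: grassmannian_def)
  from pluecker_nonzero[OF \<xi>0 this] obtain v where v: "pluecker k \<xi>0 v \<noteq> 0" by blast
  define W where "W = basic_open sV k (\<lambda>p. p v)"
  have openW: "openin (zariski sV k) W" unfolding W_def by (rule openin_basic_open[OF hom_poly.coord])
  have "L0 \<in> W" unfolding W_def using basic_open_iff[OF hom_poly.coord L0 \<xi>0, of v] v by blast
  have Wg: "L \<in> grassmannian sV k" if "L \<in> W" for L using that by (simp add: W_def basic_open_def)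
  define bs where "bs L = (SOME \<xi>. indexed_basis (fscale (*)) (k + 1) \<xi> L)" for L :: "('v \<Rightarrow> 'k) set"
  have bs: "indexed_basis (fscale (*)) (k + 1) (bs L) L" if "L \<in> W" for L
    unfolding bs_def using grassmannian_indexed_basis[OF Wg[OF that]] by (rule someI_ex)
  have nz: "pluecker k \<xi> v \<noteq> 0" if "L \<in> W" "indexed_basis (fscale (*)) (k + 1) \<xi> L" for L \<xi>
    using that unfolding W_def basic_open_def by blast
  define \<sigma> where "\<sigma> i L = (\<lambda>u. pluecker k (bs L) (v(i := u)) / pluecker k (bs L) v)" for i L
  have inv: "\<sigma> i L u = pluecker k \<xi> (v(i := u)) / pluecker k \<xi> v"
    if L: "L \<in> W" and \<xi>: "indexed_basis (fscale (*)) (k + 1) \<xi> L" for i L u \<xi>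
  proof -
    from Wg[OF L] have "L \<subseteq> dual_space sV" by (auto simp: grassmannian_def)
    from pluecker_change_basis[OF \<xi> bs[OF L] this] obtain c where
      "c \<noteq> 0" "pluecker k (bs L) = (\<lambda>v. c * pluecker k \<xi> v)" by blast
    then show ?thesis by (simp add: \<sigma>_def)
  qed
  have "\<sigma> i \<in> sections (universal_bundle sV k) W" if i: "i < k + 1" for i
  proof -
    have "\<sigma> i L \<in> L" if L: "L \<in> W" for L
    proof -
      have "\<sigma> i L = (\<lambda>u. \<Sum>l<k + 1. (adj_mat (mat (k + 1) (k + 1) (\<lambda>(i, j). bs L i (v j))) $$ (i, l) / pluecker k (bs L) v) * bs L l u)"
        using i unfolding \<sigma>_def by (intro ext) (subst pluecker_replace, simp, simp only: sum_divide_distrib times_divide_eq_left)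
      also have "\<dots> \<in> FS.span (bs L ` {..<k + 1})" by (rule span_combination)
      also have "\<dots> = L" using bs[OF L] by (simp add: indexed_basis_def)
      finally show ?thesis .
    qed
    moreover have "(\<lambda>L. \<sigma> i L u) \<in> regular_on sV k W" for u
      unfolding regular_on_def
    proof (intro CollectI ballI)
      fix L assume "L \<in> W"
      have "\<forall>M\<in>W. \<forall>\<xi>. indexed_basis (fscale (*)) (k + 1) \<xi> M \<longrightarrow>
          (\<lambda>p. p v) (pluecker k \<xi>) \<noteq> 0 \<and>
          \<sigma> i M u = (\<lambda>p. p (v(i := u))) (pluecker k \<xi>) / (\<lambda>p. p v) (pluecker k \<xi>)"
        using nz inv by blast
      then show "\<exists>U d P Q. openin (zariski sV k) U \<and> L \<in> U \<and> U \<subseteq> W \<and> hom_poly d P \<and> hom_poly d Q \<and>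
          (\<forall>M\<in>U. \<forall>\<xi>. indexed_basis (fscale (*)) (k + 1) \<xi> M \<longrightarrow>
            Q (pluecker k \<xi>) \<noteq> 0 \<and> \<sigma> i M u = P (pluecker k \<xi>) / Q (pluecker k \<xi>))"
        using \<open>L \<in> W\<close> openW hom_poly.coord[of "v(i := u)"] hom_poly.coord[of v]
        by (intro exI[of _ W] exI[of _ 1] exI[of _ "\<lambda>p. p (v(i := u))"] exI[of _ "\<lambda>p. p v"] conjI subset_refl)
    qed
    ultimately show ?thesis by (simp add: universal_bundle_def)
  qed
  moreover have "\<zeta> = (\<lambda>u. \<Sum>i<k + 1. \<zeta> (v i) * \<sigma> i L u)" if L: "L \<in> W" and \<zeta>: "\<zeta> \<in> L" for L \<zeta>
  proof
    fix u
    from indexed_basis_expand[OF bs[OF L] \<zeta>] obtain a where a: "\<zeta> = (\<lambda>u. \<Sum>l<k + 1. a l * bs L l u)" by blast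
    have "pluecker k (bs L) v * \<zeta> u = (\<Sum>l<k + 1. a l * (pluecker k (bs L) v * bs L l u))"
      by (simp only: a sum_distrib_left mult.left_commute)
    also have "\<dots> = (\<Sum>l<k + 1. a l * (\<Sum>i<k + 1. bs L l (v i) * pluecker k (bs L) (v(i := u))))"
    proof (rule sum.cong)
      fix l assume "l \<in> {..<k + 1}"
      then have "l \<le> k" by simp
      show "a l * (pluecker k (bs L) v * bs L l u) = a l * (\<Sum>i<k + 1. bs L l (v i) * pluecker k (bs L) (v(i := u)))"
        unfolding pluecker_cramer[OF \<open>l \<le> k\<close>] ..
    qed simp
    also have "\<dots> = (\<Sum>i<k + 1. \<Sum>l<k + 1. a l * bs L l (v i) * pluecker k (bs L) (v(i := u)))"
      unfolding sum_distrib_left mult.assoc[symmetric] by (rule sum.swap)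
    also have "\<dots> = (\<Sum>i<k + 1. \<zeta> (v i) * pluecker k (bs L) (v(i := u)))"
      by (simp only: a sum_distrib_right)
    finally have "pluecker k (bs L) v * \<zeta> u = (\<Sum>i<k + 1. \<zeta> (v i) * pluecker k (bs L) (v(i := u)))" .
    then have "\<zeta> u = (\<Sum>i<k + 1. \<zeta> (v i) * pluecker k (bs L) (v(i := u))) / pluecker k (bs L) v"
      using nz[OF L bs[OF L]] by (simp add: field_simps)
    then show "\<zeta> u = (\<Sum>i<k + 1. \<zeta> (v i) * \<sigma> i L u)"
      by (simp only: \<sigma>_def sum_divide_distrib times_divide_eq_right)
  qed
  ultimately show ?thesis using openW \<open>L0 \<in> W\<close> by blast
qed

end

section \<open>Regular functionals on the tautological bundle\<close>

text \<open>A homomorphism from the tautological bundle to the trivial line bundle. Images of sections are required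
to be linear combinations of regular functions instead of regular functions. This is what a linear form on
\<open>T\<close> yields directly, and it saves the proof that regular functions are closed under addition.\<close>

definition regular_functional ::
  "('k::field \<Rightarrow> 'v::ab_group_add \<Rightarrow> 'v) \<Rightarrow> nat \<Rightarrow> (('v \<Rightarrow> 'k) set \<Rightarrow> ('v \<Rightarrow> 'k) \<Rightarrow> 'k) \<Rightarrow> bool"
  where "regular_functional sV k \<Phi> \<longleftrightarrow>
    (\<forall>L\<in>grassmannian sV k. (\<forall>a\<in>L. \<forall>b\<in>L. \<Phi> L (a + b) = \<Phi> L a + \<Phi> L b) \<and>
      (\<forall>c. \<forall>a\<in>L. \<Phi> L (fscale (*) c a) = c * \<Phi> L a)) \<and>
    (\<forall>W \<sigma>. openin (zariski sV k) W \<longrightarrow> \<sigma> \<in> sections (universal_bundle sV k) W \<longrightarrow>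
      (\<exists>m c \<tau>. (\<forall>j<m. \<tau> j \<in> regular_on sV k W) \<and> (\<forall>L\<in>W. \<Phi> L (\<sigma> L) = (\<Sum>j<(m::nat). c j * \<tau> j L))))"

lemma regular_functional_add:
  "regular_functional sV k \<Phi> \<Longrightarrow> L \<in> grassmannian sV k \<Longrightarrow> a \<in> L \<Longrightarrow> b \<in> L \<Longrightarrow> \<Phi> L (a + b) = \<Phi> L a + \<Phi> L b"
  unfolding regular_functional_def by blast

lemma regular_functional_scale:
  "regular_functional sV k \<Phi> \<Longrightarrow> L \<in> grassmannian sV k \<Longrightarrow> a \<in> L \<Longrightarrow> \<Phi> L (fscale (*) c a) = c * \<Phi> L a"
  unfolding regular_functional_def by blast

lemma regular_functional_section:
  assumes "regular_functional sV k \<Phi>" "openin (zariski sV k) W" "\<sigma> \<in> sections (universal_bundle sV k) W"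
  shows "\<exists>m c \<tau>. (\<forall>j<m. \<tau> j \<in> regular_on sV k W) \<and> (\<forall>L\<in>W. \<Phi> L (\<sigma> L) = (\<Sum>j<(m::nat). c j * \<tau> j L))"
  by (rule assms(1)[unfolded regular_functional_def, THEN conjunct2, THEN spec, THEN spec, THEN mp, THEN mp,
      OF assms(2,3)])

lemma regular_functional_combination:
  assumes \<Phi>: "regular_functional sV k \<Phi>" and L: "L \<in> grassmannian sV k" and mem: "\<And>i. i < (r :: nat) \<Longrightarrow> s i \<in> L"
  shows "\<Phi> L (\<lambda>u. \<Sum>i<r. a i * s i u) = (\<Sum>i<r. a i * \<Phi> L (s i))"
proof -
  have sub: "FS.subspace L" using L by (simp add: grassmannian_def)
  have "(\<Sum>i<r. fscale (*) (a i) (s i)) \<in> L \<and>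
      \<Phi> L (\<Sum>i<r. fscale (*) (a i) (s i)) = (\<Sum>i<r. a i * \<Phi> L (s i))"
    using mem
  proof (induction r)
    case 0
    have "\<Phi> L (fscale (*) 0 0) = 0 * \<Phi> L 0"
      by (rule regular_functional_scale[OF \<Phi> L FS.subspace_0[OF sub]])
    then have "\<Phi> L 0 = 0" by simp
    with FS.subspace_0[OF sub] show ?case unfolding lessThan_0 sum.empty by blast
  next
    case (Suc r)
    have IH: "(\<Sum>i<r. fscale (*) (a i) (s i)) \<in> L"
      "\<Phi> L (\<Sum>i<r. fscale (*) (a i) (s i)) = (\<Sum>i<r. a i * \<Phi> L (s i))" using Suc by auto
    have 1: "fscale (*) (a r) (s r) \<in> L" by (rule FS.subspace_scale[OF sub Suc.prems]) simp
    have "\<Phi> L (fscale (*) (a r) (s r)) = a r * \<Phi> L (s r)"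
      by (rule regular_functional_scale[OF \<Phi> L Suc.prems]) simp
    with regular_functional_add[OF \<Phi> L IH(1) 1] IH(2) FS.subspace_add[OF sub IH(1) 1]
    show ?case unfolding sum.lessThan_Suc by (simp only: simp_thms)
  qed
  moreover have "(\<Sum>i<r. fscale (*) (a i) (s i)) = (\<lambda>u. \<Sum>i<r. a i * s i u)"
    by (simp add: fun_eq_iff fun_sum_apply fscale_apply)
  ultimately show ?thesis by simp
qed

context finite_dim_V
begin

context
  fixes C :: "('v \<Rightarrow> 'k) set" and \<eta>0 \<eta>1 :: "'v \<Rightarrow> 'k"
  assumes dual: "insert \<eta>0 (insert \<eta>1 C) \<subseteq> dual_space sV"
    and indep: "\<not> FS.dependent (insert \<eta>0 (insert \<eta>1 C))"
    and new: "\<eta>0 \<noteq> \<eta>1" "\<eta>0 \<notin> C" "\<eta>1 \<notin> C"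
    and C: "finite C" "card C = k"
begin

definition pencil_point :: "'k \<Rightarrow> 'v \<Rightarrow> 'k" where "pencil_point t = \<eta>0 + fscale (*) t \<eta>1"

text \<open>The pencil of subspaces \<open>\<langle>C, \<eta>0 + t \<eta>1\<rangle>\<close> is a line in the Grassmannian, without its point at infinity.\<close>

definition pencil :: "'k \<Rightarrow> ('v \<Rightarrow> 'k) set" where "pencil t = FS.span (insert (pencil_point t) C)"

lemma pencil_point_notin_span: "pencil_point t \<notin> FS.span C"
proof
  assume "pencil_point t \<in> FS.span C"
  then have "pencil_point t \<in> FS.span (insert \<eta>1 C)" using FS.span_mono[of C "insert \<eta>1 C"] by blast
  then have "pencil_point t - fscale (*) t \<eta>1 \<in> FS.span (insert \<eta>1 C)"
    by (rule FS.span_diff[OF _ FS.span_scale[OF FS.span_base]]) simp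
  then have "\<eta>0 \<in> FS.span (insert \<eta>1 C)" by (simp add: pencil_point_def)
  with indep new show False by (simp add: FS.independent_insert)
qed

lemma pencil_point_independent: "\<not> FS.dependent (insert (pencil_point t) C)" "pencil_point t \<notin> C"
proof -
  have "\<not> FS.dependent C" using indep FS.independent_mono by blast
  then show "\<not> FS.dependent (insert (pencil_point t) C)" using pencil_point_notin_span by (rule FS.independent_insertI[rotated])
  show "pencil_point t \<notin> C" using pencil_point_notin_span FS.span_base by blast
qed

lemma pencil_in_grassmannian: "pencil t \<in> grassmannian sV k"
  unfolding pencil_def
proof (rule span_in_grassmannian[OF vector_space_V _ pencil_point_independent(1)])
  have "pencil_point t \<in> dual_space sV" unfolding pencil_point_def
    using dual subspace_dual_space[OF vector_space_V] by (intro FS.subspace_add FS.subspace_scale) auto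
  with dual show "insert (pencil_point t) C \<subseteq> dual_space sV" by auto
  show "card (insert (pencil_point t) C) = k + 1" using C pencil_point_independent(2) by simp
qed

lemma pencil_point_in_pencil: "pencil_point t \<in> pencil t" "C \<subseteq> pencil t"
  unfolding pencil_def using FS.span_superset[of "insert (pencil_point t) C"] by auto

text \<open>The Pluecker coordinates of a member of the pencil are polynomials in \<open>t\<close>, since \<open>t\<close> enters one row.\<close>

lemma pencil_frame:
  "\<exists>\<xi>. (\<forall>t. indexed_basis (fscale (*)) (k + 1) (\<xi> t) (pencil t)) \<and>
    (\<forall>v. \<exists>\<pi>. \<forall>t. pluecker k (\<xi> t) v = poly \<pi> t)"
proof -
  from ex_bij_betw_nat_finite[OF C(1)] C(2) obtain e where e: "bij_betw e {0..<k} C" by auto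
  define \<xi> where "\<xi> t i = (if i = 0 then pencil_point t else e (i - 1))" for t and i :: nat
  have "indexed_basis (fscale (*)) (k + 1) (\<xi> t) (pencil t)" for t
    unfolding pencil_def
  proof (rule indexed_basis_of_bij[OF _ pencil_point_independent(1)])
    have "bij_betw (\<lambda>i. i - 1) {1..<k + 1} {0..<k}"
      by (rule bij_betw_byWitness[where f' = Suc]) auto
    from bij_betw_trans[OF this e] have "bij_betw (\<xi> t) {1..<k + 1} C"
      by (rule bij_betw_cong[THEN iffD1, rotated]) (auto simp: \<xi>_def)
    moreover have "bij_betw (\<xi> t) {0} {pencil_point t}" by (simp add: \<xi>_def)
    ultimately have "bij_betw (\<xi> t) ({0} \<union> {1..<k + 1}) ({pencil_point t} \<union> C)"
      using pencil_point_independent(2) by (intro bij_betw_combine) auto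
    moreover have "{0} \<union> {1..<k + 1} = {..<k + 1}" by auto
    ultimately show "bij_betw (\<xi> t) {..<k + 1} (insert (pencil_point t) C)" by simp
  qed
  moreover have "\<exists>\<pi>. \<forall>t. pluecker k (\<xi> t) v = poly \<pi> t" for v
  proof -
    define M where "M = mat (k + 1) (k + 1) (\<lambda>(i, j). if i = 0 then [:\<eta>0 (v j), \<eta>1 (v j):] else [:e (i - 1) (v j):])"
    have "pluecker k (\<xi> t) v = poly (det M) t" for t
    proof -
      have ev: "comm_ring_hom (\<lambda>f :: 'k poly. poly f t)" by unfold_locales auto
      have "map_mat (\<lambda>f. poly f t) M = mat (k + 1) (k + 1) (\<lambda>(i, j). \<xi> t i (v j))"
        by (intro eq_matI) (auto simp: M_def \<xi>_def pencil_point_def fscale_def)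
      then show ?thesis using comm_ring_hom.hom_det[OF ev, of M] by (simp add: pluecker_def)
    qed
    then show ?thesis by blast
  qed
  ultimately show ?thesis by blast
qed

lemma hom_poly_pencil:
  assumes "\<forall>v. \<exists>\<pi>. \<forall>t. pluecker k (\<xi> t) v = poly \<pi> t" "hom_poly d P"
  shows "\<exists>\<pi>. \<forall>t. P (pluecker k (\<xi> t)) = poly \<pi> t"
  using assms(2)
proof induction
  case (const c)
  show ?case by (rule exI[of _ "[:c:]"]) simp
next
  case (coord v)
  show ?case using assms(1) by blast
next
  case (add d P Q)
  then obtain p q where "\<forall>t. P (pluecker k (\<xi> t)) = poly p t" "\<forall>t. Q (pluecker k (\<xi> t)) = poly q t" by blast
  then show ?case by (intro exI[of _ "p + q"]) simp
next
  case (mult d P e Q)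
  then obtain p q where "\<forall>t. P (pluecker k (\<xi> t)) = poly p t" "\<forall>t. Q (pluecker k (\<xi> t)) = poly q t" by blast
  then show ?case by (intro exI[of _ "p * q"]) simp
qed

text \<open>A non-empty basic open set meets the pencil in the complement of the zeros of a non-zero polynomial.\<close>

lemma pencil_open_cofinite:
  assumes "openin (zariski sV k) U" "pencil t0 \<in> U"
  shows "finite {t. pencil t \<notin> U}"
proof -
  from assms(1) have "generate_topology_on {basic_open sV k P | P d. hom_poly d P} U"
    unfolding zariski_def by (simp only: openin_topology_generated_by_iff)
  then show ?thesis using assms(2)
  proof induction
    case Empty
    then show ?case by simp
  next
    case (Int a b)
    then have "finite ({t. pencil t \<notin> a} \<union> {t. pencil t \<notin> b})" by simp
    then show ?case by (rule finite_subset[rotated]) auto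
  next
    case (UN K)
    then obtain a where "a \<in> K" "pencil t0 \<in> a" by blast
    with UN.IH have "finite {t. pencil t \<notin> a}" by blast
    then show ?case by (rule finite_subset[rotated]) (use \<open>a \<in> K\<close> in auto)
  next
    case (Basis s)
    then obtain P d where P: "s = basic_open sV k P" "hom_poly d P" by blast
    from pencil_frame obtain \<xi> where \<xi>: "\<forall>t. indexed_basis (fscale (*)) (k + 1) (\<xi> t) (pencil t)"
      "\<forall>v. \<exists>\<pi>. \<forall>t. pluecker k (\<xi> t) v = poly \<pi> t" by blast
    from hom_poly_pencil[OF \<xi>(2) P(2)] obtain \<pi> where \<pi>: "\<forall>t. P (pluecker k (\<xi> t)) = poly \<pi> t" by blast
    have iff: "pencil t \<in> s \<longleftrightarrow> poly \<pi> t \<noteq> 0" for t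
      using basic_open_iff[OF P(2) pencil_in_grassmannian \<xi>(1)[rule_format]] \<pi> by (simp add: P(1))
    with Basis have "\<pi> \<noteq> 0" by auto
    then show ?case by (simp add: iff poly_roots_finite)
  qed
qed

lemma regular_on_pencil:
  assumes "g \<in> regular_on sV k W" "pencil t0 \<in> W"
  shows "rational_near (\<lambda>t. g (pencil t)) t0"
proof -
  from assms obtain U d P Q where *: "openin (zariski sV k) U" "pencil t0 \<in> U" "hom_poly d P" "hom_poly d Q"
    "\<forall>M\<in>U. \<forall>\<xi>. indexed_basis (fscale (*)) (k + 1) \<xi> M \<longrightarrow>
      Q (pluecker k \<xi>) \<noteq> 0 \<and> g M = P (pluecker k \<xi>) / Q (pluecker k \<xi>)"
    unfolding regular_on_def by blast
  from pencil_frame obtain \<xi> where \<xi>: "\<forall>t. indexed_basis (fscale (*)) (k + 1) (\<xi> t) (pencil t)"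
    "\<forall>v. \<exists>\<pi>. \<forall>t. pluecker k (\<xi> t) v = poly \<pi> t" by blast
  from hom_poly_pencil[OF \<xi>(2) *(3)] obtain p where p: "\<forall>t. P (pluecker k (\<xi> t)) = poly p t" by blast
  from hom_poly_pencil[OF \<xi>(2) *(4)] obtain q where q: "\<forall>t. Q (pluecker k (\<xi> t)) = poly q t" by blast
  show ?thesis
  proof (rule rational_nearI)
    show "finite {t. pencil t \<notin> U}" by (rule pencil_open_cofinite[OF *(1,2)])
    show "t0 \<notin> {t. pencil t \<notin> U}" using *(2) by simp
    show "poly q t \<noteq> 0" if "t \<notin> {t. pencil t \<notin> U}" for t
      using *(5) \<xi>(1) q that by (metis (mono_tags, lifting) mem_Collect_eq)
    show "g (pencil t) = poly p t / poly q t" if "t \<notin> {t. pencil t \<notin> U}" for t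
      using *(5) \<xi>(1) p q that by (metis (mono_tags, lifting) mem_Collect_eq)
  qed
qed

text \<open>In a local frame the functional along the pencil is a sum of products of polynomials and regular functions,
so it is rational near every \<open>t\<close>.\<close>

lemma regular_functional_pencil:
  assumes \<Phi>: "regular_functional sV k \<Phi>"
  shows "\<exists>p. \<forall>t. \<Phi> (pencil t) (pencil_point t) = poly p t"
proof (rule everywhere_rational_imp_poly)
  fix t0
  from local_frame[OF pencil_in_grassmannian[of t0]] obtain v W \<sigma> where
    W: "openin (zariski sV k) W" "pencil t0 \<in> W"
    and \<sigma>: "\<forall>i<k + 1. \<sigma> i \<in> sections (universal_bundle sV k) W"
    and expand: "\<forall>L\<in>W. \<forall>\<zeta>\<in>L. \<zeta> = (\<lambda>u. \<Sum>i<k + 1. \<zeta> (v i) * \<sigma> i L u)" by blast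
  have rat: "rational_near (\<lambda>t. \<Phi> (pencil t) (\<sigma> i (pencil t))) t0" if i: "i < k + 1" for i
  proof -
    from \<sigma> i have "\<sigma> i \<in> sections (universal_bundle sV k) W" by blast
    from regular_functional_section[OF \<Phi> W(1) this]
    obtain m :: nat and c \<tau> where *: "\<forall>j<m. \<tau> j \<in> regular_on sV k W"
      "\<forall>L\<in>W. \<Phi> L (\<sigma> i L) = (\<Sum>j<m. c j * \<tau> j L)" by (elim exE conjE)
    have "rational_near (\<lambda>t. \<Sum>j<m. poly [:c j:] t * \<tau> j (pencil t)) t0"
      using * W(2) by (intro rational_near_sum rational_near_mult rational_near_poly regular_on_pencil) auto
    then show ?thesis
      by (rule rational_near_cong[OF _ pencil_open_cofinite[OF W]]) (use * W(2) in auto)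
  qed
  have "rational_near (\<lambda>t. \<Sum>i<k + 1. poly [:\<eta>0 (v i), \<eta>1 (v i):] t * \<Phi> (pencil t) (\<sigma> i (pencil t))) t0"
    by (intro rational_near_sum rational_near_mult rational_near_poly rat) auto
  then show "rational_near (\<lambda>t. \<Phi> (pencil t) (pencil_point t)) t0"
  proof (rule rational_near_cong[OF _ pencil_open_cofinite[OF W]])
    show "t0 \<notin> {t. pencil t \<notin> W}" using W(2) by simp
    fix t assume "t \<notin> {t. pencil t \<notin> W}"
    then have t: "pencil t \<in> W" by simp
    have mem: "\<sigma> i (pencil t) \<in> pencil t" if "i < k + 1" for i
      using \<sigma> t that by (auto simp: universal_bundle_def)
    have "pencil_point t = (\<lambda>u. \<Sum>i<k + 1. pencil_point t (v i) * \<sigma> i (pencil t) u)"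
      using expand t pencil_point_in_pencil(1) by blast
    then have "\<Phi> (pencil t) (pencil_point t) = \<Phi> (pencil t) (\<lambda>u. \<Sum>i<k + 1. pencil_point t (v i) * \<sigma> i (pencil t) u)"
      by (rule arg_cong)
    also have "\<dots> = (\<Sum>i<k + 1. pencil_point t (v i) * \<Phi> (pencil t) (\<sigma> i (pencil t)))"
      by (rule regular_functional_combination[OF \<Phi> pencil_in_grassmannian mem])
    also have "\<dots> = (\<Sum>i<k + 1. poly [:\<eta>0 (v i), \<eta>1 (v i):] t * \<Phi> (pencil t) (\<sigma> i (pencil t)))"
      by (intro sum.cong) (simp_all add: pencil_point_def fscale_def)
    finally show "\<Phi> (pencil t) (pencil_point t) =
      (\<Sum>i<k + 1. poly [:\<eta>0 (v i), \<eta>1 (v i):] t * \<Phi> (pencil t) (\<sigma> i (pencil t)))" .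
  qed
qed

end

text \<open>The two affine charts of the pencil are parametrized by \<open>\<eta>0 + t \<eta>1\<close> and \<open>\<eta>1 + t \<eta>0\<close>. In both of them the
functional is polynomial, so together they form a section of \<open>O(1)\<close> on the projective line.\<close>

lemma pencil_additive:
  assumes \<Phi>: "regular_functional sV k \<Phi>"
    and dual: "insert \<eta>0 (insert \<eta>1 C) \<subseteq> dual_space sV"
    and indep: "\<not> FS.dependent (insert \<eta>0 (insert \<eta>1 C))"
    and new: "\<eta>0 \<noteq> \<eta>1" "\<eta>0 \<notin> C" "\<eta>1 \<notin> C"
    and C: "finite C" "card C = k"
  shows "\<Phi> (FS.span (insert (\<eta>0 + \<eta>1) C)) (\<eta>0 + \<eta>1) =
    \<Phi> (FS.span (insert \<eta>0 C)) \<eta>0 + \<Phi> (FS.span (insert \<eta>1 C)) \<eta>1"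
proof -
  have dual': "insert \<eta>1 (insert \<eta>0 C) \<subseteq> dual_space sV" and indep': "\<not> FS.dependent (insert \<eta>1 (insert \<eta>0 C))"
    using dual indep by (simp_all add: insert_commute)
  define x where "x t = \<eta>0 + fscale (*) t \<eta>1" for t
  define y where "y t = \<eta>1 + fscale (*) t \<eta>0" for t
  from regular_functional_pencil[OF dual indep new C \<Phi>] obtain p where
    p: "\<And>t. \<Phi> (FS.span (insert (x t) C)) (x t) = poly p t"
    unfolding pencil_def[OF dual indep new C] pencil_point_def[OF dual indep new C] x_def by blast
  from regular_functional_pencil[OF dual' indep' new(1)[symmetric] new(3,2) C \<Phi>] obtain q where
    q: "\<And>t. \<Phi> (FS.span (insert (y t) C)) (y t) = poly q t"
    unfolding pencil_def[OF dual' indep' new(1)[symmetric] new(3,2) C]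
      pencil_point_def[OF dual' indep' new(1)[symmetric] new(3,2) C] y_def by blast
  have "poly p t = t * poly q (1 / t)" if t: "t \<noteq> 0" for t
  proof -
    have xy: "x t = fscale (*) t (y (1 / t))" "y (1 / t) = fscale (*) (1 / t) (x t)"
      using t by (auto simp: x_def y_def fscale_def fun_eq_iff field_simps)
    have "FS.span (insert (x t) C) = FS.span (insert (y (1 / t)) C)"
    proof (rule FS.span_eq[THEN iffD2], intro conjI)
      show "insert (x t) C \<subseteq> FS.span (insert (y (1 / t)) C)"
        unfolding xy(1) by (auto intro: FS.span_scale FS.span_base)
      show "insert (y (1 / t)) C \<subseteq> FS.span (insert (x t) C)"
        unfolding xy(2) by (auto intro: FS.span_scale FS.span_base)
    qed
    moreover have "FS.span (insert (y (1 / t)) C) \<in> grassmannian sV k"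
      using pencil_in_grassmannian[OF dual' indep' new(1)[symmetric] new(3,2) C, of "1 / t"]
      unfolding pencil_def[OF dual' indep' new(1)[symmetric] new(3,2) C]
        pencil_point_def[OF dual' indep' new(1)[symmetric] new(3,2) C] y_def .
    ultimately have "\<Phi> (FS.span (insert (x t) C)) (x t) = t * \<Phi> (FS.span (insert (y (1 / t)) C)) (y (1 / t))"
      unfolding xy(1) using regular_functional_scale[OF \<Phi>, of _ "y (1 / t)" t] FS.span_base[of "y (1 / t)"] by simp
    then show ?thesis by (simp only: p q)
  qed
  from two_chart_linear[OF this] have "poly p 1 = poly p 0 + poly q 0" .
  moreover have "x 1 = \<eta>0 + \<eta>1" "x 0 = \<eta>0" "y 0 = \<eta>1" by (simp_all add: x_def y_def)
  ultimately show ?thesis using p[of 1] p[of 0] q[of 0] by simp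
qed

end

context finite_dim_V
begin

section \<open>Regular functionals are evaluations at vectors\<close>

lemma dual_dim:
  "\<exists>E. E \<subseteq> dual_space sV \<and> \<not> FS.dependent E \<and> finite E \<and> card E = card BV \<and> dual_space sV \<subseteq> FS.span E"
proof -
  obtain b \<delta> where *: "\<forall>j<card BV. \<delta> j \<in> dual_space sV"
    "\<forall>i<card BV. \<forall>j<card BV. \<delta> i (b j) = (if i = j then 1 else 0)"
    "\<forall>l\<in>dual_space sV. l = (\<lambda>u. \<Sum>j<card BV. l (b j) * \<delta> j u)" by (rule dual_basis)
  have lin: "\<forall>j\<in>{..<card BV}. c j = 0" if "\<forall>x. (\<Sum>j\<in>{..<card BV}. c j * \<delta> j x) = 0" for c
  proof
    fix j assume j: "j \<in> {..<card BV}"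
    have "(\<Sum>i\<in>{..<card BV}. c i * \<delta> i (b j)) = (\<Sum>i\<in>{..<card BV}. if i = j then c i else 0)"
      by (rule sum.cong) (use *(2) j in auto)
    also have "\<dots> = c j" using j by simp
    finally show "c j = 0" using that by simp
  qed
  note ind = independent_family[where f = \<delta>, OF finite_lessThan, OF lin]
  have "dual_space sV \<subseteq> FS.span (\<delta> ` {..<card BV})"
    using *(3) span_combination[where \<xi> = \<delta> and r = "card BV"] by (metis subsetI)
  with ind * show ?thesis
    by (intro exI[of _ "\<delta> ` {..<card BV}"]) (auto simp: card_image)
qed

lemma extend_independent:
  assumes B: "B \<subseteq> dual_space sV" "\<not> FS.dependent B" "card B \<le> m" and m: "m \<le> card BV"
  shows "\<exists>E. B \<subseteq> E \<and> E \<subseteq> dual_space sV \<and> \<not> FS.dependent E \<and> finite E \<and> card E = m"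
proof -
  obtain E0 where E0: "E0 \<subseteq> dual_space sV" "\<not> FS.dependent E0" "finite E0" "card E0 = card BV"
    "dual_space sV \<subseteq> FS.span E0" using dual_dim by blast
  obtain E1 where E1: "B \<subseteq> E1" "E1 \<subseteq> dual_space sV" "\<not> FS.dependent E1" "dual_space sV \<subseteq> FS.span E1"
    using FS.maximal_independent_subset_extend[OF B(1,2)] by blast
  have fin: "finite E1" using FS.independent_span_bound[OF E0(3) E1(3)] E1(2) E0(5) by blast
  have "card E0 \<le> card E1" using FS.independent_span_bound[OF fin E0(2)] E0(1) E1(4) by blast
  then have "m - card B \<le> card (E1 - B)"
    using m E0(4) card_Diff_subset[OF finite_subset[OF E1(1) fin] E1(1)] by simp
  then obtain T where T: "T \<subseteq> E1 - B" "card T = m - card B" "finite T" by (rule obtain_subset_with_card_n)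
  have finB: "finite B" using E1(1) fin finite_subset by blast
  have "card (B \<union> T) = card B + card T" using T finB by (intro card_Un_disjoint) auto
  then have "card (B \<union> T) = m" using T(2) B(3) by simp
  moreover have "\<not> FS.dependent (B \<union> T)"
    using FS.independent_mono[OF E1(3), of "B \<union> T"] E1(1) T(1) by blast
  ultimately show ?thesis using E1 T finB by (intro exI[of _ "B \<union> T"]) auto
qed

lemma span_insert_add:
  assumes "c \<in> FS.span C"
  shows "FS.span (insert (x + c) C) = FS.span (insert (x :: 'v \<Rightarrow> 'k) C)"
proof (rule FS.span_eq[THEN iffD2], intro conjI)
  have C: "c \<in> FS.span (insert y C)" for y using assms FS.span_mono[of C "insert y C"] by blast
  have "x + c \<in> FS.span (insert x C)" by (rule FS.span_add[OF FS.span_base C]) simp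
  then show "insert (x + c) C \<subseteq> FS.span (insert x C)" by (auto intro: FS.span_base)
  have "(x + c) - c \<in> FS.span (insert (x + c) C)" by (rule FS.span_diff[OF FS.span_base C]) simp
  then have "x \<in> FS.span (insert (x + c) C)" by simp
  then show "insert x C \<subseteq> FS.span (insert (x + c) C)" by (auto intro: FS.span_base)
qed

text \<open>A refined Steinitz exchange: the removed element can be chosen outside \<open>B'\<close>. Otherwise \<open>\<eta>'\<close> would survive
in the span after the removal of all of \<open>B - B'\<close>, so it would depend on \<open>B \<inter> B'\<close>.\<close>

lemma exchangeable_element:
  assumes B: "\<not> FS.dependent (B :: ('v \<Rightarrow> 'k) set)" "finite B" and B': "\<not> FS.dependent B'"
    and \<eta>': "\<eta>' \<in> B'" "\<eta>' \<notin> B" and ne: "B - B' \<noteq> {}"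
  shows "\<exists>\<eta>\<in>B - B'. \<eta>' \<notin> FS.span (B - {\<eta>})"
proof (rule ccontr)
  assume "\<not> ?thesis"
  then have all: "\<eta>' \<in> FS.span (B - {\<eta>})" if "\<eta> \<in> B - B'" for \<eta> using that by blast
  from ne obtain \<eta>0 where "\<eta>0 \<in> B - B'" by blast
  from all[OF this] have 0: "\<eta>' \<in> FS.span B" using FS.span_mono[of "B - {\<eta>0}" B] by blast
  have "finite F \<Longrightarrow> F \<subseteq> B - B' \<Longrightarrow> \<eta>' \<in> FS.span (B - F)" for F
  proof (induction F rule: finite_induct)
    case empty
    with 0 show ?case by simp
  next
    case (insert \<eta> F)
    show ?case
    proof (rule ccontr)
      assume no: "\<eta>' \<notin> FS.span (B - insert \<eta> F)"
      have e: "insert \<eta> (B - insert \<eta> F) = B - F" using insert by auto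
      from insert have "\<eta>' \<in> FS.span (insert \<eta> (B - insert \<eta> F))" unfolding e by simp
      from FS.in_span_insert[OF this no] have 1: "\<eta> \<in> FS.span (insert \<eta>' (B - insert \<eta> F))" .
      have "insert \<eta>' (B - insert \<eta> F) \<subseteq> FS.span (B - {\<eta>})"
        using all[of \<eta>] insert.prems by (auto intro: FS.span_base)
      then have "FS.span (insert \<eta>' (B - insert \<eta> F)) \<subseteq> FS.span (B - {\<eta>})"
        by (rule FS.span_minimal) simp
      with 1 have "\<eta> \<in> FS.span (B - {\<eta>})" by blast
      with insert.prems B(1) show False unfolding FS.dependent_def by blast
    qed
  qed
  from this[of "B - B'"] B(2) have "\<eta>' \<in> FS.span (B - (B - B'))" by simp
  moreover have "B - (B - B') \<subseteq> B' - {\<eta>'}" using \<eta>' by auto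
  ultimately have "\<eta>' \<in> FS.span (B' - {\<eta>'})" using FS.span_mono by blast
  with \<eta>'(1) B' show False unfolding FS.dependent_def by blast
qed

context
  fixes \<Psi> :: "('v \<Rightarrow> 'k) set \<Rightarrow> ('v \<Rightarrow> 'k) \<Rightarrow> 't::ab_group_add" and sT :: "'k \<Rightarrow> 't \<Rightarrow> 't"
  assumes T: "vector_space sT"
    and add: "\<And>L a b. L \<in> grassmannian sV k \<Longrightarrow> a \<in> L \<Longrightarrow> b \<in> L \<Longrightarrow> \<Psi> L (a + b) = \<Psi> L a + \<Psi> L b"
    and scale: "\<And>L a c. L \<in> grassmannian sV k \<Longrightarrow> a \<in> L \<Longrightarrow> \<Psi> L (fscale (*) c a) = sT c (\<Psi> L a)"
    and pencil: "\<And>C \<eta>0 \<eta>1. insert \<eta>0 (insert \<eta>1 C) \<subseteq> dual_space sV \<Longrightarrow>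
      \<not> FS.dependent (insert \<eta>0 (insert \<eta>1 C)) \<Longrightarrow> \<eta>0 \<noteq> \<eta>1 \<Longrightarrow> \<eta>0 \<notin> C \<Longrightarrow> \<eta>1 \<notin> C \<Longrightarrow>
      finite C \<Longrightarrow> card C = k \<Longrightarrow>
      \<Psi> (FS.span (insert (\<eta>0 + \<eta>1) C)) (\<eta>0 + \<eta>1) =
      \<Psi> (FS.span (insert \<eta>0 C)) \<eta>0 + \<Psi> (FS.span (insert \<eta>1 C)) \<eta>1"
    and kn: "k + 2 \<le> card BV"
begin

interpretation T: vector_space sT by (rule T)

text \<open>Apply the additivity along pencils to \<open>\<eta>0 + c\<close> in place of \<open>\<eta>0\<close>. The subspaces do not change, and the
difference of the two identities is the claim.\<close>

lemma pencil_axis_half: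
  assumes dual: "insert \<eta>0 (insert \<eta>1 C) \<subseteq> dual_space sV"
    and indep: "\<not> FS.dependent (insert \<eta>0 (insert \<eta>1 C))"
    and new: "\<eta>0 \<noteq> \<eta>1" "\<eta>0 \<notin> C" "\<eta>1 \<notin> C" and C: "finite C" "card C = k" and c: "c \<in> C"
  shows "\<Psi> (FS.span (insert (\<eta>0 + \<eta>1) C)) c = \<Psi> (FS.span (insert \<eta>0 C)) c"
proof -
  have ind1: "\<not> FS.dependent (insert \<eta>1 C)" and out: "\<eta>0 \<notin> FS.span (insert \<eta>1 C)"
    using indep new by (auto simp: FS.independent_insert)
  have cs: "c \<in> FS.span C" "c \<in> FS.span (insert \<eta>1 C)" using c by (auto intro: FS.span_base)
  have out': "\<eta>0 + c \<notin> FS.span (insert \<eta>1 C)"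
  proof
    assume "\<eta>0 + c \<in> FS.span (insert \<eta>1 C)"
    from FS.span_diff[OF this cs(2)] out show False by simp
  qed
  have "\<eta>0 + c \<in> dual_space sV" using dual c by (intro FS.subspace_add[OF subspace_dual_space[OF vector_space_V]]) auto
  then have dual': "insert (\<eta>0 + c) (insert \<eta>1 C) \<subseteq> dual_space sV" using dual by auto
  have indep': "\<not> FS.dependent (insert (\<eta>0 + c) (insert \<eta>1 C))" by (rule FS.independent_insertI[OF out' ind1])
  have new': "\<eta>0 + c \<noteq> \<eta>1" "\<eta>0 + c \<notin> C" using out' FS.span_base[of _ "insert \<eta>1 C"] by auto
  let ?A = "FS.span (insert \<eta>0 C)" and ?M = "FS.span (insert (\<eta>0 + \<eta>1) C)"
  have M0: "?A \<in> grassmannian sV k"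
  proof (rule span_in_grassmannian[OF vector_space_V])
    show "\<not> FS.dependent (insert \<eta>0 C)" by (rule FS.independent_mono[OF indep]) auto
  qed (use dual new C in auto)
  have M: "?M \<in> grassmannian sV k"
    using pencil_in_grassmannian[OF dual indep new C, of 1]
    unfolding pencil_def[OF dual indep new C] pencil_point_def[OF dual indep new C] by simp
  have mem: "c \<in> ?A" "c \<in> ?M" "\<eta>0 \<in> ?A" "\<eta>0 + \<eta>1 \<in> ?M" using c by (auto intro: FS.span_base)
  have "(\<eta>0 + c) + \<eta>1 = (\<eta>0 + \<eta>1) + c" by (simp only: ac_simps)
  with pencil[OF dual' indep' new' new(3) C]
  have "\<Psi> ?M ((\<eta>0 + \<eta>1) + c) = \<Psi> ?A (\<eta>0 + c) + \<Psi> (FS.span (insert \<eta>1 C)) \<eta>1"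
    by (simp only: span_insert_add[OF cs(1)])
  then have "\<Psi> ?M (\<eta>0 + \<eta>1) + \<Psi> ?M c = \<Psi> ?A \<eta>0 + \<Psi> ?A c + \<Psi> (FS.span (insert \<eta>1 C)) \<eta>1"
    by (simp only: add[OF M mem(4,2)] add[OF M0 mem(3,1)])
  with pencil[OF dual indep new C] show ?thesis by (simp add: algebra_simps)
qed

lemma pencil_axis:
  assumes dual: "insert \<eta>0 (insert \<eta>1 C) \<subseteq> dual_space sV"
    and indep: "\<not> FS.dependent (insert \<eta>0 (insert \<eta>1 C))"
    and new: "\<eta>0 \<noteq> \<eta>1" "\<eta>0 \<notin> C" "\<eta>1 \<notin> C" and C: "finite C" "card C = k" and c: "c \<in> C"
  shows "\<Psi> (FS.span (insert \<eta>0 C)) c = \<Psi> (FS.span (insert \<eta>1 C)) c"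
proof -
  have "insert \<eta>1 (insert \<eta>0 C) \<subseteq> dual_space sV" "\<not> FS.dependent (insert \<eta>1 (insert \<eta>0 C))"
    using dual indep by (simp_all add: insert_commute)
  from pencil_axis_half[OF this new(1)[symmetric] new(3,2) C c] pencil_axis_half[OF assms]
  show ?thesis by (simp add: add.commute)
qed

text \<open>The value of \<open>\<Psi>\<close> at a functional does not depend on the subspace: two subspaces that contain \<open>\<xi>\<close> are joined
by exchanging basis elements other than \<open>\<xi>\<close> one at a time. A step either keeps the span or moves along
a pencil whose axis contains \<open>\<xi>\<close>.\<close>

lemma exchange_bases:
  assumes "B \<subseteq> dual_space sV" "\<not> FS.dependent B" "finite B" "card B = k + 1" "\<xi> \<in> B"
    and "B' \<subseteq> dual_space sV" "\<not> FS.dependent B'" "finite B'" "card B' = k + 1" "\<xi> \<in> B'"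
  shows "\<Psi> (FS.span B) \<xi> = \<Psi> (FS.span B') \<xi>"
  using assms(1-5)
proof (induction "card (B' - B)" arbitrary: B)
  case 0
  then have "B' \<subseteq> B" using assms(8) by simp
  with 0 assms(8,9) have "B' = B" by (intro card_subset_eq) auto
  then show ?case by simp
next
  case (Suc m)
  then obtain \<eta>' where \<eta>': "\<eta>' \<in> B'" "\<eta>' \<notin> B" by (metis Diff_iff card_eq_0_iff ex_in_conv nat.distinct(1))
  have "B - B' \<noteq> {}"
  proof
    assume "B - B' = {}"
    then have "B \<subseteq> B'" by blast
    with Suc.prems assms(8,9) have "B = B'" by (intro card_subset_eq) auto
    with \<eta>' show False by blast
  qed
  from exchangeable_element[OF Suc.prems(2,3) assms(7) \<eta>' this]
  obtain \<eta> where \<eta>: "\<eta> \<in> B" "\<eta> \<notin> B'" "\<eta>' \<notin> FS.span (B - {\<eta>})" by blast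
  define C where "C = B - {\<eta>}"
  have BC: "B = insert \<eta> C" "\<eta> \<notin> C" "\<eta>' \<notin> C" using \<eta> \<eta>' by (auto simp: C_def)
  have C: "finite C" "card C = k" using Suc.prems \<eta>(1) by (auto simp: C_def)
  have \<xi>: "\<xi> \<in> C" using Suc.prems(5) \<eta>(2) assms(10) by (auto simp: C_def)
  define B2 where "B2 = insert \<eta>' C"
  have indC: "\<not> FS.dependent C" using FS.independent_mono[OF Suc.prems(2)] BC by blast
  have B2: "B2 \<subseteq> dual_space sV" "\<not> FS.dependent B2" "finite B2" "card B2 = k + 1" "\<xi> \<in> B2"
    using Suc.prems(1) \<eta>' assms(6) C BC \<xi> FS.independent_insertI[OF \<eta>(3)[folded C_def] indC]
    by (auto simp: B2_def)
  have "B' - B = insert \<eta>' (B' - B2)" using \<eta>' \<eta>(2) by (auto simp: B2_def C_def)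
  moreover have "\<eta>' \<notin> B' - B2" by (simp add: B2_def)
  ultimately have "card (B' - B) = Suc (card (B' - B2))" using assms(8) by simp
  with Suc(2) have "m = card (B' - B2)" by simp
  from Suc.hyps(1)[OF this B2] have IH: "\<Psi> (FS.span B2) \<xi> = \<Psi> (FS.span B') \<xi>" .
  have "\<Psi> (FS.span B) \<xi> = \<Psi> (FS.span B2) \<xi>"
  proof (cases "\<eta>' \<in> FS.span B")
    case True
    have "\<eta> \<in> FS.span B2"
      unfolding B2_def by (rule FS.in_span_insert[OF True[unfolded BC(1)] \<eta>(3)[folded C_def]])
    then have "B \<subseteq> FS.span B2" unfolding BC(1) B2_def by (auto intro: FS.span_base)
    moreover have "B2 \<subseteq> FS.span B" using True unfolding B2_def BC(1) by (auto intro: FS.span_base)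
    ultimately have "FS.span B = FS.span B2" using FS.span_eq by blast
    then show ?thesis by simp
  next
    case False
    have "insert \<eta>' B = insert \<eta> (insert \<eta>' C)" unfolding BC(1) by (rule insert_commute)
    with FS.independent_insertI[OF False Suc.prems(2)]
    have "\<not> FS.dependent (insert \<eta> (insert \<eta>' C))" by simp
    moreover have "insert \<eta> (insert \<eta>' C) \<subseteq> dual_space sV" using Suc.prems(1) BC \<eta>' assms(6) by auto
    moreover have "\<eta> \<noteq> \<eta>'" using \<eta> \<eta>' by blast
    ultimately show ?thesis
      unfolding BC(1) B2_def using pencil_axis[OF _ _ _ BC(2,3) C \<xi>] by blast
  qed
  with IH show ?case by simp
qed

text \<open>The global sections of the dual of the tautological bundle are the vectors of \<open>V\<close>; here with values in
\<open>T\<close>. For independent \<open>a\<close> and \<open>b\<close> a set \<open>C\<close> of \<open>k\<close> further independent functionals exists because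
the dual space has dimension at least \<open>k + 2\<close>, and additivity follows from the pencil with axis \<open>C\<close>.\<close>

lemma linear_extension:
  "\<exists>f. (\<forall>a\<in>dual_space sV. \<forall>b\<in>dual_space sV. f (a + b) = f a + f b) \<and>
    (\<forall>c. \<forall>a\<in>dual_space sV. f (fscale (*) c a) = sT c (f a)) \<and>
    (\<forall>L\<in>grassmannian sV k. \<forall>\<zeta>\<in>L. \<Psi> L \<zeta> = f \<zeta>)"
proof -
  define good where "good \<xi> B \<longleftrightarrow> B \<subseteq> dual_space sV \<and> \<not> FS.dependent B \<and> finite B \<and> card B = k + 1 \<and> \<xi> \<in> B" for \<xi> B
  have ex: "\<exists>B. good \<xi> B" if "\<xi> \<in> dual_space sV" "\<xi> \<noteq> 0" for \<xi>
  proof -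
    have "\<not> FS.dependent {\<xi>}" using that(2) FS.dependent_single by blast
    then show ?thesis using extend_independent[of "{\<xi>}" "k + 1"] that kn unfolding good_def by auto
  qed
  define f where "f \<xi> = (if \<xi> = 0 then 0 else \<Psi> (FS.span (SOME B. good \<xi> B)) \<xi>)" for \<xi>
  have f: "f \<xi> = \<Psi> (FS.span B) \<xi>" if "good \<xi> B" "\<xi> \<noteq> 0" for \<xi> B
  proof -
    have "good \<xi> (SOME B. good \<xi> B)" using that(1) by (rule someI)
    then have "\<Psi> (FS.span (SOME B. good \<xi> B)) \<xi> = \<Psi> (FS.span B) \<xi>"
      using that(1) unfolding good_def by (intro exchange_bases) auto
    with that(2) show ?thesis by (simp add: f_def)
  qed
  have grass: "FS.span B \<in> grassmannian sV k" if "good \<xi> B" for \<xi> B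
    using that unfolding good_def by (intro span_in_grassmannian[OF vector_space_V]) auto
  have \<Psi>0: "\<Psi> L 0 = 0" if "L \<in> grassmannian sV k" for L
  proof -
    have "0 \<in> L" using that FS.subspace_0 by (auto simp: grassmannian_def)
    from scale[OF that this, of 0] show ?thesis by (simp only: FS.scale_zero_left T.scale_zero_left)
  qed
  have f_eq: "\<Psi> L \<zeta> = f \<zeta>" if L: "L \<in> grassmannian sV k" and \<zeta>: "\<zeta> \<in> L" for L \<zeta>
  proof (cases "\<zeta> = 0")
    case True
    with \<Psi>0[OF L] show ?thesis by (simp add: f_def)
  next
    case False
    have sub: "FS.subspace L" "FS.dim L = k + 1" "L \<subseteq> dual_space sV" using L by (auto simp: grassmannian_def)
    have "\<not> FS.dependent {\<zeta>}" using False FS.dependent_single by blast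
    with \<zeta> obtain B where B: "{\<zeta>} \<subseteq> B" "B \<subseteq> L" "\<not> FS.dependent B" "L \<subseteq> FS.span B"
      using FS.maximal_independent_subset_extend[of "{\<zeta>}" L] by blast
    have LB: "FS.span B = L" using B sub(1) by (metis FS.span_minimal subset_antisym)
    have "card B = k + 1" using FS.basis_card_eq_dim[OF B(2,4,3)] sub(2) by simp
    then have "good \<zeta> B" using B sub(3) unfolding good_def by (auto intro: card_ge_0_finite)
    from f[OF this False] show ?thesis by (simp add: LB)
  qed
  have f_scale: "f (fscale (*) c a) = sT c (f a)" if a: "a \<in> dual_space sV" for c a
  proof (cases "a = 0")
    case True
    then show ?thesis by (simp only: FS.scale_zero_right f_def if_True T.scale_zero_right simp_thms)
  next
    case False
    from ex[OF a False] obtain B where B: "good a B" by blast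
    have "a \<in> FS.span B" using B by (auto simp: good_def intro: FS.span_base)
    then show ?thesis
      using f_eq[OF grass[OF B]] scale[OF grass[OF B], of a c] FS.span_scale[of a B c] by metis
  qed
  have f_add: "f (a + b) = f a + f b" if a: "a \<in> dual_space sV" and b: "b \<in> dual_space sV" for a b
  proof (cases "a = 0")
    case True
    then show ?thesis by (simp add: f_def)
  next
    case a0: False
    show ?thesis
    proof (cases "b \<in> FS.span {a}")
      case True
      then obtain c where c: "b = fscale (*) c a" by (auto simp: FS.span_singleton)
      have "a + b = fscale (*) (1 + c) a" by (simp only: c FS.scale_left_distrib FS.scale_one)
      then have "f (a + b) = sT (1 + c) (f a)" by (simp only: f_scale[OF a])
      also have "\<dots> = f a + f b" by (simp only: c f_scale[OF a] T.scale_left_distrib T.scale_one)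
      finally show ?thesis .
    next
      case False
      have "\<not> FS.dependent {a}" using a0 FS.dependent_single by blast
      then have ind: "\<not> FS.dependent {b, a}" using False by (rule FS.independent_insertI[rotated])
      have ab: "a \<noteq> b" using False FS.span_base[of a "{a}"] by auto
      from extend_independent[of "{b, a}" "k + 2"] ind a b kn ab
      obtain E where E: "{b, a} \<subseteq> E" "E \<subseteq> dual_space sV" "\<not> FS.dependent E" "finite E" "card E = k + 2"
        by auto
      define C where "C = E - {a, b}"
      have EC: "E = insert a (insert b C)" "a \<notin> C" "b \<notin> C" using E(1) by (auto simp: C_def)
      have C: "finite C" "card C = k" using E ab by (auto simp: C_def card_Diff_subset)
      have dual: "insert a (insert b C) \<subseteq> dual_space sV" and indep: "\<not> FS.dependent (insert a (insert b C))"
        using E EC by auto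
      have 1: "FS.span (insert a C) \<in> grassmannian sV k" "FS.span (insert b C) \<in> grassmannian sV k"
        using dual EC C FS.independent_mono[OF indep, of "insert a C"] FS.independent_mono[OF indep, of "insert b C"]
        by (auto intro!: span_in_grassmannian[OF vector_space_V])
      have 2: "FS.span (insert (a + b) C) \<in> grassmannian sV k"
        using pencil_in_grassmannian[OF dual indep ab EC(2,3) C, of 1]
        unfolding pencil_def[OF dual indep ab EC(2,3) C] pencil_point_def[OF dual indep ab EC(2,3) C] by simp
      have "f (a + b) = \<Psi> (FS.span (insert (a + b) C)) (a + b)" by (rule f_eq[OF 2, symmetric]) (auto intro: FS.span_base)
      also have "\<dots> = \<Psi> (FS.span (insert a C)) a + \<Psi> (FS.span (insert b C)) b"
        by (rule pencil[OF dual indep ab EC(2,3) C])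
      also have "\<dots> = f a + f b" using f_eq[OF 1(1), of a] f_eq[OF 1(2), of b] by (simp add: FS.span_base)
      finally show ?thesis .
    qed
  qed
  from f_add f_scale f_eq show ?thesis by (intro exI[of _ f]) blast
qed

end

lemma subspace_in_grassmannian_point:
  assumes "finite W" "W \<subseteq> dual_space sV" "card W \<le> k + 1" "k + 1 \<le> card BV"
  shows "\<exists>L\<in>grassmannian sV k. W \<subseteq> L"
proof -
  obtain B where B: "B \<subseteq> W" "\<not> FS.dependent B" "W \<subseteq> FS.span B" using FS.maximal_independent_subset by blast
  have "card B \<le> k + 1" using card_mono[OF assms(1) B(1)] assms(3) by simp
  from extend_independent[OF _ B(2) this assms(4)] B(1) assms(2) obtain E where
    E: "B \<subseteq> E" "E \<subseteq> dual_space sV" "\<not> FS.dependent E" "card E = k + 1" by blast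
  have "W \<subseteq> FS.span E" using B(3) FS.span_mono[OF E(1)] by blast
  then show ?thesis using span_in_grassmannian[OF vector_space_V E(2-4)] by blast
qed

end

section \<open>Steiner bundles\<close>

lemma separate_points:
  assumes "vector_space sT" "\<And>l. l \<in> dual_space sT \<Longrightarrow> l x = l y"
  shows "x = y"
proof (rule ccontr)
  assume ne: "x \<noteq> y"
  interpret T: vector_space sT by fact
  interpret TK: vector_space_pair sT "(*) :: 'a \<Rightarrow> 'a \<Rightarrow> 'a"
    by unfold_locales (auto simp: algebra_simps)
  have "\<not> T.dependent {x - y}" using ne by simp
  from TK.linear_independent_extend[OF this, of "\<lambda>_. 1"]
  obtain l where l: "Vector_Spaces.linear sT (*) l" "l (x - y) = 1" by auto
  then have "l \<in> dual_space sT" by (simp add: dual_space_def)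
  from assms(2)[OF this] l(2) TK.linear_diff[OF l(1)] show False by simp
qed

lemma id_dual: "(\<lambda>x. x) \<in> dual_space ((*) :: 'k::field \<Rightarrow> 'k \<Rightarrow> 'k)"
proof -
  have "vector_space ((*) :: 'k \<Rightarrow> 'k \<Rightarrow> 'k)" by unfold_locales (auto simp: algebra_simps)
  from dual_space_iff[OF this] show ?thesis by auto
qed

lemma tensor_elem_id: "tensor_elem sT (*) t c (\<lambda>x. x) = sT c t"
  by (simp add: tensor_elem_def id_dual)

text \<open>The fibre \<open>T \<otimes> 'k\<close> consists of functions on the dual of the field, a line spanned by the identity.
Evaluation at the identity identifies this fibre with \<open>T\<close>.\<close>

lemma tensor_space_line_eq_0:
  assumes T: "vector_space sT" and g: "g \<in> tensor_space sT (*) UNIV" and 0: "g (\<lambda>x. x) = 0"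
  shows "g = 0"
proof -
  interpret T: vector_space sT by (rule T)
  interpret G: vector_space "fscale sT" by (rule vector_space_fscale[OF T])
  have K: "vector_space ((*) :: 'a \<Rightarrow> 'a \<Rightarrow> 'a)" by unfold_locales (auto simp: algebra_simps)
  have "\<forall>l. g l = (if l \<in> dual_space (*) then sT (l 1) (g (\<lambda>x. x)) else 0)"
    using g unfolding tensor_space_def
  proof (induction rule: G.span_induct_alt)
    case base
    show ?case by simp
  next
    case (step c x y)
    then obtain t e where x: "x = tensor_elem sT (*) t e" by blast
    have "l e = e * l 1" if "l \<in> dual_space (*)" for l :: "'a \<Rightarrow> 'a"
      using that[unfolded dual_space_iff[OF K]] by (metis mult.right_neutral)
    then have xl: "x l = (if l \<in> dual_space (*) then sT (l 1) (x (\<lambda>x. x)) else 0)" for l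
      unfolding x tensor_elem_id by (simp add: tensor_elem_def mult.commute)
    show ?case
    proof
      fix l
      show "(fscale sT c x + y) l = (if l \<in> dual_space (*) then sT (l 1) ((fscale sT c x + y) (\<lambda>x. x)) else 0)"
        using xl[of l] spec[OF step.IH, of l]
        by (simp add: fscale_def T.scale_right_distrib mult.commute)
    qed
  qed
  with 0 show ?thesis by (auto simp: fun_eq_iff)
qed

lemma tensor_elem_mem: "vector_space sS \<Longrightarrow> e \<in> A \<Longrightarrow> tensor_elem sS sE s e \<in> tensor_space sS sE A"
proof -
  assume S: "vector_space sS" and e: "e \<in> A"
  interpret G: vector_space "fscale sS" by (rule vector_space_fscale[OF S])
  show ?thesis unfolding tensor_space_def by (rule G.span_base) (use e in blast)
qed

locale steiner = finite_dim_V sV BV k + S: finite_dimensional_vector_space sS BS + T: finite_dimensional_vector_space sT BT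
  for sV :: "'k::{alg_closed_field, field_char_0} \<Rightarrow> 'v::ab_group_add \<Rightarrow> 'v" and BV k
    and sS :: "'k \<Rightarrow> 's::ab_group_add \<Rightarrow> 's" and BS and sT :: "'k \<Rightarrow> 't::ab_group_add \<Rightarrow> 't" and BT +
  fixes \<phi> \<psi> and F :: "(('v \<Rightarrow> 'k) set, 'k, 'f::ab_group_add) vbundle"
  assumes resolution: "steiner_resolution sV k sS sT \<phi> \<psi> F"
begin

lemma SV: "vector_space sS" and TV: "vector_space sT"
  by (rule S.vector_space_axioms, rule T.vector_space_axioms)

sublocale SF: vector_space "fscale sS" by (rule vector_space_fscale[OF SV])
sublocale TF: vector_space "fscale sT" by (rule vector_space_fscale[OF TV])

abbreviation "fibreA L \<equiv> tensor_space sS (fscale (*)) (L :: ('v \<Rightarrow> 'k) set)"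
abbreviation "fibreB \<equiv> tensor_space sT ((*) :: 'k \<Rightarrow> 'k \<Rightarrow> 'k) UNIV"

lemma subspace_fibreA: "SF.subspace (fibreA L)" and subspace_fibreB: "TF.subspace fibreB"
  unfolding tensor_space_def by simp_all

lemma bundle_simps:
  "fibre (tensor_bundle sS (universal_bundle sV k)) L = fibreA L"
  "scl (tensor_bundle sS (universal_bundle sV k)) = fscale sS"
  "fibre (tensor_bundle sT (trivial_line_bundle (regular_on sV k))) L = fibreB"
  "scl (tensor_bundle sT (trivial_line_bundle (regular_on sV k))) = fscale sT"
  by (simp_all add: tensor_bundle_def universal_bundle_def trivial_line_bundle_def)

lemma bundle_homs:
  "bundle_hom (zariski sV k) (tensor_bundle sS (universal_bundle sV k))
    (tensor_bundle sT (trivial_line_bundle (regular_on sV k))) \<phi>"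
  "bundle_hom (zariski sV k) (tensor_bundle sT (trivial_line_bundle (regular_on sV k))) F \<psi>"
  using resolution unfolding steiner_resolution_def short_exact_bundles_def by blast+

lemma phi_linear:
  assumes "L \<in> grassmannian sV k"
  shows "x \<in> fibreA L \<Longrightarrow> \<phi> L x \<in> fibreB"
    and "x \<in> fibreA L \<Longrightarrow> y \<in> fibreA L \<Longrightarrow> \<phi> L (x + y) = \<phi> L x + \<phi> L y"
    and "x \<in> fibreA L \<Longrightarrow> \<phi> L (fscale sS c x) = fscale sT c (\<phi> L x)"
  using bundle_homs(1)[unfolded bundle_hom_def bundle_simps topspace_zariski, THEN conjunct1,
    THEN bspec, OF assms] by blast+

lemma psi_linear:
  assumes "L \<in> grassmannian sV k"
  shows "x \<in> fibreB \<Longrightarrow> y \<in> fibreB \<Longrightarrow> \<psi> L (x + y) = \<psi> L x + \<psi> L y"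
    and "x \<in> fibreB \<Longrightarrow> \<psi> L (fscale sT c x) = scl F c (\<psi> L x)"
  using bundle_homs(2)[unfolded bundle_hom_def bundle_simps topspace_zariski, THEN conjunct1,
    THEN bspec, OF assms] by blast+

lemma exactness:
  assumes "L \<in> grassmannian sV k"
  shows "inj_on (\<phi> L) (fibreA L)" "\<phi> L ` fibreA L = {b \<in> fibreB. \<psi> L b = 0}" "\<psi> L ` fibreB = fibre F L"
  using resolution[unfolded steiner_resolution_def short_exact_bundles_def bundle_simps topspace_zariski,
    THEN conjunct2, THEN conjunct2, THEN bspec, OF assms] by blast+

lemma phi_section:
  assumes "openin (zariski sV k) W" "\<sigma> \<in> sections (universal_bundle sV k) W"
  shows "\<exists>m t \<tau>. (\<forall>j<m. \<tau> j \<in> regular_on sV k W) \<and>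
    (\<forall>L\<in>W. \<phi> L (tensor_elem sS (fscale (*)) s (\<sigma> L)) = (\<Sum>j<(m::nat). tensor_elem sT (*) (t j) (\<tau> j L)))"
proof -
  have sec: "(\<lambda>L. tensor_elem sS (fscale (*)) s (\<sigma> L)) \<in> sections (tensor_bundle sS (universal_bundle sV k)) W"
    using assms(2) by (auto simp: tensor_bundle_def universal_bundle_def intro!: exI[of _ "1::nat"] exI[of _ "\<lambda>_. s"] exI[of _ "\<lambda>_. \<sigma>"])
  have "(\<lambda>L. \<phi> L (tensor_elem sS (fscale (*)) s (\<sigma> L))) \<in>
      sections (tensor_bundle sT (trivial_line_bundle (regular_on sV k))) W"
    by (rule bundle_homs(1)[unfolded bundle_hom_def, THEN conjunct2, THEN spec, THEN mp, OF assms(1), THEN bspec, OF sec])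
  then show ?thesis
    by (simp only: tensor_bundle_def trivial_line_bundle_def vbundle.select_convs mem_Collect_eq)
qed

text \<open>The map \<open>\<phi>\<close> on the summand \<open>s \<otimes> U\<close> of its source, with values in \<open>T\<close> itself.\<close>

definition component :: "'s \<Rightarrow> ('v \<Rightarrow> 'k) set \<Rightarrow> ('v \<Rightarrow> 'k) \<Rightarrow> 't"
  where "component s L \<zeta> = \<phi> L (tensor_elem sS (fscale (*)) s \<zeta>) (\<lambda>x. x)"

lemma component_linear:
  assumes "L \<in> grassmannian sV k" "a \<in> L"
  shows "b \<in> L \<Longrightarrow> component s L (a + b) = component s L a + component s L b"
    and "component s L (fscale (*) c a) = sT c (component s L a)"
    and "component (s + s') L a = component s L a + component s' L a"
    and "component (sS c s) L a = sT c (component s L a)"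
proof -
  have mem: "tensor_elem sS (fscale (*)) s x \<in> fibreA L" if "x \<in> L" for s x
    using that by (rule tensor_elem_mem[OF SV])
  note bilin = tensor_elem_bilinear[OF SV vector_space_functions]
  have app: "fscale sT c f i = sT c (f i)" for c and f :: "('k \<Rightarrow> 'k) \<Rightarrow> 't" and i
    by (simp add: fscale_def)
  show "component s L (a + b) = component s L a + component s L b" if "b \<in> L"
    by (simp only: component_def bilin(2) phi_linear(2)[OF assms(1) mem[OF assms(2)] mem[OF that]] plus_fun_apply)
  show "component s L (fscale (*) c a) = sT c (component s L a)"
    by (simp only: component_def bilin(4) phi_linear(3)[OF assms(1) mem[OF assms(2)]] app)
  show "component (s + s') L a = component s L a + component s' L a"
    by (simp only: component_def bilin(1) phi_linear(2)[OF assms(1) mem[OF assms(2)] mem[OF assms(2)]] plus_fun_apply)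
  show "component (sS c s) L a = sT c (component s L a)"
    by (simp only: component_def bilin(3) phi_linear(3)[OF assms(1) mem[OF assms(2)]] app)
qed

lemma component_regular:
  assumes l: "l \<in> dual_space sT"
  shows "regular_functional sV k (\<lambda>L \<zeta>. l (component s L \<zeta>))"
proof -
  have lin: "l (x + y) = l x + l y" "l (sT c x) = c * l x" for x y c
    using l unfolding dual_space_iff[OF TV] by auto
  have l0: "l 0 = 0" using lin(2)[of 0 0] by simp
  have lsum: "l (\<Sum>j<m. f j) = (\<Sum>j<m. l (f j))" for f :: "nat \<Rightarrow> 't" and m :: nat
    by (induction m) (simp_all add: lin l0)
  show ?thesis
    unfolding regular_functional_def
  proof (intro conjI ballI allI impI)
    fix L a b c assume L: "L \<in> grassmannian sV k" and a: "a \<in> L"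
    show "l (component s L (a + b)) = l (component s L a) + l (component s L b)" if "b \<in> L"
      using component_linear(1)[OF L a that] by (simp add: lin)
    show "l (component s L (fscale (*) c a)) = c * l (component s L a)"
      using component_linear(2)[OF L a] by (simp add: lin)
  next
    fix W \<sigma> assume "openin (zariski sV k) W" "\<sigma> \<in> sections (universal_bundle sV k) W"
    from phi_section[OF this, of s] obtain m :: nat and t \<tau> where *: "\<forall>j<m. \<tau> j \<in> regular_on sV k W"
      "\<forall>L\<in>W. \<phi> L (tensor_elem sS (fscale (*)) s (\<sigma> L)) = (\<Sum>j<m. tensor_elem sT (*) (t j) (\<tau> j L))"
      by (elim exE conjE)
    have "l (component s L (\<sigma> L)) = (\<Sum>j<m. l (t j) * \<tau> j L)" if "L \<in> W" for L
      using *(2) that by (simp add: component_def fun_sum_apply tensor_elem_id lsum lin mult.commute)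
    with *(1) show "\<exists>m c \<tau>. (\<forall>j<m. \<tau> j \<in> regular_on sV k W) \<and> (\<forall>L\<in>W. l (component s L (\<sigma> L)) = (\<Sum>j<(m::nat). c j * \<tau> j L))"
      by (intro exI[of _ m] exI[of _ "\<lambda>j. l (t j)"] exI[of _ \<tau>]) blast
  qed
qed

lemma component_extension:
  assumes kn: "k + 2 \<le> card BV"
  shows "\<exists>f. (\<forall>a\<in>dual_space sV. \<forall>b\<in>dual_space sV. f (a + b) = f a + f b) \<and>
    (\<forall>c. \<forall>a\<in>dual_space sV. f (fscale (*) c a) = sT c (f a)) \<and>
    (\<forall>L\<in>grassmannian sV k. \<forall>\<zeta>\<in>L. component s L \<zeta> = f \<zeta>)"
proof (rule linear_extension[OF TV _ _ _ kn])
  show "component s L (a + b) = component s L a + component s L b" if "L \<in> grassmannian sV k" "a \<in> L" "b \<in> L" for L a b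
    by (rule component_linear(1)[OF that])
  show "component s L (fscale (*) c a) = sT c (component s L a)" if "L \<in> grassmannian sV k" "a \<in> L" for L a c
    by (rule component_linear(2)[OF that])
  fix C :: "('v \<Rightarrow> 'k) set" and \<eta>0 \<eta>1
  assume *: "insert \<eta>0 (insert \<eta>1 C) \<subseteq> dual_space sV" "\<not> FS.dependent (insert \<eta>0 (insert \<eta>1 C))"
    "\<eta>0 \<noteq> \<eta>1" "\<eta>0 \<notin> C" "\<eta>1 \<notin> C" "finite C" "card C = k"
  show "component s (FS.span (insert (\<eta>0 + \<eta>1) C)) (\<eta>0 + \<eta>1) =
      component s (FS.span (insert \<eta>0 C)) \<eta>0 + component s (FS.span (insert \<eta>1 C)) \<eta>1"
  proof (rule separate_points[OF TV])
    fix l assume l: "l \<in> dual_space sT"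
    then have lin: "l (x + y) = l x + l y" for x y unfolding dual_space_iff[OF TV] by auto
    from pencil_additive[OF component_regular[OF l] *]
    show "l (component s (FS.span (insert (\<eta>0 + \<eta>1) C)) (\<eta>0 + \<eta>1)) =
        l (component s (FS.span (insert \<eta>0 C)) \<eta>0 + component s (FS.span (insert \<eta>1 C)) \<eta>1)"
      by (simp only: lin)
  qed
qed

lemma phi_sum:
  assumes L: "L \<in> grassmannian sV k" and x: "\<And>i. i < r \<Longrightarrow> x i \<in> fibreA L"
  shows "(\<Sum>i<(r::nat). x i) \<in> fibreA L \<and> \<phi> L (\<Sum>i<r. x i) = (\<Sum>i<r. \<phi> L (x i))"
  using x
proof (induction r)
  case 0
  have 0: "0 \<in> fibreA L" by (rule SF.subspace_0[OF subspace_fibreA])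
  from phi_linear(3)[OF L this, of 0] have "\<phi> L 0 = 0" by (simp only: SF.scale_zero_left TF.scale_zero_left)
  with 0 show ?case unfolding lessThan_0 sum.empty by blast
next
  case (Suc r)
  then have IH: "(\<Sum>i<r. x i) \<in> fibreA L" "\<phi> L (\<Sum>i<r. x i) = (\<Sum>i<r. \<phi> L (x i))" "x r \<in> fibreA L" by auto
  from phi_linear(2)[OF L IH(1,3)] IH(2) SF.subspace_add[OF subspace_fibreA IH(1,3)]
  show ?case unfolding sum.lessThan_Suc by (simp only: simp_thms)
qed

text \<open>Injectivity of \<open>\<phi>\<close> in the fibre of \<open>L\<close>, in terms of components.\<close>

lemma component_injective:
  assumes L: "L \<in> grassmannian sV k" and e: "inj_on e {..<r}" "\<not> S.dependent (e ` {..<(r::nat)})"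
    and \<zeta>: "\<And>i. i < r \<Longrightarrow> \<zeta> i \<in> L" and zero: "(\<Sum>i<r. component (e i) L (\<zeta> i)) = 0" and i: "i < r"
  shows "\<zeta> i = 0"
proof -
  define x where "x = (\<Sum>i<r. tensor_elem sS (fscale (*)) (e i) (\<zeta> i))"
  have mem: "tensor_elem sS (fscale (*)) (e i) (\<zeta> i) \<in> fibreA L" if "i < r" for i
    using tensor_elem_mem[OF SV \<zeta>[OF that]] .
  from phi_sum[OF L, where r = r and x = "\<lambda>i. tensor_elem sS (fscale (*)) (e i) (\<zeta> i)"] mem have x: "x \<in> fibreA L"
    "\<phi> L x = (\<Sum>i<r. \<phi> L (tensor_elem sS (fscale (*)) (e i) (\<zeta> i)))" unfolding x_def by blast+
  have "\<phi> L x (\<lambda>x. x) = 0" using zero by (simp add: x(2) fun_sum_apply component_def)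
  from tensor_space_line_eq_0[OF TV phi_linear(1)[OF L x(1)] this] have "\<phi> L x = 0" .
  moreover have "\<phi> L 0 = 0" using phi_sum[OF L, of 0 "\<lambda>_. 0"] by simp
  ultimately have "x = 0"
    using exactness(1)[OF L] x(1) SF.subspace_0[OF subspace_fibreA] by (metis inj_onD)
  then show ?thesis
    using tensor_elem_sum_eq_0[OF SV vector_space_functions finite_lessThan e] i unfolding x_def by blast
qed

text \<open>The components extend to linear maps \<open>f s\<close> on the dual of \<open>V\<close>, that is to a linear map on all
\<open>s \<times> N\<close> matrices. A matrix of rank at most \<open>k + 1\<close> in the kernel has its rows in a common \<open>L\<close>, so it is \<open>0\<close>
by injectivity in the fibre of \<open>L\<close>. The coordinates of \<open>T\<close> are therefore \<open>dim T\<close> linear forms without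
common zero other than \<open>0\<close> on the cone of these matrices. The minimum covers the case where \<open>S\<close> has dimension less
than \<open>k + 1\<close> and every matrix has rank at most \<open>k + 1\<close>.\<close>

lemma dim_T_ge:
  assumes kn: "k + 2 \<le> card BV"
  defines "m \<equiv> min (k + 1) (card BS)"
  shows "m * (card BS + card BV - m) \<le> card BT"
proof -
  obtain e where e: "bij_betw e {..<card BS} BS"
    using ex_bij_betw_nat_finite[OF S.finite_Basis] by (auto simp: atLeast0LessThan)
  obtain t where t: "bij_betw t {..<card BT} BT"
    using ex_bij_betw_nat_finite[OF T.finite_Basis] by (auto simp: atLeast0LessThan)
  obtain b \<delta> where \<delta>: "\<forall>j<card BV. \<delta> j \<in> dual_space sV"
    "\<forall>i<card BV. \<forall>j<card BV. \<delta> i (b j) = (if i = j then 1 else 0)" by (rule dual_basis)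
  from component_extension[OF kn] obtain f where
    f: "\<forall>s. (\<forall>a\<in>dual_space sV. \<forall>b\<in>dual_space sV. f s (a + b) = f s a + f s b) \<and>
    (\<forall>c. \<forall>a\<in>dual_space sV. f s (fscale (*) c a) = sT c (f s a)) \<and>
    (\<forall>L\<in>grassmannian sV k. \<forall>\<zeta>\<in>L. component s L \<zeta> = f s \<zeta>)" by metis
  have D: "FS.subspace (dual_space sV)" by (rule subspace_dual_space[OF vector_space_V])
  have comb: "(\<lambda>u. \<Sum>j<r. a j * w j u) \<in> dual_space sV \<and> f s (\<lambda>u. \<Sum>j<r. a j * w j u) = (\<Sum>j<r. sT (a j) (f s (w j)))"
    if "\<And>j. j < r \<Longrightarrow> w j \<in> dual_space sV" for r :: nat and a w s
  proof -
    have "(\<Sum>j<r. fscale (*) (a j) (w j)) \<in> dual_space sV \<and>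
        f s (\<Sum>j<r. fscale (*) (a j) (w j)) = (\<Sum>j<r. sT (a j) (f s (w j)))"
      using that
    proof (induction r)
      case 0
      have 0: "0 \<in> dual_space sV" by (rule FS.subspace_0[OF D])
      have "f s (fscale (*) 0 0) = sT 0 (f s 0)" using f 0 by blast
      then have "f s 0 = 0" by (simp only: FS.scale_zero_left T.scale_zero_left)
      with 0 show ?case unfolding lessThan_0 sum.empty by blast
    next
      case (Suc r)
      then have IH: "(\<Sum>j<r. fscale (*) (a j) (w j)) \<in> dual_space sV"
        "f s (\<Sum>j<r. fscale (*) (a j) (w j)) = (\<Sum>j<r. sT (a j) (f s (w j)))" "w r \<in> dual_space sV" by auto
      have 1: "fscale (*) (a r) (w r) \<in> dual_space sV" by (rule FS.subspace_scale[OF D IH(3)])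
      have "f s ((\<Sum>j<r. fscale (*) (a j) (w j)) + fscale (*) (a r) (w r)) =
          f s (\<Sum>j<r. fscale (*) (a j) (w j)) + f s (fscale (*) (a r) (w r))" using f IH(1) 1 by blast
      also have "f s (fscale (*) (a r) (w r)) = sT (a r) (f s (w r))" using f IH(3) by blast
      finally show ?case using FS.subspace_add[OF D IH(1) 1] IH(2) unfolding sum.lessThan_Suc by (simp only: simp_thms)
    qed
    moreover have "(\<Sum>j<r. fscale (*) (a j) (w j)) = (\<lambda>u. \<Sum>j<r. a j * w j u)"
      by (simp add: fun_eq_iff fun_sum_apply fscale_apply)
    ultimately show ?thesis by simp
  qed
  define Y where "Y l ij = T.representation BT (f (e (fst ij)) (\<delta> (snd ij))) (t l)" for l ij
  show ?thesis
  proof (rule linear_space_avoiding_rank_le[where Y = Y])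
    show "m \<le> card BS" "m \<le> card BV" using kn by (auto simp: m_def)
    fix A :: "nat \<times> nat \<Rightarrow> 'k" and i j
    assume A: "A \<in> rank_le (card BS) (card BV) m"
      and zero: "\<And>l. l < card BT \<Longrightarrow> (\<Sum>ij\<in>{..<card BS} \<times> {..<card BV}. Y l ij * A ij) = 0"
      and ij: "i < card BS" "j < card BV"
    from A obtain B C where BC: "\<forall>i<card BS. \<forall>j<card BV. A (i, j) = (\<Sum>l<m. B i l * C l j)"
      unfolding rank_le_def by blast
    define \<xi> where "\<xi> i = (\<lambda>u. \<Sum>j<card BV. A (i, j) * \<delta> j u)" for i
    define \<omega> where "\<omega> l = (\<lambda>u. \<Sum>j<card BV. C l j * \<delta> j u)" for l
    have \<xi>_eq: "\<xi> i = (\<lambda>u. \<Sum>l<m. B i l * \<omega> l u)" if "i < card BS" for i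
    proof
      fix u
      have "\<xi> i u = (\<Sum>j<card BV. \<Sum>l<m. B i l * (C l j * \<delta> j u))"
        unfolding \<xi>_def using BC that by (intro sum.cong) (auto simp: sum_distrib_right mult.assoc)
      also have "\<dots> = (\<Sum>l<m. B i l * \<omega> l u)" by (subst sum.swap) (simp add: \<omega>_def sum_distrib_left)
      finally show "\<xi> i u = (\<Sum>l<m. B i l * \<omega> l u)" .
    qed
    have \<omega>D: "\<omega> l \<in> dual_space sV" for l unfolding \<omega>_def using comb[of "card BV" \<delta>] \<delta>(1) by blast
    have "card (\<omega> ` {..<m}) \<le> k + 1" using card_image_le[of "{..<m}" \<omega>] by (simp add: m_def)
    with subspace_in_grassmannian_point[of "\<omega> ` {..<m}"] \<omega>D kn obtain L where
      L: "L \<in> grassmannian sV k" "\<omega> ` {..<m} \<subseteq> L" by auto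
    have "\<xi> i \<in> L" if "i < card BS" for i
    proof -
      have "FS.subspace L" using L(1) by (simp add: grassmannian_def)
      then have "FS.span (\<omega> ` {..<m}) \<subseteq> L" using L(2) by (intro FS.span_minimal)
      with span_combination[where r = m and \<xi> = \<omega>] show ?thesis unfolding \<xi>_eq[OF that] by blast
    qed
    moreover have "(\<Sum>i<card BS. component (e i) L (\<xi> i)) = 0"
    proof -
      have "(\<Sum>i<card BS. component (e i) L (\<xi> i)) = (\<Sum>i<card BS. f (e i) (\<xi> i))"
        using f L(1) calculation by (intro sum.cong) auto
      also have "\<dots> = (\<Sum>i<card BS. \<Sum>j<card BV. sT (A (i, j)) (f (e i) (\<delta> j)))"
        unfolding \<xi>_def using comb[of "card BV" \<delta>] \<delta>(1) by (intro sum.cong) auto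
      also have "\<dots> = (\<Sum>ij\<in>{..<card BS} \<times> {..<card BV}. sT (A ij) (f (e (fst ij)) (\<delta> (snd ij))))"
        by (simp add: sum.cartesian_product case_prod_unfold)
      finally have eq: "(\<Sum>i<card BS. component (e i) L (\<xi> i)) =
          (\<Sum>ij\<in>{..<card BS} \<times> {..<card BV}. sT (A ij) (f (e (fst ij)) (\<delta> (snd ij))))" (is "?lhs = ?rhs") .
      have "T.representation BT ?rhs v = 0" if v: "v \<in> BT" for v
      proof -
        from v t obtain l where l: "l < card BT" "v = t l" by (auto simp: bij_betw_def)
        have "T.representation BT ?rhs v = (\<Sum>ij\<in>{..<card BS} \<times> {..<card BV}. Y l ij * A ij)"
          by (simp add: T.representation_sum[OF T.independent_Basis] T.span_Basis
              T.representation_scale[OF T.independent_Basis] Y_def l(2) mult.commute)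
        with zero[OF l(1)] show ?thesis by simp
      qed
      moreover have "(\<Sum>v\<in>BT. sT (T.representation BT ?rhs v) v) = ?rhs"
        by (rule T.sum_representation_eq[OF T.independent_Basis]) (auto simp: T.span_Basis T.finite_Basis)
      ultimately show ?thesis unfolding eq by simp
    qed
    ultimately have "\<xi> i = 0"
      using component_injective[OF L(1), of e "card BS" \<xi> i] e S.independent_Basis ij(1) by (auto simp: bij_betw_def)
    then have "\<xi> i (b j) = 0" by simp
    moreover have "\<xi> i (b j) = (\<Sum>j'<card BV. if j' = j then A (i, j') else 0)"
      unfolding \<xi>_def using \<delta>(2) ij(2) by (intro sum.cong) auto
    ultimately show "A (i, j) = 0" using ij(2) by simp
  qed
qed

lemma component_span:
  assumes L: "L \<in> grassmannian sV k" and \<xi>: "indexed_basis (fscale (*)) (k + 1) \<xi> L" and x: "x \<in> fibreA L"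
  shows "\<phi> L x (\<lambda>x. x) \<in> T.span ((\<lambda>(s, i). component s L (\<xi> i)) ` (BS \<times> {..<k + 1}))" (is "_ \<in> T.span ?Z")
proof -
  have sub: "FS.subspace L" using L by (simp add: grassmannian_def)
  have \<xi>L: "FS.span (\<xi> ` {..<k + 1}) = L" using \<xi> by (simp add: indexed_basis_def)
  have 1: "component s L (\<xi> i) \<in> T.span ?Z" if i: "i < k + 1" for s i
  proof -
    have mem: "\<xi> i \<in> L" using i \<xi>L FS.span_base[of "\<xi> i" "\<xi> ` {..<k + 1}"] by auto
    have "s \<in> S.span BS" by (simp add: S.span_Basis)
    then show ?thesis
    proof (induction rule: S.span_induct_alt)
      case base
      have "component 0 L (\<xi> i) = sT 0 (component 0 L (\<xi> i))" using component_linear(4)[OF L mem, of 0 0] by simp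
      then show ?case by (simp add: T.span_zero)
    next
      case (step c s s')
      have "component s L (\<xi> i) \<in> T.span ?Z" using step.hyps i by (intro T.span_base) force
      with step.IH show ?case
        by (simp only: component_linear(3,4)[OF L mem] T.span_add T.span_scale)
    qed
  qed
  have 2: "component s L \<zeta> \<in> T.span ?Z" if "\<zeta> \<in> L" for s \<zeta>
  proof -
    from that have "\<zeta> \<in> FS.span (\<xi> ` {..<k + 1})" by (simp only: \<xi>L)
    then have "\<zeta> \<in> L \<and> component s L \<zeta> \<in> T.span ?Z"
    proof (induction rule: FS.span_induct_alt)
      case base
      have 0: "0 \<in> L" by (rule FS.subspace_0[OF sub])
      have "component s L 0 = sT 0 (component s L 0)" using component_linear(2)[OF L 0, of s 0] by (simp only: FS.scale_zero_left)
      then have "component s L 0 = 0" by simp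
      with 0 show ?case by (simp only: T.span_zero simp_thms)
    next
      case (step c a \<zeta>)
      then obtain i where i: "i < k + 1" "a = \<xi> i" by auto
      have a: "a \<in> L" using FS.span_base[OF step.hyps(1)] by (simp only: \<xi>L)
      have ca: "fscale (*) c a \<in> L" by (rule FS.subspace_scale[OF sub a])
      have \<zeta>: "\<zeta> \<in> L" "component s L \<zeta> \<in> T.span ?Z" using step.IH by simp_all
      have "component s L a \<in> T.span ?Z" unfolding i(2) by (rule 1[OF i(1)])
      from T.span_add[OF T.span_scale[OF this] \<zeta>(2), of c]
      have "component s L (fscale (*) c a + \<zeta>) \<in> T.span ?Z"
        by (simp only: component_linear(1)[OF L ca \<zeta>(1)] component_linear(2)[OF L a])
      with FS.subspace_add[OF sub ca \<zeta>(1)] show ?case by (rule conjI)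
    qed
    then show ?thesis by blast
  qed
  from x[unfolded tensor_space_def] have "x \<in> fibreA L \<and> \<phi> L x (\<lambda>x. x) \<in> T.span ?Z"
  proof (induction rule: SF.span_induct_alt)
    case base
    have "\<phi> L 0 = 0" using phi_sum[OF L, of 0 "\<lambda>_. 0"] by simp
    then have "\<phi> L 0 (\<lambda>x. x) \<in> T.span ?Z" by (simp add: T.span_zero)
    with SF.subspace_0[OF subspace_fibreA] show ?case by (rule conjI)
  next
    case (step c a x)
    from step.hyps(1) obtain s \<zeta> where a: "a = tensor_elem sS (fscale (*)) s \<zeta>" "\<zeta> \<in> L" by blast
    have aA: "a \<in> fibreA L" unfolding a(1) by (rule tensor_elem_mem[OF SV a(2)])
    have x: "x \<in> fibreA L" "\<phi> L x (\<lambda>x. x) \<in> T.span ?Z" using step.IH by simp_all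
    have caA: "fscale sS c a \<in> fibreA L" by (rule SF.subspace_scale[OF subspace_fibreA aA])
    have "component s L \<zeta> = \<phi> L a (\<lambda>x. x)" by (simp only: component_def a(1))
    then have "fscale sT c (\<phi> L a) (\<lambda>x. x) = sT c (component s L \<zeta>)" by (simp add: fscale_def)
    then have "\<phi> L (fscale sS c a + x) (\<lambda>x. x) = sT c (component s L \<zeta>) + \<phi> L x (\<lambda>x. x)"
      by (simp only: phi_linear(2)[OF L caA x(1)] phi_linear(3)[OF L aA] plus_fun_apply)
    with T.span_add[OF T.span_scale[OF 2[OF a(2)]] x(2)]
    have "\<phi> L (fscale sS c a + x) (\<lambda>x. x) \<in> T.span ?Z" by (simp only:)
    with SF.subspace_add[OF subspace_fibreA caA x(1)] show ?case by (rule conjI)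
  qed
  then show ?thesis by (rule conjunct2)
qed

text \<open>By exactness in the fibre of \<open>L\<close>, lifts of a basis of the fibre of \<open>F\<close> and the images of the tensors of
basis elements span \<open>T\<close>.\<close>

lemma dim_T_le:
  assumes F: "vector_bundle (zariski sV k) (regular_on sV k) F r" and ne: "L \<in> grassmannian sV k"
  shows "card BT \<le> card BS * (k + 1) + r"
proof -
  have L: "L \<in> topspace (zariski sV k)" using ne by (simp add: topspace_zariski)
  have FV: "vector_space (scl F)" using F unfolding vector_bundle_def by (rule conjunct1)
  interpret FV: vector_space "scl F" by (rule FV)
  from F[unfolded vector_bundle_def, THEN conjunct2, THEN conjunct2, THEN conjunct2, THEN conjunct2, THEN bspec, OF L]
  obtain U e where "L \<in> U" "\<forall>y\<in>U. indexed_basis (scl F) r (\<lambda>i. e i y) (fibre F y)"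
    by (elim exE conjE)
  then have "indexed_basis (scl F) r (\<lambda>i. e i L) (fibre F L)" by (rule bspec[rotated])
  then obtain \<epsilon> where \<epsilon>: "indexed_basis (scl F) r \<epsilon> (fibre F L)" ..
  have span\<epsilon>: "FV.span (\<epsilon> ` {..<r}) = fibre F L" using \<epsilon> by (simp add: indexed_basis_def)
  have "\<exists>g. g \<in> fibreB \<and> \<psi> L g = \<epsilon> i" if "i < r" for i
  proof -
    have "\<epsilon> i \<in> fibre F L" using that span\<epsilon> FV.span_base[of "\<epsilon> i" "\<epsilon> ` {..<r}"] by auto
    then show ?thesis unfolding exactness(3)[OF ne, symmetric] by auto
  qed
  then obtain g where g: "\<And>i. i < r \<Longrightarrow> g i \<in> fibreB" "\<And>i. i < r \<Longrightarrow> \<psi> L (g i) = \<epsilon> i" by metis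
  from grassmannian_indexed_basis[OF ne] obtain \<xi> where \<xi>: "indexed_basis (fscale (*)) (k + 1) \<xi> L" by blast
  define Z1 where "Z1 = (\<lambda>(s, i). component s L (\<xi> i)) ` (BS \<times> {..<k + 1})"
  define Z2 where "Z2 = (\<lambda>i. g i (\<lambda>x. x)) ` {..<r}"
  have lift: "\<exists>h\<in>fibreB. \<psi> L h = y \<and> h (\<lambda>x. x) \<in> T.span Z2" if "y \<in> fibre F L" for y
    using that unfolding span\<epsilon>[symmetric]
  proof (induction rule: FV.span_induct_alt)
    case base
    have 0: "0 \<in> fibreB" by (rule TF.subspace_0[OF subspace_fibreB])
    from psi_linear(2)[OF ne this, of 0] have \<psi>0: "\<psi> L 0 = 0" by (simp only: TF.scale_zero_left FV.scale_zero_left)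
    have "(0 :: ('k \<Rightarrow> 'k) \<Rightarrow> 't) (\<lambda>x. x) \<in> T.span Z2" by (simp add: T.span_zero)
    with \<psi>0 have "\<psi> L 0 = 0 \<and> (0 :: ('k \<Rightarrow> 'k) \<Rightarrow> 't) (\<lambda>x. x) \<in> T.span Z2" by (rule conjI)
    then show ?case by (rule bexI[where x = 0, OF _ 0])
  next
    case (step c a y)
    then obtain i where i: "i < r" "a = \<epsilon> i" by auto
    from step.IH obtain h where h: "h \<in> fibreB" "\<psi> L h = y" "h (\<lambda>x. x) \<in> T.span Z2" by blast
    have cg: "fscale sT c (g i) \<in> fibreB" by (rule TF.subspace_scale[OF subspace_fibreB g(1)[OF i(1)]])
    have "g i (\<lambda>x. x) \<in> T.span Z2" using i(1) unfolding Z2_def by (intro T.span_base imageI) simp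
    then have "(fscale sT c (g i) + h) (\<lambda>x. x) \<in> T.span Z2"
      using h(3) by (simp add: fscale_def T.span_add T.span_scale)
    moreover have "\<psi> L (fscale sT c (g i) + h) = scl F c a + y"
      using psi_linear(1)[OF ne cg h(1)] psi_linear(2)[OF ne g(1)[OF i(1)], of c] g(2)[OF i(1)] h(2) i(2) by simp
    ultimately show ?case using TF.subspace_add[OF subspace_fibreB cg h(1)] by blast
  qed
  have "UNIV \<subseteq> T.span (Z1 \<union> Z2)"
  proof
    fix t :: 't
    define x where "x = tensor_elem sT (*) t (1 :: 'k)"
    have x: "x \<in> fibreB" unfolding x_def by (rule tensor_elem_mem[OF TV]) simp
    have "\<psi> L x \<in> fibre F L" using x exactness(3)[OF ne] by blast
    from lift[OF this] obtain h where h: "h \<in> fibreB" "\<psi> L h = \<psi> L x" "h (\<lambda>x. x) \<in> T.span Z2" by blast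
    define h' where "h' = fscale sT (- 1) h"
    have h': "h' \<in> fibreB" unfolding h'_def by (rule TF.subspace_scale[OF subspace_fibreB h(1)])
    have "\<psi> L (x + h') = \<psi> L x + scl F (- 1) (\<psi> L h)"
      using psi_linear(1)[OF ne x h'] psi_linear(2)[OF ne h(1), of "- 1"] by (simp add: h'_def)
    also have "\<dots> = 0" by (simp add: h(2))
    finally have "x + h' \<in> {b \<in> fibreB. \<psi> L b = 0}" using TF.subspace_add[OF subspace_fibreB x h'] by blast
    then obtain z where z: "z \<in> fibreA L" "\<phi> L z = x + h'" unfolding exactness(2)[OF ne, symmetric] by auto
    have "(x + h') (\<lambda>x. x) \<in> T.span Z1" using component_span[OF ne \<xi> z(1)] unfolding z(2) Z1_def .
    then have 1: "(x + h') (\<lambda>x. x) \<in> T.span (Z1 \<union> Z2)" using T.span_mono[of Z1 "Z1 \<union> Z2"] by blast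
    have 2: "h (\<lambda>x. x) \<in> T.span (Z1 \<union> Z2)" using h(3) T.span_mono[of Z2 "Z1 \<union> Z2"] by blast
    have "t = (x + h') (\<lambda>x. x) + h (\<lambda>x. x)"
      by (simp add: x_def h'_def tensor_elem_id fscale_def)
    with T.span_add[OF 1 2] show "t \<in> T.span (Z1 \<union> Z2)" by simp
  qed
  moreover have fin: "finite (Z1 \<union> Z2)" unfolding Z1_def Z2_def using S.finite_Basis by auto
  ultimately have "card BT \<le> card (Z1 \<union> Z2)"
    using T.independent_span_bound[OF fin T.independent_Basis] by blast
  also have "\<dots> \<le> card Z1 + card Z2" by (rule card_Un_le)
  also have "card Z1 \<le> card BS * (k + 1)"
    using card_image_le[of "BS \<times> {..<k + 1}" "\<lambda>(s, i). component s L (\<xi> i)"] S.finite_Basis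
    unfolding Z1_def by (simp add: card_cartesian_product)
  also have "card Z2 \<le> r" using card_image_le[of "{..<r}" "\<lambda>i. g i (\<lambda>x. x)"] unfolding Z2_def by simp
  finally show ?thesis by simp
qed

end

text \<open>The two bounds for the dimension of \<open>T\<close> are compared in the cases \<open>dim S \<le> k + 1\<close> and \<open>dim S > k + 1\<close>.\<close>

theorem theorem1p3:
  fixes sV :: "'k::{alg_closed_field, field_char_0} \<Rightarrow> 'v::ab_group_add \<Rightarrow> 'v"
    and sS :: "'k \<Rightarrow> 's::ab_group_add \<Rightarrow> 's"
    and sT :: "'k \<Rightarrow> 't::ab_group_add \<Rightarrow> 't"
    and F :: "(('v \<Rightarrow> 'k) set, 'k, 'f::ab_group_add) vbundle"
    and k n r :: nat
  assumes "finite_dimensional_vector_space sV BV"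
    and "vector_space.dim sV (UNIV :: 'v set) = n + 1"
    and "k \<le> n"
    and "finite_dimensional_vector_space sS BS"
    and "finite_dimensional_vector_space sT BT"
    and "vector_bundle (zariski sV k) (regular_on sV k) F r"
    and "steiner_resolution sV k sS sT \<phi> \<psi> F"
  shows "r \<ge> min ((k + 1) * (n - k)) ((n - k) * vector_space.dim sS (UNIV :: 's set))"
proof (cases "k = n")
  case True
  then show ?thesis by simp
next
  case False
  interpret V: finite_dimensional_vector_space sV BV by fact
  interpret S: finite_dimensional_vector_space sS BS by fact
  interpret T: finite_dimensional_vector_space sT BT by fact
  interpret G: finite_dim_V sV BV k by unfold_locales
  interpret St: steiner sV BV k sS BS sT BT \<phi> \<psi> F
    by unfold_locales fact
  have N: "card BV = n + 1" using assms(2) by (simp add: V.dim_UNIV)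
  have s: "vector_space.dim sS (UNIV :: 's set) = card BS" by (simp add: S.dim_UNIV)
  define s where "s = card BS"
  have kn: "k + 2 \<le> card BV" using N False assms(3) by simp
  obtain L where L: "L \<in> grassmannian sV k"
    using G.subspace_in_grassmannian_point[of "{}"] kn by auto
  have ge: "min (k + 1) s * (s + (n + 1) - min (k + 1) s) \<le> s * (k + 1) + r"
    using St.dim_T_ge[OF kn] St.dim_T_le[OF assms(6) L] by (simp add: N s_def)
  obtain d where d: "n = k + d" using assms(3) le_Suc_ex by blast
  show ?thesis
  proof (cases "s \<le> k + 1")
    case True
    then have "min (k + 1) s = s" by simp
    with ge have "s * (n + 1) \<le> s * (k + 1) + r" by simp
    then have "d * s \<le> r" by (simp add: d algebra_simps)
    then show ?thesis by (simp add: s s_def[symmetric] d)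
  next
    case False
    then obtain a where a: "s = k + 1 + a" using le_Suc_ex[of "k + 1" s] by auto
    then have "min (k + 1) s = k + 1" by simp
    with ge have "(k + 1) * (s + (n + 1) - (k + 1)) \<le> s * (k + 1) + r" by simp
    then have "(k + 1) * d \<le> r" by (simp add: d algebra_simps)
    then show ?thesis by (simp add: s s_def[symmetric] d)
  qed
qed

end
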